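(* Let $U\subset\mathbb{R}^n$ be an open subset, $n\ge 2$, with a Riemannian metric $g$ whose sectional curvature is constant $-1$, and let $e_1,\dots,e_n$ be any orthonormal frame on $U$ with dual forms $\omega_i$ and connection forms $\omega_{ij}$. Let $W$ be the matrix of 1-forms with entries $(W)_{ij}=\omega_{ij}$. Then for any given $x^0\in U$ and any given initial condition $L(x^0)\in O(n)$ there exists a unique orthonormal frame $v_i=\sum_{j=1}^n L_{ij}e_j$, $L(x)\in O(n)$, defined locally near $x^0$ and having the given initial value $L(x^0)$, such that $L$ satisfies the integrable system of PDEs $$(dL\,L^t)_{1i}+(LWL^t)_{1i}+\sum_{k=1}^n L_{ik}\omega_k=0\qquad\text{for all } i\ge 2,$$ $$(dL\,L^t)_{ij}+(LWL^t)_{ij}=0\qquad\text{for all } i,j\ge 2,\ i\ne j.$$ In this case, $\sum_{k=1}^n L_{1k}\,\omega_k$ is a closed form.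
   Context: All data are smooth. For an orthonormal frame field $e_1,\dots,e_n$ on $(U,g)$ with Levi-Civita connection $\nabla$, the dual forms are the 1-forms $\omega_i$ with $\omega_i(e_j)=\delta_{ij}$, and the connection forms are $\omega_{ij}(X)=g(\nabla_X e_i,e_j)$, so $\omega_{ij}=-\omega_{ji}$. They satisfy $d\omega_i=\sum_{j\ne i}\omega_j\wedge\omega_{ji}$ and, since the sectional curvature is $-1$, $d\omega_{ij}=\sum_k\omega_{ik}\wedge\omega_{kj}+\omega_i\wedge\omega_j$. $O(n)$ is the group of orthogonal $n\times n$ real matrices, $L^t$ denotes the transpose of $L$, and $dL$ is the matrix of 1-forms $(dL)_{ij}=d(L_{ij})$. "Integrable" means completely integrable in the sense of Frobenius. Uniqueness means that two solutions with the same initial value at $x^0$ agree on a neighborhood of $x^0$. When $n=2$ the second family of equations is vacuous. *)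

theory Defs
  imports "HOL-Analysis.Analysis"
begin

primrec Ck_on :: "nat \<Rightarrow> 'a::real_normed_vector set \<Rightarrow> ('a \<Rightarrow> 'b::real_normed_vector) \<Rightarrow> bool" where
  "Ck_on 0 S f \<longleftrightarrow> continuous_on S f"
| "Ck_on (Suc k) S f \<longleftrightarrow>
     (\<forall>x\<in>S. f differentiable (at x)) \<and> (\<forall>v. Ck_on k S (\<lambda>x. frechet_derivative f (at x) v))"

text \<open>All domains below are open subsets of finite-dimensional spaces; there this is the usual
  notion of a \<open>C\<^sup>\<infinity>\<close> map.\<close>

definition smooth_on :: "'a::real_normed_vector set \<Rightarrow> ('a \<Rightarrow> 'b::real_normed_vector) \<Rightarrow> bool" where
  "smooth_on S f \<longleftrightarrow> (\<forall>k. Ck_on k S f)"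


subsection \<open>Differential 1-forms\<close>

text \<open>A 1-form \<open>\<alpha>\<close> is written \<open>\<alpha> x v\<close>: its value at the point \<open>x\<close> on the tangent vector \<open>v\<close>.\<close>

definition smooth_1form_on :: "'a::real_normed_vector set \<Rightarrow> ('a \<Rightarrow> 'a \<Rightarrow> real) \<Rightarrow> bool" where
  "smooth_1form_on S \<alpha> \<longleftrightarrow> (\<forall>x\<in>S. linear (\<alpha> x)) \<and> (\<forall>v. smooth_on S (\<lambda>x. \<alpha> x v))"

text \<open>This is \<open>d\<alpha>(X,Y) = X(\<alpha>(Y)) - Y(\<alpha>(X)) - \<alpha>([X,Y])\<close> for the constant extensions of \<open>u\<close> and \<open>v\<close>.\<close>

definition ext_deriv :: "('a::real_normed_vector \<Rightarrow> 'a \<Rightarrow> real) \<Rightarrow> 'a \<Rightarrow> 'a \<Rightarrow> 'a \<Rightarrow> real" where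
  "ext_deriv \<alpha> x u v =
     frechet_derivative (\<lambda>y. \<alpha> y v) (at x) u - frechet_derivative (\<lambda>y. \<alpha> y u) (at x) v"

definition closed_1form_on :: "'a::real_normed_vector set \<Rightarrow> ('a \<Rightarrow> 'a \<Rightarrow> real) \<Rightarrow> bool" where
  "closed_1form_on S \<alpha> \<longleftrightarrow> smooth_1form_on S \<alpha> \<and> (\<forall>x\<in>S. \<forall>u v. ext_deriv \<alpha> x u v = 0)"

text \<open>Complete integrability in the sense of Frobenius of the Pfaffian system \<open>\<theta> = 0\<close>, \<open>\<theta> \<in> \<Theta>\<close>, on
  a submanifold \<open>N\<close> (with tangent spaces \<open>T p\<close>) of an open set \<open>S\<close> on which the forms are given:
  the common kernel on \<open>T p\<close> has constant dimension \<open>d\<close>, and \<open>d\<theta> \<equiv> 0\<close> modulo \<open>\<Theta>\<close> for all \<open>\<theta> \<in> \<Theta>\<close>,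
  i.e. every \<open>d\<theta>\<close> vanishes on that kernel.  Exterior differentiation commutes with restriction
  to \<open>N\<close>, so \<open>d\<theta>\<close> may be computed in \<open>S\<close>.\<close>

definition frobenius_integrable ::
  "'a::real_normed_vector set \<Rightarrow> 'a set \<Rightarrow> ('a \<Rightarrow> 'a set) \<Rightarrow> nat \<Rightarrow> ('a \<Rightarrow> 'a \<Rightarrow> real) set \<Rightarrow> bool"
  where
  "frobenius_integrable S N T d \<Theta> \<longleftrightarrow>
     (\<forall>\<theta>\<in>\<Theta>. smooth_1form_on S \<theta>) \<and>
     (\<forall>p\<in>N. dim {\<xi> \<in> T p. \<forall>\<theta>\<in>\<Theta>. \<theta> p \<xi> = 0} = d) \<and>
     (\<forall>p\<in>N. \<forall>\<xi>\<in>T p. \<forall>\<eta>\<in>T p. (\<forall>\<theta>\<in>\<Theta>. \<theta> p \<xi> = 0 \<and> \<theta> p \<eta> = 0)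
        \<longrightarrow> (\<forall>\<theta>\<in>\<Theta>. ext_deriv \<theta> p \<xi> \<eta> = 0))"


subsection \<open>Riemannian geometry on an open subset of Euclidean space\<close>

type_synonym 'n metric = "real^'n \<Rightarrow> real^'n \<Rightarrow> real^'n \<Rightarrow> real"
type_synonym 'n vfield = "real^'n \<Rightarrow> real^'n"

definition riemannian_metric_on :: "(real^'n) set \<Rightarrow> 'n metric \<Rightarrow> bool" where
  "riemannian_metric_on U g \<longleftrightarrow>
     (\<forall>x\<in>U. bilinear (g x) \<and> (\<forall>u v. g x u v = g x v u) \<and> (\<forall>u. u \<noteq> 0 \<longrightarrow> 0 < g x u u)) \<and>
     (\<forall>u v. smooth_on U (\<lambda>x. g x u v))"

definition lie_bracket :: "'n::finite vfield \<Rightarrow> 'n vfield \<Rightarrow> 'n vfield" where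
  "lie_bracket X Y x =
     frechet_derivative Y (at x) (X x) - frechet_derivative X (at x) (Y x)"

definition affine_connection_on ::
  "(real^'n) set \<Rightarrow> ('n vfield \<Rightarrow> 'n vfield \<Rightarrow> 'n vfield) \<Rightarrow> bool" where
  "affine_connection_on U nabla \<longleftrightarrow>
     (\<forall>X Y. smooth_on U X \<and> smooth_on U Y \<longrightarrow> smooth_on U (nabla X Y)) \<and>
     (\<forall>X X' Y. smooth_on U X \<and> smooth_on U X' \<and> smooth_on U Y \<longrightarrow>
        (\<forall>x\<in>U. nabla (\<lambda>y. X y + X' y) Y x = nabla X Y x + nabla X' Y x)) \<and>
     (\<forall>f X Y. smooth_on U f \<and> smooth_on U X \<and> smooth_on U Y \<longrightarrow>
        (\<forall>x\<in>U. nabla (\<lambda>y. f y *\<^sub>R X y) Y x = f x *\<^sub>R nabla X Y x)) \<and>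
     (\<forall>X Y Y'. smooth_on U X \<and> smooth_on U Y \<and> smooth_on U Y' \<longrightarrow>
        (\<forall>x\<in>U. nabla X (\<lambda>y. Y y + Y' y) x = nabla X Y x + nabla X Y' x)) \<and>
     (\<forall>f X Y. smooth_on U f \<and> smooth_on U X \<and> smooth_on U Y \<longrightarrow>
        (\<forall>x\<in>U. nabla X (\<lambda>y. f y *\<^sub>R Y y) x =
           frechet_derivative f (at x) (X x) *\<^sub>R Y x + f x *\<^sub>R nabla X Y x))"

definition levi_civita_on ::
  "(real^'n) set \<Rightarrow> 'n metric \<Rightarrow> ('n vfield \<Rightarrow> 'n vfield \<Rightarrow> 'n vfield) \<Rightarrow> bool" where
  "levi_civita_on U g nabla \<longleftrightarrow>
     affine_connection_on U nabla \<and>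
     (\<forall>X Y. smooth_on U X \<and> smooth_on U Y \<longrightarrow>
        (\<forall>x\<in>U. nabla X Y x - nabla Y X x = lie_bracket X Y x)) \<and>
     (\<forall>X Y Z. smooth_on U X \<and> smooth_on U Y \<and> smooth_on U Z \<longrightarrow>
        (\<forall>x\<in>U. frechet_derivative (\<lambda>y. g y (Y y) (Z y)) (at x) (X x) =
           g x (nabla X Y x) (Z x) + g x (Y x) (nabla X Z x)))"

definition curvature ::
  "('n::finite vfield \<Rightarrow> 'n vfield \<Rightarrow> 'n vfield) \<Rightarrow> 'n vfield \<Rightarrow> 'n vfield \<Rightarrow> 'n vfield \<Rightarrow> 'n vfield" where
  "curvature nabla X Y Z x = nabla X (nabla Y Z) x - nabla Y (nabla X Z) x - nabla (lie_bracket X Y) Z x"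

text \<open>Curvature and connection forms are tensorial in the slots into which tangent vectors are
  inserted, so these may be extended to constant vector fields.\<close>

definition sectional_curvature ::
  "'n metric \<Rightarrow> ('n vfield \<Rightarrow> 'n vfield \<Rightarrow> 'n vfield) \<Rightarrow> real^'n \<Rightarrow> real^'n \<Rightarrow> real^'n \<Rightarrow> real" where
  "sectional_curvature g nabla x u v =
     g x (curvature nabla (\<lambda>_. u) (\<lambda>_. v) (\<lambda>_. v) x) u / (g x u u * g x v v - (g x u v)\<^sup>2)"

definition constant_curvature_on ::
  "(real^'n) set \<Rightarrow> 'n metric \<Rightarrow> ('n vfield \<Rightarrow> 'n vfield \<Rightarrow> 'n vfield) \<Rightarrow> real \<Rightarrow> bool" where
  "constant_curvature_on U g nabla \<kappa> \<longleftrightarrow>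
     (\<forall>x\<in>U. \<forall>u v. u \<noteq> v \<and> independent {u, v} \<longrightarrow> sectional_curvature g nabla x u v = \<kappa>)"

definition orthonormal_frame_on :: "(real^'n) set \<Rightarrow> 'n metric \<Rightarrow> ('n \<Rightarrow> 'n vfield) \<Rightarrow> bool" where
  "orthonormal_frame_on U g e \<longleftrightarrow>
     (\<forall>i. smooth_on U (e i)) \<and>
     (\<forall>x\<in>U. \<forall>i j. g x (e i x) (e j x) = (if i = j then 1 else 0))"

definition dual_forms_on ::
  "(real^'n) set \<Rightarrow> ('n \<Rightarrow> 'n vfield) \<Rightarrow> ('n \<Rightarrow> real^'n \<Rightarrow> real^'n \<Rightarrow> real) \<Rightarrow> bool" where
  "dual_forms_on U e \<omega> \<longleftrightarrow>
     (\<forall>x\<in>U. \<forall>i. linear (\<omega> i x) \<and> (\<forall>j. \<omega> i x (e j x) = (if i = j then 1 else 0)))"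

definition connection_matrix ::
  "'n metric \<Rightarrow> ('n vfield \<Rightarrow> 'n vfield \<Rightarrow> 'n vfield) \<Rightarrow> ('n \<Rightarrow> 'n vfield)
     \<Rightarrow> real^'n \<Rightarrow> real^'n \<Rightarrow> real^'n^'n" where
  "connection_matrix g nabla e x v = (\<chi> i j. g x (nabla (\<lambda>_. v) (e i) x) (e j x))"

definition rotated_frame ::
  "(real^'n \<Rightarrow> real^'n^'n) \<Rightarrow> ('n \<Rightarrow> 'n vfield) \<Rightarrow> 'n \<Rightarrow> 'n vfield" where
  "rotated_frame L e i x = (\<Sum>j\<in>UNIV. L x $ i $ j *\<^sub>R e j x)"


subsection \<open>The system of partial differential equations\<close>

text \<open>The left-hand sides of the equations as 1-forms on \<open>U \<times> O(n)\<close>, extended by the same formulas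
  to matrices that are not orthogonal.  The point is \<open>(x, A)\<close>, the tangent vector \<open>(v, M)\<close>;
  for a map \<open>L\<close> one substitutes \<open>A = L x\<close> and \<open>M = dL(v)\<close>.  The index \<open>a\<close> plays the role of \<open>1\<close>.\<close>

definition system_form1 ::
  "('n \<Rightarrow> real^'n \<Rightarrow> real^'n \<Rightarrow> real) \<Rightarrow> (real^'n \<Rightarrow> real^'n \<Rightarrow> real^'n^'n) \<Rightarrow> 'n \<Rightarrow> 'n
     \<Rightarrow> (real^'n) \<times> (real^'n^'n) \<Rightarrow> (real^'n) \<times> (real^'n^'n) \<Rightarrow> real" where
  "system_form1 \<omega> W a i = (\<lambda>(x, A) (v, M).
     (M ** transpose A) $ a $ i + (A ** W x v ** transpose A) $ a $ i
       + (\<Sum>k\<in>UNIV. A $ i $ k * \<omega> k x v))"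

definition system_form2 ::
  "(real^'n \<Rightarrow> real^'n \<Rightarrow> real^'n^'n) \<Rightarrow> 'n \<Rightarrow> 'n
     \<Rightarrow> (real^'n) \<times> (real^'n^'n) \<Rightarrow> (real^'n) \<times> (real^'n^'n) \<Rightarrow> real" where
  "system_form2 W i j = (\<lambda>(x, A) (v, M).
     (M ** transpose A) $ i $ j + (A ** W x v ** transpose A) $ i $ j)"

definition system_forms ::
  "('n \<Rightarrow> real^'n \<Rightarrow> real^'n \<Rightarrow> real) \<Rightarrow> (real^'n \<Rightarrow> real^'n \<Rightarrow> real^'n^'n) \<Rightarrow> 'n
     \<Rightarrow> ((real^'n) \<times> (real^'n^'n) \<Rightarrow> (real^'n) \<times> (real^'n^'n) \<Rightarrow> real) set" where
  "system_forms \<omega> W a =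
     {system_form1 \<omega> W a i | i. i \<noteq> a} \<union>
     {system_form2 W i j | i j. i \<noteq> a \<and> j \<noteq> a \<and> i \<noteq> j}"

text \<open>The tangent space of \<open>U \<times> O(n)\<close> at \<open>(x, A)\<close>, \<open>O(n)\<close> being the level set \<open>A A\<^sup>t = 1\<close>.\<close>

definition orthogonal_tangent ::
  "(real^'n) \<times> (real^'n^'n) \<Rightarrow> ((real^'n) \<times> (real^'n^'n)) set" where
  "orthogonal_tangent = (\<lambda>(x, A). {(v, M). M ** transpose A + A ** transpose M = 0})"

definition integrable_system_on ::
  "(real^'n) set \<Rightarrow> ('n \<Rightarrow> real^'n \<Rightarrow> real^'n \<Rightarrow> real) \<Rightarrow> (real^'n \<Rightarrow> real^'n \<Rightarrow> real^'n^'n) \<Rightarrow> 'n \<Rightarrow> bool"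
  where
  "integrable_system_on U \<omega> W a \<longleftrightarrow>
     frobenius_integrable (U \<times> UNIV) (U \<times> {A. orthogonal_matrix A}) orthogonal_tangent
       CARD('n) (system_forms \<omega> W a)"

definition matrix_differential ::
  "(real^'n \<Rightarrow> real^'n^'n) \<Rightarrow> real^'n \<Rightarrow> real^'n \<Rightarrow> real^'n^'n" where
  "matrix_differential L x v = (\<chi> i j. frechet_derivative (\<lambda>y. L y $ i $ j) (at x) v)"

definition solution_on ::
  "(real^'n) set \<Rightarrow> ('n \<Rightarrow> real^'n \<Rightarrow> real^'n \<Rightarrow> real) \<Rightarrow> (real^'n \<Rightarrow> real^'n \<Rightarrow> real^'n^'n) \<Rightarrow> 'n
     \<Rightarrow> (real^'n \<Rightarrow> real^'n^'n) \<Rightarrow> bool" where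
  "solution_on V \<omega> W a L \<longleftrightarrow>
     smooth_on V L \<and> (\<forall>x\<in>V. orthogonal_matrix (L x)) \<and>
     (\<forall>\<theta>\<in>system_forms \<omega> W a. \<forall>x\<in>V. \<forall>v. \<theta> (x, L x) (v, matrix_differential L x v) = 0)"

end

theory Submission
  imports Defs
begin

text \<open>
  Write \<open>a\<close> for the distinguished index, \<open>\<omega>(v)\<close> for the vector with entries \<open>\<omega>\<^sub>k(v)\<close>, and \<open>r\<^sub>i\<close> for
  the rows of \<open>L\<close>.  For orthogonal \<open>L\<close> the equations of the system, together with the derivative of
  \<open>L L\<^sup>t = 1\<close>, prescribe the whole differential of \<open>L\<close>:
    \<open>dr\<^sub>i(v) = W(v) r\<^sub>i + (r\<^sub>i \<bullet> \<omega>(v)) r\<^sub>a - \<delta>\<^sub>i\<^sub>a \<omega>(v)\<close>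
  (lemma \<open>kernel_iff\<close>).  In terms of the rotated frame \<open>v\<^sub>i\<close>, its dual forms \<open>\<eta>\<^sub>i\<close> and its connection
  forms \<open>\<eta>\<^sub>i\<^sub>j\<close>, this says \<open>\<eta>\<^sub>a\<^sub>i = - \<eta>\<^sub>i\<close> and \<open>\<eta>\<^sub>i\<^sub>j = 0\<close> for \<open>i, j \<noteq> a\<close>.

  The right-hand side is a quadratic polynomial in \<open>L\<close>, and among the possible extensions from \<open>O(n)\<close>
  to all matrices this one has the virtue of satisfying the Frobenius compatibility condition at
  every matrix (lemma \<open>rhs_integrable\<close>).  The compatibility condition is a consequence of the two
  structure equations \<open>d\<omega> = W \<and> \<omega>\<close> and \<open>dW = W \<and> W + \<omega> \<and> \<omega>\<^sup>t\<close>; the second one is where curvature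
  \<open>-1\<close> enters (theorem \<open>structure_equations\<close>).

  Local solutions therefore exist on an open subset of \<open>\<real>\<^sup>n\<close> with values in all matrices, by a local
  Frobenius theorem (\<open>frobenius_local\<close>), proved by Picard iteration along the rays issuing from \<open>x\<^sub>0\<close>.
  The matrix \<open>L L\<^sup>t - 1\<close> of such a solution satisfies a homogeneous linear total differential
  equation, so it vanishes near \<open>x\<^sub>0\<close> if it vanishes at \<open>x\<^sub>0\<close> (lemma \<open>solves_orthogonal\<close>).
  Uniqueness holds because a Lipschitz total differential equation has at most one local solution
  (\<open>total_system_unique\<close>).

  For the forms on \<open>U \<times> O(n)\<close>, the common kernel at \<open>(x, A)\<close> is the graph of the linear map
  \<open>v \<mapsto> dL(v)\<close> above, hence has dimension \<open>n\<close>, and the structure equations make the exterior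
  derivatives vanish on it (lemma \<open>pfaff_ext_deriv\<close>).  Finally,
  \<open>d\<eta>\<^sub>a = \<Sum>\<^sub>j \<eta>\<^sub>a\<^sub>j \<and> \<eta>\<^sub>j = - \<Sum>\<^sub>j \<eta>\<^sub>j \<and> \<eta>\<^sub>j = 0\<close> (lemma \<open>first_form_closed\<close>).
\<close>

section \<open>Calculus of smooth maps\<close>

lemma frechet_derivative_eqI:
  "(f has_derivative f') (at x) \<Longrightarrow> frechet_derivative f (at x) = f'"
  by (rule frechet_derivative_at[symmetric])

lemma has_derivative_cong_open:
  assumes "open S" "x \<in> S" "\<And>y. y \<in> S \<Longrightarrow> f y = g y"
  shows "(f has_derivative f') (at x) \<longleftrightarrow> (g has_derivative f') (at x)"
proof
  show "(g has_derivative f') (at x)" if "(f has_derivative f') (at x)"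
    by (rule has_derivative_transform_within_open[OF that assms])
  show "(f has_derivative f') (at x)" if "(g has_derivative f') (at x)"
    by (rule has_derivative_transform_within_open[OF that assms(1,2) assms(3)[symmetric]])
qed

lemma frechet_derivative_cong_open:
  assumes "open S" "x \<in> S" "\<And>y. y \<in> S \<Longrightarrow> f y = g y"
  shows "frechet_derivative f (at x) = frechet_derivative g (at x)"
  unfolding frechet_derivative_def by (simp only: has_derivative_cong_open[OF assms])

lemma differentiable_cong_open:
  assumes "open S" "x \<in> S" "\<And>y. y \<in> S \<Longrightarrow> f y = g y"
  shows "f differentiable at x \<longleftrightarrow> g differentiable at x"
  unfolding differentiable_def by (simp only: has_derivative_cong_open[OF assms])

lemma Ck_on_cong:
  assumes "open S" "\<And>y. y \<in> S \<Longrightarrow> f y = g y"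
  shows "Ck_on k S f \<longleftrightarrow> Ck_on k S g"
  using assms(2)
proof (induction k arbitrary: f g)
  case 0
  then show ?case by (simp cong: continuous_on_cong)
next
  case (Suc k)
  have "Ck_on k S (\<lambda>x. frechet_derivative f (at x) v)
      \<longleftrightarrow> Ck_on k S (\<lambda>x. frechet_derivative g (at x) v)" for v
    by (rule Suc.IH) (simp only: frechet_derivative_cong_open[OF assms(1) _ Suc.prems])
  moreover have "(\<forall>x\<in>S. f differentiable at x) \<longleftrightarrow> (\<forall>x\<in>S. g differentiable at x)"
    by (intro ball_cong refl differentiable_cong_open[OF assms(1)] Suc.prems)
  ultimately show ?case by (simp only: Ck_on.simps)
qed

lemma Ck_on_mono: "T \<subseteq> S \<Longrightarrow> Ck_on k S f \<Longrightarrow> Ck_on k T f"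
  by (induction k arbitrary: f) (auto intro: continuous_on_subset)

lemma Ck_on_Suc_imp: "Ck_on (Suc k) S f \<Longrightarrow> Ck_on k S f"
proof (induction k arbitrary: f)
  case 0
  then show ?case
    by (auto intro!: continuous_at_imp_continuous_on differentiable_imp_continuous_within)
next
  case (Suc k)
  then show ?case by (metis Ck_on.simps(2))
qed

lemma Ck_on_SucI:
  assumes "open S" "\<And>x. x \<in> S \<Longrightarrow> (f has_derivative f' x) (at x)"
    and "\<And>v. Ck_on k S (\<lambda>x. f' x v)"
  shows "Ck_on (Suc k) S f"
proof -
  have "Ck_on k S (\<lambda>x. frechet_derivative f (at x) v)" for v
    using Ck_on_cong[OF assms(1), of "\<lambda>x. frechet_derivative f (at x) v" "\<lambda>x. f' x v"]
      frechet_derivative_eqI[OF assms(2)] assms(3) by simp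
  then show ?thesis using assms(2) by (auto simp: differentiable_def)
qed

lemma Ck_on_Suc_has_derivative:
  "Ck_on (Suc k) S f \<Longrightarrow> x \<in> S \<Longrightarrow> (f has_derivative frechet_derivative f (at x)) (at x)"
  by (simp add: frechet_derivative_works)

lemma Ck_on_const: "Ck_on k S (\<lambda>x. c)"
  by (induction k arbitrary: c) simp_all

lemma Ck_on_bounded_linear:
  assumes "bounded_linear h" "open S"
  shows "Ck_on k S h"
proof (cases k)
  case 0
  then show ?thesis using assms by (simp add: linear_continuous_on)
next
  case (Suc m)
  have "Ck_on (Suc m) S h"
    using assms by (intro Ck_on_SucI[of _ _ "\<lambda>x. h"] Ck_on_const bounded_linear_imp_has_derivative)
  then show ?thesis using Suc by simp
qed

lemma Ck_on_add:
  assumes "open S" "Ck_on k S f" "Ck_on k S g"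
  shows "Ck_on k S (\<lambda>x. f x + g x)"
  using assms(2,3)
proof (induction k arbitrary: f g)
  case 0
  then show ?case by (auto intro: continuous_on_add)
next
  case (Suc k)
  show ?case
  proof (rule Ck_on_SucI[OF assms(1)])
    show "((\<lambda>x. f x + g x) has_derivative
        (\<lambda>h. frechet_derivative f (at x) h + frechet_derivative g (at x) h)) (at x)" if "x \<in> S" for x
      using Suc.prems that by (intro has_derivative_add Ck_on_Suc_has_derivative)
  qed (use Suc in auto)
qed

lemma (in bounded_bilinear) Ck_on_prod:
  assumes "open S" "Ck_on k S f" "Ck_on k S g"
  shows "Ck_on k S (\<lambda>x. prod (f x) (g x))"
  using assms(2,3)
proof (induction k arbitrary: f g)
  case 0
  then show ?case by (auto intro: continuous_on)
next
  case (Suc k)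
  show ?case
  proof (rule Ck_on_SucI[OF assms(1)])
    show "((\<lambda>x. prod (f x) (g x)) has_derivative
        (\<lambda>h. prod (f x) (frechet_derivative g (at x) h) + prod (frechet_derivative f (at x) h) (g x))) (at x)"
      if "x \<in> S" for x
      using Suc.prems that by (intro FDERIV Ck_on_Suc_has_derivative)
    show "Ck_on k S (\<lambda>x. prod (f x) (frechet_derivative g (at x) v)
        + prod (frechet_derivative f (at x) v) (g x))" for v
      using Suc.prems Suc.prems[THEN Ck_on_Suc_imp]
      by (intro Ck_on_add assms(1) Suc.IH) simp_all
  qed
qed

lemma Ck_on_linear_compose:
  assumes "bounded_linear h" "open S" "Ck_on k S f"
  shows "Ck_on k S (\<lambda>x. h (f x))"
  using assms(3)
proof (induction k arbitrary: f)
  case 0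
  then show ?case using assms(1) by (auto intro: bounded_linear.continuous_on)
next
  case (Suc k)
  show ?case
  proof (rule Ck_on_SucI[OF assms(2)])
    show "((\<lambda>x. h (f x)) has_derivative (\<lambda>v. h (frechet_derivative f (at x) v))) (at x)"
      if "x \<in> S" for x
      using Suc.prems that
      by (intro bounded_linear.has_derivative[OF assms(1)] Ck_on_Suc_has_derivative)
  qed (use Suc in auto)
qed

lemma Ck_on_compose_linear:
  assumes "bounded_linear h" "open S" "open T" "h ` T \<subseteq> S" "Ck_on k S f"
  shows "Ck_on k T (\<lambda>x. f (h x))"
  using assms(5)
proof (induction k arbitrary: f)
  case 0
  then show ?case
    using assms(1,4) continuous_on_compose2[of S f T h] linear_continuous_on[of h T] by simp
next
  case (Suc k)
  show ?case
  proof (rule Ck_on_SucI[OF assms(3)])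
    show "((\<lambda>x. f (h x)) has_derivative (\<lambda>v. frechet_derivative f (at (h x)) (h v))) (at x)"
      if "x \<in> T" for x
    proof -
      have "(f has_derivative frechet_derivative f (at (h x))) (at (h x))"
        using Suc.prems assms(4) that by (intro Ck_on_Suc_has_derivative) auto
      from diff_chain_at[OF bounded_linear_imp_has_derivative[OF assms(1)] this]
      show ?thesis by (simp add: o_def)
    qed
  qed (use Suc in auto)
qed

lemma Ck_on_sum:
  assumes "open S" "\<And>i. i \<in> I \<Longrightarrow> Ck_on k S (f i)"
  shows "Ck_on k S (\<lambda>x. \<Sum>i\<in>I. f i x)"
  using assms(2)
  by (induction I rule: infinite_finite_induct) (auto intro: Ck_on_const Ck_on_add assms(1))

lemma Ck_on_diff:
  assumes "open S" "Ck_on k S f" "Ck_on k S g"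
  shows "Ck_on k S (\<lambda>x. f x - g x)"
proof -
  have "Ck_on k S (\<lambda>x. f x + - g x)"
    by (intro Ck_on_add assms Ck_on_linear_compose[OF bounded_linear_minus[OF bounded_linear_ident]])
  then show ?thesis by simp
qed

lemma bounded_linear_axis: "bounded_linear (\<lambda>c::'b::euclidean_space. axis i c :: 'b^'n)"
  by (auto intro!: linear_conv_bounded_linear[THEN iffD1] linearI simp: vec_eq_iff axis_def)

lemma Ck_on_vec:
  fixes f :: "'a::real_normed_vector \<Rightarrow> ('b::euclidean_space)^'n"
  assumes "open S" "\<And>i. Ck_on k S (\<lambda>x. f x $ i)"
  shows "Ck_on k S f"
proof -
  have "Ck_on k S (\<lambda>x. \<Sum>i\<in>UNIV. axis i (f x $ i))"
    by (intro Ck_on_sum Ck_on_linear_compose[OF bounded_linear_axis] assms)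
  moreover have "(\<Sum>i\<in>UNIV. axis i (f x $ i)) = f x" for x
    by (auto simp: vec_eq_iff axis_def if_distrib if_distribR cong: if_cong)
  ultimately show ?thesis by simp
qed

lemma Ck_on_nth:
  fixes f :: "'a::real_normed_vector \<Rightarrow> ('b::euclidean_space)^'n"
  shows "open S \<Longrightarrow> Ck_on k S f \<Longrightarrow> Ck_on k S (\<lambda>x. f x $ i)"
  by (rule Ck_on_linear_compose[OF bounded_linear_vec_nth])

lemma smooth_on_cong:
  assumes "open S" "\<And>y. y \<in> S \<Longrightarrow> f y = g y"
  shows "smooth_on S f \<longleftrightarrow> smooth_on S g"
  using Ck_on_cong[OF assms] by (simp add: smooth_on_def)

lemma smooth_on_mono: "smooth_on S f \<Longrightarrow> T \<subseteq> S \<Longrightarrow> smooth_on T f"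
  using Ck_on_mono[of T S] by (auto simp: smooth_on_def)

lemma smooth_on_has_derivative:
  "smooth_on S f \<Longrightarrow> x \<in> S \<Longrightarrow> (f has_derivative frechet_derivative f (at x)) (at x)"
  using Ck_on_Suc_has_derivative[of 0] unfolding smooth_on_def by blast

lemma smooth_on_deriv: "smooth_on S f \<Longrightarrow> smooth_on S (\<lambda>x. frechet_derivative f (at x) v)"
  unfolding smooth_on_def by (metis Ck_on.simps(2))

lemma smooth_on_continuous: "smooth_on S f \<Longrightarrow> continuous_on S f"
  unfolding smooth_on_def by (metis Ck_on.simps(1))

lemma smooth_on_const: "smooth_on S (\<lambda>x. c)"
  by (simp add: smooth_on_def Ck_on_const)

lemma smooth_on_add:
  "open S \<Longrightarrow> smooth_on S f \<Longrightarrow> smooth_on S g \<Longrightarrow> smooth_on S (\<lambda>x. f x + g x)"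
  by (simp add: smooth_on_def Ck_on_add)

lemma smooth_on_bounded_linear: "bounded_linear h \<Longrightarrow> open S \<Longrightarrow> smooth_on S h"
  by (simp add: smooth_on_def Ck_on_bounded_linear)

lemma smooth_on_compose_linear:
  "bounded_linear h \<Longrightarrow> open S \<Longrightarrow> open T \<Longrightarrow> h ` T \<subseteq> S \<Longrightarrow> smooth_on S f
    \<Longrightarrow> smooth_on T (\<lambda>x. f (h x))"
  unfolding smooth_on_def using Ck_on_compose_linear[of h S T _ f] by simp

lemma smooth_on_scaleR:
  "open S \<Longrightarrow> smooth_on S f \<Longrightarrow> smooth_on S g \<Longrightarrow> smooth_on S (\<lambda>x. f x *\<^sub>R g x)"
  by (simp add: smooth_on_def bounded_bilinear.Ck_on_prod[OF bounded_bilinear_scaleR])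

lemma smooth_on_mult:
  fixes f g :: "'a::real_normed_vector \<Rightarrow> real"
  shows "open S \<Longrightarrow> smooth_on S f \<Longrightarrow> smooth_on S g \<Longrightarrow> smooth_on S (\<lambda>x. f x * g x)"
  by (simp add: smooth_on_def bounded_bilinear.Ck_on_prod[OF bounded_bilinear_mult])

lemma smooth_on_inner:
  fixes f g :: "'a::real_normed_vector \<Rightarrow> 'b::real_inner"
  shows "open S \<Longrightarrow> smooth_on S f \<Longrightarrow> smooth_on S g \<Longrightarrow> smooth_on S (\<lambda>x. f x \<bullet> g x)"
  by (simp add: smooth_on_def bounded_bilinear.Ck_on_prod[OF bounded_bilinear_inner])

lemma smooth_on_diff:
  "open S \<Longrightarrow> smooth_on S f \<Longrightarrow> smooth_on S g \<Longrightarrow> smooth_on S (\<lambda>x. f x - g x)"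
  by (simp add: smooth_on_def Ck_on_diff)

lemma smooth_on_sum:
  "open S \<Longrightarrow> (\<And>i. i \<in> I \<Longrightarrow> smooth_on S (f i)) \<Longrightarrow> smooth_on S (\<lambda>x. \<Sum>i\<in>I. f i x)"
  by (simp add: smooth_on_def Ck_on_sum)

lemma smooth_on_vec:
  fixes f :: "'a::real_normed_vector \<Rightarrow> ('b::euclidean_space)^'n"
  shows "open S \<Longrightarrow> (\<And>i. smooth_on S (\<lambda>x. f x $ i)) \<Longrightarrow> smooth_on S f"
  by (simp add: smooth_on_def Ck_on_vec)

lemma smooth_on_nth:
  fixes f :: "'a::real_normed_vector \<Rightarrow> ('b::euclidean_space)^'n"
  shows "open S \<Longrightarrow> smooth_on S f \<Longrightarrow> smooth_on S (\<lambda>x. f x $ i)"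
  by (simp add: smooth_on_def Ck_on_nth)

text \<open>The second difference of \<open>f\<close> over a small parallelogram, written as a mixed second derivative
  at an interior point.  It is symmetric in the two sides, which is what makes the mixed derivatives
  agree in the limit.\<close>

lemma second_difference_mean_value:
  fixes f :: "'a::real_normed_vector \<Rightarrow> real"
  assumes h: "h > 0"
    and in_S: "\<And>s t. 0 \<le> s \<Longrightarrow> s \<le> h \<Longrightarrow> 0 \<le> t \<Longrightarrow> t \<le> h \<Longrightarrow> x + s *\<^sub>R u + t *\<^sub>R v \<in> S"
    and f: "\<And>y. y \<in> S \<Longrightarrow> (f has_derivative f' y) (at y)"
    and f': "\<And>y. y \<in> S \<Longrightarrow> ((\<lambda>y. f' y u) has_derivative f'' y) (at y)"
  obtains s t where "0 < s" "s < h" "0 < t" "t < h"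
    "f (x + h *\<^sub>R u + h *\<^sub>R v) - f (x + h *\<^sub>R u) - f (x + h *\<^sub>R v) + f x
      = h\<^sup>2 * f'' (x + s *\<^sub>R u + t *\<^sub>R v) v"
proof -
  define \<phi> where "\<phi> s = f (x + s *\<^sub>R u + h *\<^sub>R v) - f (x + s *\<^sub>R u + 0 *\<^sub>R v)" for s
  have line: "((\<lambda>s. f (x + s *\<^sub>R u + t *\<^sub>R v)) has_real_derivative f' (x + s *\<^sub>R u + t *\<^sub>R v) u) (at s)"
    if "0 \<le> s" "s \<le> h" "0 \<le> t" "t \<le> h" for s t
  proof -
    have "((\<lambda>s. x + s *\<^sub>R u + t *\<^sub>R v) has_derivative (\<lambda>r. r *\<^sub>R u)) (at s)"
      by (auto intro!: derivative_eq_intros)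
    note d = diff_chain_at[OF this f[OF in_S[OF that]]]
    have "f' (x + s *\<^sub>R u + t *\<^sub>R v) \<circ> (\<lambda>r. r *\<^sub>R u) = (*) (f' (x + s *\<^sub>R u + t *\<^sub>R v) u)"
      by (rule ext) (simp add: linear_cmul[OF has_derivative_linear[OF f[OF in_S[OF that]]]])
    with d show ?thesis by (simp add: has_field_derivative_def o_def)
  qed
  have "\<exists>s. 0 < s \<and> s < h \<and> \<phi> h - \<phi> 0 = (h - 0) *
      (f' (x + s *\<^sub>R u + h *\<^sub>R v) u - f' (x + s *\<^sub>R u + 0 *\<^sub>R v) u)"
    unfolding \<phi>_def using h by (intro MVT2 DERIV_diff line) auto
  then obtain s where s: "0 < s" "s < h"
    "\<phi> h - \<phi> 0 = h * (f' (x + s *\<^sub>R u + h *\<^sub>R v) u - f' (x + s *\<^sub>R u + 0 *\<^sub>R v) u)"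
    by auto
  have line': "((\<lambda>t. f' (x + s *\<^sub>R u + t *\<^sub>R v) u) has_real_derivative f'' (x + s *\<^sub>R u + t *\<^sub>R v) v) (at t)"
    if "0 \<le> t" "t \<le> h" for t
  proof -
    have p: "x + s *\<^sub>R u + t *\<^sub>R v \<in> S" using s that by (intro in_S) auto
    have "((\<lambda>t. x + s *\<^sub>R u + t *\<^sub>R v) has_derivative (\<lambda>r. r *\<^sub>R v)) (at t)"
      by (auto intro!: derivative_eq_intros)
    note d = diff_chain_at[OF this f'[OF p]]
    have "f'' (x + s *\<^sub>R u + t *\<^sub>R v) \<circ> (\<lambda>r. r *\<^sub>R v) = (*) (f'' (x + s *\<^sub>R u + t *\<^sub>R v) v)"
      by (rule ext) (simp add: linear_cmul[OF has_derivative_linear[OF f'[OF p]]])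
    with d show ?thesis by (simp add: has_field_derivative_def o_def)
  qed
  have "\<exists>t. 0 < t \<and> t < h \<and> f' (x + s *\<^sub>R u + h *\<^sub>R v) u - f' (x + s *\<^sub>R u + 0 *\<^sub>R v) u
      = (h - 0) * f'' (x + s *\<^sub>R u + t *\<^sub>R v) v"
    using h by (intro MVT2 line') auto
  then obtain t where t: "0 < t" "t < h"
    "f' (x + s *\<^sub>R u + h *\<^sub>R v) u - f' (x + s *\<^sub>R u + 0 *\<^sub>R v) u = h * f'' (x + s *\<^sub>R u + t *\<^sub>R v) v"
    by auto
  show thesis
    by (rule that[OF s(1,2) t(1,2)])
      (use s(3) t(3) in \<open>simp add: \<phi>_def power2_eq_square mult.assoc\<close>)
qed

lemma second_derivative_symmetric:
  fixes f :: "'a::real_normed_vector \<Rightarrow> real"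
  assumes S: "open S" "x \<in> S" and f: "smooth_on S f"
  shows "frechet_derivative (\<lambda>y. frechet_derivative f (at y) v) (at x) u
    = frechet_derivative (\<lambda>y. frechet_derivative f (at y) u) (at x) v"
proof -
  define D where "D u v y = frechet_derivative (\<lambda>y. frechet_derivative f (at y) u) (at y) v" for u v y
  have cont: "continuous_on S (D u v)" for u v
    unfolding D_def by (intro smooth_on_continuous smooth_on_deriv f)
  have "\<bar>D v u x - D u v x\<bar> \<le> \<epsilon>" if "\<epsilon> > 0" for \<epsilon>
  proof -
    have ev: "\<forall>\<^sub>F y in nhds x. \<bar>D p q y - D p q x\<bar> < \<epsilon> / 2" for p q
    proof -
      have "continuous (at x) (D p q)"
        using cont S by (simp add: continuous_on_eq_continuous_at)
      then have "(D p q \<longlongrightarrow> D p q x) (nhds x)"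
        by (simp add: continuous_at tendsto_nhds_iff)
      then show ?thesis
        using that by (auto dest!: tendstoD[of _ _ _ "\<epsilon> / 2"] simp: dist_real_def)
    qed
    have "\<forall>\<^sub>F y in nhds x. y \<in> S \<and> \<bar>D u v y - D u v x\<bar> < \<epsilon> / 2 \<and> \<bar>D v u y - D v u x\<bar> < \<epsilon> / 2"
      by (intro eventually_conj ev eventually_nhds_in_open S)
    then obtain d where d: "d > 0" and near: "\<And>y. dist y x < d \<Longrightarrow>
        y \<in> S \<and> \<bar>D u v y - D u v x\<bar> < \<epsilon> / 2 \<and> \<bar>D v u y - D v u x\<bar> < \<epsilon> / 2"
      by (auto simp: eventually_nhds_metric)
    define P where "P = norm u + norm v + 1"
    define h where "h = d / 2 / P"
    have pos: "P > 0" unfolding P_def by (smt (verit) norm_ge_zero)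
    have h: "h > 0" using d pos by (simp add: h_def)
    have small: "dist (x + s *\<^sub>R p + t *\<^sub>R q) x < d"
      if "0 \<le> s" "s \<le> h" "0 \<le> t" "t \<le> h" "norm p + norm q = norm u + norm v" for s t p q
    proof -
      have "dist (x + s *\<^sub>R p + t *\<^sub>R q) x = norm (s *\<^sub>R p + t *\<^sub>R q)"
        by (simp add: dist_norm add.assoc)
      also have "\<dots> \<le> s * norm p + t * norm q"
        using norm_triangle_ineq[of "s *\<^sub>R p" "t *\<^sub>R q"] that by simp
      also have "\<dots> \<le> h * norm p + h * norm q"
        using that by (intro add_mono mult_right_mono) auto
      also have "\<dots> = h * (norm u + norm v)" using that(5) by (metis distrib_left)
      also have "\<dots> \<le> h * P" using h by (simp add: P_def)
      also have "\<dots> = d / 2" using pos by (simp add: h_def)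
      finally show ?thesis using d by linarith
    qed
    have der: "(f has_derivative frechet_derivative f (at y)) (at y)"
      "((\<lambda>y. frechet_derivative f (at y) p) has_derivative
        frechet_derivative (\<lambda>y. frechet_derivative f (at y) p) (at y)) (at y)" if "y \<in> S" for y p
      using that f by (auto intro: smooth_on_has_derivative smooth_on_deriv)
    obtain s t where st: "0 < s" "s < h" "0 < t" "t < h"
      "f (x + h *\<^sub>R u + h *\<^sub>R v) - f (x + h *\<^sub>R u) - f (x + h *\<^sub>R v) + f x
        = h\<^sup>2 * D u v (x + s *\<^sub>R u + t *\<^sub>R v)"
      using second_difference_mean_value[OF h _ der(1) der(2), of x u v] small near
      unfolding D_def by (metis (no_types, lifting))
    obtain s' t' where st': "0 < s'" "s' < h" "0 < t'" "t' < h"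
      "f (x + h *\<^sub>R v + h *\<^sub>R u) - f (x + h *\<^sub>R v) - f (x + h *\<^sub>R u) + f x
        = h\<^sup>2 * D v u (x + s' *\<^sub>R v + t' *\<^sub>R u)"
      using second_difference_mean_value[OF h _ der(1) der(2), of x v u] small near
      unfolding D_def by (metis (no_types, lifting) add.commute)
    have "h\<^sup>2 * D u v (x + s *\<^sub>R u + t *\<^sub>R v) = h\<^sup>2 * D v u (x + s' *\<^sub>R v + t' *\<^sub>R u)"
      using st(5) st'(5) by (simp add: algebra_simps)
    then have "D u v (x + s *\<^sub>R u + t *\<^sub>R v) = D v u (x + s' *\<^sub>R v + t' *\<^sub>R u)"
      using h by simp
    moreover have "\<bar>D u v (x + s *\<^sub>R u + t *\<^sub>R v) - D u v x\<bar> < \<epsilon> / 2"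
      using near[OF small] st by simp
    moreover have "\<bar>D v u (x + s' *\<^sub>R v + t' *\<^sub>R u) - D v u x\<bar> < \<epsilon> / 2"
      using near[OF small] st' by (simp add: add.commute)
    ultimately show ?thesis by linarith
  qed
  then have "\<bar>D v u x - D u v x\<bar> \<le> 0" by (rule field_le_epsilon) simp
  then show ?thesis by (simp add: D_def)
qed

section \<open>A local Frobenius theorem\<close>

lemma convex_radial_segment:
  fixes x0 x :: "'a::real_vector"
  assumes "convex B" "x0 \<in> B" "x \<in> B" "t \<in> {0..1}"
  shows "x0 + t *\<^sub>R (x - x0) \<in> B"
proof -
  have "(1 - t) *\<^sub>R x0 + t *\<^sub>R x \<in> B"
    using assms by (intro convexD_alt) auto
  then show ?thesis by (simp add: algebra_simps)
qed

text \<open>The Poincare homotopy formula \<open>dI = \<alpha> - h(d\<alpha>)\<close> for the radial primitive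
  \<open>I(x) = \<integral>\<^sub>0\<^sup>1 \<alpha>(x\<^sub>0 + t (x - x\<^sub>0))(x - x\<^sub>0) dt\<close> of a vector-valued 1-form \<open>\<alpha>\<close> of class \<open>C\<^sup>1\<close>;
  the integrand in the statement is \<open>t\<close> times \<open>d\<alpha>\<close> applied to \<open>x - x\<^sub>0\<close> and \<open>v\<close>.\<close>

lemma radial_primitive_has_derivative:
  fixes \<alpha> :: "'a::euclidean_space \<Rightarrow> 'a \<Rightarrow>\<^sub>L 'b::euclidean_space"
    and \<alpha>' :: "'a \<Rightarrow> 'a \<Rightarrow>\<^sub>L ('a \<Rightarrow>\<^sub>L 'b)"
  assumes B: "open B" "convex B" "x0 \<in> B"
    and der: "\<And>x. x \<in> B \<Longrightarrow> (\<alpha> has_derivative \<alpha>' x) (at x)"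
    and cont': "continuous_on B \<alpha>'"
  shows "\<exists>G :: 'a \<Rightarrow> 'a \<Rightarrow>\<^sub>L 'b. continuous_on B G \<and> (\<forall>x\<in>B.
    ((\<lambda>x. integral {0..1} (\<lambda>t. \<alpha> (x0 + t *\<^sub>R (x - x0)) (x - x0))) has_derivative blinfun_apply (G x)) (at x) \<and>
    (\<forall>v. blinfun_apply (G x) v = \<alpha> x v - integral {0..1} (\<lambda>t. t *\<^sub>R
        (\<alpha>' (x0 + t *\<^sub>R (x - x0)) (x - x0) v - \<alpha>' (x0 + t *\<^sub>R (x - x0)) v (x - x0)))))"
proof -
  define \<gamma> where "\<gamma> x t = x0 + t *\<^sub>R (x - x0)" for x and t :: real
  \<comment> \<open>The derivative of the integrand with respect to \<open>x\<close>, for differentiation under the integral.\<close>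
  define fx where "fx x t = t *\<^sub>R (blinfun.prod_left (x - x0) o\<^sub>L \<alpha>' (\<gamma> x t)) + \<alpha> (\<gamma> x t)" for x t
  define G where "G x = integral {0..1} (fx x)" for x
  have \<gamma>_in: "\<gamma> x t \<in> B" if "x \<in> B" "t \<in> {0..1}" for x t
    unfolding \<gamma>_def using convex_radial_segment[OF B(2,3)] that by blast
  have cont: "continuous_on B \<alpha>"
    using der by (meson continuous_at_imp_continuous_on has_derivative_continuous)
  have cont_\<gamma>: "continuous_on (B \<times> {0..1}) (\<lambda>z. \<gamma> (fst z) (snd z))"
    unfolding \<gamma>_def by (intro continuous_intros)
  have cont_\<alpha>\<gamma>: "continuous_on (B \<times> {0..1}) (\<lambda>z. \<alpha> (\<gamma> (fst z) (snd z)))"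
    by (rule continuous_on_compose2[OF cont cont_\<gamma>]) (auto intro: \<gamma>_in)
  have cont_\<alpha>'\<gamma>: "continuous_on (B \<times> {0..1}) (\<lambda>z. \<alpha>' (\<gamma> (fst z) (snd z)))"
    by (rule continuous_on_compose2[OF cont' cont_\<gamma>]) (auto intro: \<gamma>_in)
  have cont_fx: "continuous_on (B \<times> {0..1}) (\<lambda>(x, t). fx x t)"
    unfolding fx_def case_prod_beta
    by (rule continuous_on_blinfun_componentwise)
      (auto simp: blinfun.bilinear_simps intro!: continuous_intros cont_\<alpha>\<gamma> cont_\<alpha>'\<gamma>)
  have sect: "continuous_on {0..1} (\<lambda>t. h x t)"
    if "continuous_on (B \<times> {0..1}) (\<lambda>z. h (fst z) (snd z))" "x \<in> B" for h :: "'a \<Rightarrow> real \<Rightarrow> 'c::topological_space" and x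
  proof -
    have "continuous_on {0..1} (Pair x)" by (intro continuous_intros)
    moreover have "Pair x ` {0..1} \<subseteq> B \<times> {0..1}" using that(2) by auto
    ultimately show ?thesis using continuous_on_compose2[OF that(1)] by fastforce
  qed
  have cont_fx1: "continuous_on {0..1} (fx x)" if "x \<in> B" for x
    using sect[of fx x] cont_fx that by (simp add: case_prod_beta)
  show ?thesis
  proof (intro exI[of _ G] conjI ballI allI)
    show "continuous_on B G"
      unfolding G_def using integral_continuous_on_param[of B 0 1 fx] cont_fx by simp
    fix x assume x: "x \<in> B"
    have "((\<lambda>x. integral (cbox 0 1) (\<lambda>t. \<alpha> (\<gamma> x t) (x - x0))) has_derivative
        integral (cbox 0 1) (fx x)) (at x within B)"
    proof (rule leibniz_rule)
      fix x and t :: real assume x: "x \<in> B" and t: "t \<in> cbox 0 1"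
      have "((\<lambda>x. \<gamma> x t) has_derivative (\<lambda>v. t *\<^sub>R v)) (at x within B)"
        unfolding \<gamma>_def by (auto intro!: derivative_eq_intros)
      moreover have "(\<alpha> has_derivative \<alpha>' (\<gamma> x t)) (at (\<gamma> x t))"
        using x t \<gamma>_in by (intro der) auto
      ultimately have "((\<lambda>x. \<alpha> (\<gamma> x t)) has_derivative (\<lambda>v. \<alpha>' (\<gamma> x t) (t *\<^sub>R v))) (at x within B)"
        by (rule has_derivative_compose)
      then have "((\<lambda>x. \<alpha> (\<gamma> x t) (x - x0)) has_derivative
          (\<lambda>v. \<alpha> (\<gamma> x t) v + \<alpha>' (\<gamma> x t) (t *\<^sub>R v) (x - x0))) (at x within B)"
        by (auto intro!: derivative_eq_intros)
      moreover have "(\<lambda>v. \<alpha> (\<gamma> x t) v + \<alpha>' (\<gamma> x t) (t *\<^sub>R v) (x - x0)) = blinfun_apply (fx x t)"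
        by (rule ext) (simp add: fx_def blinfun.bilinear_simps scaleR_diff_right)
      ultimately show "((\<lambda>x. \<alpha> (\<gamma> x t) (x - x0)) has_derivative blinfun_apply (fx x t)) (at x within B)"
        by simp
    next
      fix x assume x: "x \<in> B"
      have "continuous_on {0..1} (\<lambda>t. \<alpha> (\<gamma> x t) (x - x0))"
        using sect[OF cont_\<alpha>\<gamma> x] by (intro continuous_intros)
      then show "(\<lambda>t. \<alpha> (\<gamma> x t) (x - x0)) integrable_on cbox 0 1"
        by (simp add: integrable_continuous_real)
    qed (use cont_fx x B in auto)
    then show "((\<lambda>x. integral {0..1} (\<lambda>t. \<alpha> (x0 + t *\<^sub>R (x - x0)) (x - x0))) has_derivative G x) (at x)"
      using at_within_open[OF x B(1)] by (simp add: G_def \<gamma>_def)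
    fix v
    have apply_G: "G x v = integral {0..1} (\<lambda>t. fx x t v)"
      unfolding G_def using integral_linear[OF integrable_continuous_real[OF cont_fx1[OF x]]
          blinfun.bounded_linear_left[of v]] by (simp add: o_def)
    \<comment> \<open>The integrand is the derivative of \<open>t \<alpha>(\<gamma>(t))(v)\<close>; it differs from \<open>fx x t v\<close> by the \<open>d\<alpha>\<close> term.\<close>
    have "((\<lambda>t. \<alpha> (\<gamma> x t) v + t *\<^sub>R \<alpha>' (\<gamma> x t) (x - x0) v) has_integral
        (1::real) *\<^sub>R \<alpha> (\<gamma> x 1) v - (0::real) *\<^sub>R \<alpha> (\<gamma> x 0) v) {0..1}"
    proof (rule fundamental_theorem_of_calculus)
      fix t :: real assume t: "t \<in> {0..1}"
      have "((\<lambda>t. \<gamma> x t) has_derivative (\<lambda>s. s *\<^sub>R (x - x0))) (at t within {0..1})"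
        unfolding \<gamma>_def by (auto intro!: derivative_eq_intros)
      moreover have "(\<alpha> has_derivative \<alpha>' (\<gamma> x t)) (at (\<gamma> x t))"
        using x t \<gamma>_in by (intro der) auto
      ultimately have "((\<lambda>t. \<alpha> (\<gamma> x t)) has_derivative (\<lambda>s. \<alpha>' (\<gamma> x t) (s *\<^sub>R (x - x0)))) (at t within {0..1})"
        by (rule has_derivative_compose)
      then have "((\<lambda>t. t *\<^sub>R \<alpha> (\<gamma> x t) v) has_derivative
          (\<lambda>s. t *\<^sub>R \<alpha>' (\<gamma> x t) (s *\<^sub>R (x - x0)) v + s *\<^sub>R \<alpha> (\<gamma> x t) v)) (at t within {0..1})"
        by (auto intro!: derivative_eq_intros)
      then show "((\<lambda>t. t *\<^sub>R \<alpha> (\<gamma> x t) v) has_vector_derivative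
          \<alpha> (\<gamma> x t) v + t *\<^sub>R \<alpha>' (\<gamma> x t) (x - x0) v) (at t within {0..1})"
        by (simp add: has_vector_derivative_def blinfun.bilinear_simps algebra_simps)
    qed simp
    then have int1: "integral {0..1} (\<lambda>t. \<alpha> (\<gamma> x t) v + t *\<^sub>R \<alpha>' (\<gamma> x t) (x - x0) v) = \<alpha> x v"
      by (simp add: integral_unique \<gamma>_def)
    have c1: "continuous_on {0..1} (\<lambda>t. \<alpha> (\<gamma> x t) v + t *\<^sub>R \<alpha>' (\<gamma> x t) (x - x0) v)"
      "continuous_on {0..1} (\<lambda>t. t *\<^sub>R (\<alpha>' (\<gamma> x t) (x - x0) v - \<alpha>' (\<gamma> x t) v (x - x0)))"
      using sect[OF cont_\<alpha>\<gamma> x] sect[OF cont_\<alpha>'\<gamma> x] by (auto intro!: continuous_intros)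
    have "integral {0..1} (\<lambda>t. fx x t v) = integral {0..1} (\<lambda>t. \<alpha> (\<gamma> x t) v + t *\<^sub>R \<alpha>' (\<gamma> x t) (x - x0) v)
      - integral {0..1} (\<lambda>t. t *\<^sub>R (\<alpha>' (\<gamma> x t) (x - x0) v - \<alpha>' (\<gamma> x t) v (x - x0)))"
      using c1[THEN integrable_continuous_real]
      by (subst integral_diff[symmetric])
        (auto simp: fx_def blinfun.bilinear_simps algebra_simps intro!: integral_cong)
    then show "G x v = \<alpha> x v - integral {0..1} (\<lambda>t. t *\<^sub>R
        (\<alpha>' (x0 + t *\<^sub>R (x - x0)) (x - x0) v - \<alpha>' (x0 + t *\<^sub>R (x - x0)) v (x - x0)))"
      unfolding apply_G int1 by (simp add: \<gamma>_def)
  qed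
qed

text \<open>A local Gronwall argument: on a ball whose radius is small compared with \<open>1 / C\<close> the mean value
  theorem bounds the maximum of \<open>norm D\<close> by half of itself.\<close>

lemma eq_zero_of_derivative_bound:
  fixes D :: "'a::euclidean_space \<Rightarrow> 'b::real_normed_vector"
  assumes R: "R > 0" and D0: "D x0 = 0"
    and der: "\<And>x. x \<in> ball x0 R \<Longrightarrow> (D has_derivative D' x) (at x)"
    and bound: "\<And>x v. x \<in> ball x0 R \<Longrightarrow> norm (D' x v) \<le> C * norm (D x) * norm v"
  obtains r where "r > 0" "r \<le> R" "\<And>x. x \<in> ball x0 r \<Longrightarrow> D x = 0"
proof -
  define r where "r = min (R / 2) (1 / (2 * (\<bar>C\<bar> + 1)))"
  have r: "r > 0" "r \<le> R" "r < R" using R by (auto simp: r_def)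
  have Cr: "\<bar>C\<bar> * r \<le> 1 / 2"
  proof -
    have "\<bar>C\<bar> * r \<le> \<bar>C\<bar> * (1 / (2 * (\<bar>C\<bar> + 1)))" by (intro mult_left_mono) (auto simp: r_def)
    also have "\<dots> \<le> 1 / 2" by (auto simp: field_simps)
    finally show ?thesis .
  qed
  have sub: "cball x0 r \<subseteq> ball x0 R" using r by auto
  have "continuous_on (cball x0 r) D"
    using der sub by (meson continuous_at_imp_continuous_on has_derivative_continuous subsetD)
  then have "continuous_on (cball x0 r) (\<lambda>x. norm (D x))" by (rule continuous_on_norm)
  then obtain z where z: "z \<in> cball x0 r" "\<And>y. y \<in> cball x0 r \<Longrightarrow> norm (D y) \<le> norm (D z)"
    using continuous_attains_sup[of "cball x0 r" "\<lambda>x. norm (D x)"] r by auto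
  have "norm (D z - D x0) \<le> \<bar>C\<bar> * norm (D z) * norm (z - x0)"
  proof (rule differentiable_bound[where S = "cball x0 r" and f' = D'])
    fix x assume x: "x \<in> cball x0 r"
    show "(D has_derivative D' x) (at x within cball x0 r)"
      using der x sub by (blast intro: has_derivative_at_withinI)
    show "onorm (D' x) \<le> \<bar>C\<bar> * norm (D z)"
    proof (rule onorm_bound)
      fix v
      have "norm (D' x v) \<le> C * norm (D x) * norm v" using bound x sub by auto
      also have "\<dots> \<le> \<bar>C\<bar> * norm (D z) * norm v"
        using z(2)[OF x] by (intro mult_mono) auto
      finally show "norm (D' x v) \<le> \<bar>C\<bar> * norm (D z) * norm v" .
    qed simp
  qed (use r z in auto)
  also have "\<dots> \<le> \<bar>C\<bar> * norm (D z) * r"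
    using z(1) by (intro mult_left_mono) (auto simp: dist_norm norm_minus_commute)
  also have "\<dots> = (\<bar>C\<bar> * r) * norm (D z)" by simp
  also have "\<dots> \<le> 1 / 2 * norm (D z)" using Cr by (intro mult_right_mono) auto
  finally have "norm (D z) \<le> 0" using D0 by simp
  then have "\<And>x. x \<in> ball x0 r \<Longrightarrow> D x = 0"
    using z(2) by (metis ball_subset_cball norm_le_zero_iff order_trans subsetD)
  then show thesis using that r by blast
qed


lemma C1_local_bounds:
  fixes f :: "'a::euclidean_space \<times> 'b::euclidean_space \<Rightarrow> 'c::real_normed_vector"
    and f' :: "'a \<times> 'b \<Rightarrow> ('a \<times> 'b) \<Rightarrow>\<^sub>L 'c"
  assumes S: "open S" "(x0, y0) \<in> S"
    and der: "\<And>p. p \<in> S \<Longrightarrow> (f has_derivative f' p) (at p)"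
    and cont: "continuous_on S f'"
  obtains R M K where "R > 0" "M > 0" "K > 0" "cball x0 R \<times> cball y0 R \<subseteq> S"
    "\<And>p. p \<in> cball x0 R \<times> cball y0 R \<Longrightarrow> norm (f p) \<le> M"
    "\<And>p. p \<in> cball x0 R \<times> cball y0 R \<Longrightarrow> norm (f' p) \<le> K"
    "\<And>x y y'. x \<in> cball x0 R \<Longrightarrow> y \<in> cball y0 R \<Longrightarrow> y' \<in> cball y0 R \<Longrightarrow>
      norm (f (x, y) - f (x, y')) \<le> K * norm (y - y')"
proof -
  obtain A1 B1 where AB: "open A1" "open B1" "x0 \<in> A1" "y0 \<in> B1" "A1 \<times> B1 \<subseteq> S"
    using S open_prod_elim[of S "(x0, y0)"] by (metis mem_Sigma_iff)
  obtain R1 where R1: "R1 > 0" "cball x0 R1 \<subseteq> A1" using AB open_contains_cball by blast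
  obtain R2 where R2: "R2 > 0" "cball y0 R2 \<subseteq> B1" using AB open_contains_cball by blast
  define R where "R = min R1 R2"
  define Z where "Z = cball x0 R \<times> cball y0 R"
  have R: "R > 0" using R1 R2 by (simp add: R_def)
  have Z: "compact Z" "convex Z"
    by (auto simp: Z_def intro!: compact_Times convex_Times)
  have "cball x0 R \<subseteq> A1" "cball y0 R \<subseteq> B1"
    using R1(2) R2(2) subset_cball[of R R1 x0] subset_cball[of R R2 y0] by (auto simp: R_def)
  then have "Z \<subseteq> S" using AB(5) unfolding Z_def by blast
  note Z = Z this
  have contf: "continuous_on S f"
    using der by (meson continuous_at_imp_continuous_on has_derivative_continuous)
  have "bounded (f ` Z)" "bounded (f' ` Z)"
    using Z contf cont
    by (auto intro!: compact_imp_bounded compact_continuous_image intro: continuous_on_subset)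
  then obtain M K where M: "M > 0" "\<And>p. p \<in> Z \<Longrightarrow> norm (f p) \<le> M"
    and K: "K > 0" "\<And>p. p \<in> Z \<Longrightarrow> norm (f' p) \<le> K"
    unfolding bounded_pos by blast
  have lipschitz: "norm (f (x, y) - f (x, y')) \<le> K * norm (y - y')"
    if "(x, y) \<in> Z" "(x, y') \<in> Z" for x y y'
  proof -
    have "norm (f (x, y) - f (x, y')) \<le> K * norm ((x, y) - (x, y'))"
    proof (rule differentiable_bound[OF Z(2), where f' = f'])
      fix p assume p: "p \<in> Z"
      show "(f has_derivative f' p) (at p within Z)"
        using der p Z by (blast intro: has_derivative_at_withinI)
      show "onorm (f' p) \<le> K" using K(2)[OF p] by (simp add: norm_blinfun.rep_eq)
    qed (use that in auto)
    then show ?thesis by (simp add: norm_Pair)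
  qed
  show thesis
  proof (rule that[OF R M(1) K(1)])
    show "norm (f (x, y) - f (x, y')) \<le> K * norm (y - y')"
      if "x \<in> cball x0 R" "y \<in> cball y0 R" "y' \<in> cball y0 R" for x y y'
      using that by (intro lipschitz) (auto simp: Z_def)
  qed (use Z M K in \<open>auto simp: Z_def\<close>)
qed

text \<open>The local Frobenius theorem for \<open>dF = f(x, F)\<close>.  The Picard iterates are
  \<open>F\<^sub>k\<^sub>+\<^sub>1(x) = y\<^sub>0 + \<integral>\<^sub>0\<^sup>1 f(\<gamma>(t), F\<^sub>k(\<gamma>(t)))(x - x\<^sub>0) dt\<close> with \<open>\<gamma>\<close> the segment from \<open>x\<^sub>0\<close> to \<open>x\<close>, so
  that each \<open>F\<^sub>k\<^sub>+\<^sub>1 - y\<^sub>0\<close> is the radial primitive of the 1-form \<open>\<alpha>\<^sub>k = f(\<cdot>, F\<^sub>k)\<close>.  The integrability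
  condition bounds \<open>d\<alpha>\<^sub>k\<close> by a multiple of the defect \<open>dF\<^sub>k - \<alpha>\<^sub>k\<close>; by the homotopy formula the
  defects then decay geometrically along with the distances \<open>F\<^sub>k\<^sub>+\<^sub>1 - F\<^sub>k\<close>.  Consequently \<open>F\<^sub>k\<close> and
  \<open>dF\<^sub>k\<close> both converge uniformly, and no differentiability of the limit in directions transversal
  to the rays has to be established separately.\<close>

theorem frobenius_local:
  fixes f :: "'a::euclidean_space \<times> 'b::euclidean_space \<Rightarrow> 'a \<Rightarrow>\<^sub>L 'b"
    and f' :: "'a \<times> 'b \<Rightarrow> ('a \<times> 'b) \<Rightarrow>\<^sub>L ('a \<Rightarrow>\<^sub>L 'b)"
  assumes S: "open S" "(x0, y0) \<in> S"
    and der: "\<And>p. p \<in> S \<Longrightarrow> (f has_derivative f' p) (at p)"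
    and cont: "continuous_on S f'"
    and integrable: "\<And>x y u v. (x, y) \<in> S \<Longrightarrow>
      f' (x, y) (u, f (x, y) u) v = f' (x, y) (v, f (x, y) v) u"
  obtains r F where "r > 0" "F x0 = y0"
    "\<And>x. x \<in> ball x0 r \<Longrightarrow> (x, F x) \<in> S"
    "\<And>x. x \<in> ball x0 r \<Longrightarrow> (F has_derivative f (x, F x)) (at x)"
proof -
  obtain R M K where R: "R > 0" and M: "M > 0" and K: "K > 0"
    and ZS: "cball x0 R \<times> cball y0 R \<subseteq> S"
    and Mb: "\<And>p. p \<in> cball x0 R \<times> cball y0 R \<Longrightarrow> norm (f p) \<le> M"
    and Kb: "\<And>p. p \<in> cball x0 R \<times> cball y0 R \<Longrightarrow> norm (f' p) \<le> K"
    and Lb: "\<And>x y y'. x \<in> cball x0 R \<Longrightarrow> y \<in> cball y0 R \<Longrightarrow> y' \<in> cball y0 R \<Longrightarrow>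
      norm (f (x, y) - f (x, y')) \<le> K * norm (y - y')"
    by (rule C1_local_bounds[OF S der cont]) blast+
  define Z where "Z = cball x0 R \<times> cball y0 R"
  have Z: "Z \<subseteq> S" using ZS by (simp add: Z_def)
  have M: "M > 0" "\<And>p. p \<in> Z \<Longrightarrow> norm (f p) \<le> M" and K: "K > 0" "\<And>p. p \<in> Z \<Longrightarrow> norm (f' p) \<le> K"
    using M K Mb Kb by (auto simp: Z_def)
  have lipschitz: "norm (f (x, y) - f (x, y')) \<le> K * norm (y - y')"
    if "(x, y) \<in> Z" "(x, y') \<in> Z" for x y y'
    using that Lb by (auto simp: Z_def)
  have contf: "continuous_on S f"
    using der by (meson continuous_at_imp_continuous_on has_derivative_continuous)
  \<comment> \<open>The radius makes the Picard map preserve \<open>cball y0 R\<close>, contract distances and halve the defect.\<close>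
  define r where "r = min R (min (R / M) (1 / (4 * K)))"
  have r: "r > 0" "r \<le> R" "M * r \<le> R" "K * r \<le> 1 / 4"
    using R M K by (auto simp: r_def min_def field_simps)
  define B where "B = ball x0 r"
  have B: "open B" "convex B" "x0 \<in> B" using r by (auto simp: B_def)
  have B_dist: "norm (x - x0) \<le> r" if "x \<in> B" for x
    using that by (simp add: B_def dist_norm norm_minus_commute)
  have inZ: "(x, y) \<in> Z" if "x \<in> B" "y \<in> cball y0 R" for x y
    using that r by (auto simp: B_def Z_def)
  define \<gamma> where "\<gamma> x t = x0 + t *\<^sub>R (x - x0)" for x and t :: real
  have \<gamma>_in: "\<gamma> x t \<in> B" if "x \<in> B" "t \<in> {0..1}" for x t
    unfolding \<gamma>_def using convex_radial_segment[OF B(2,3)] that by blast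
  define T where "T F x = y0 + integral {0..1} (\<lambda>t. f (\<gamma> x t, F (\<gamma> x t)) (x - x0))" for F x
  define nice where "nice F \<longleftrightarrow> continuous_on B F \<and> F ` B \<subseteq> cball y0 R" for F :: "'a \<Rightarrow> 'b"
  have cont_path: "continuous_on {0..1} (\<lambda>t. f (\<gamma> x t, F (\<gamma> x t)) w)" if "nice F" "x \<in> B" for F x w
  proof -
    have "continuous_on {0..1} (\<gamma> x)" unfolding \<gamma>_def by (intro continuous_intros)
    moreover from this have "continuous_on {0..1} (\<lambda>t. F (\<gamma> x t))"
      using that(1) \<gamma>_in[OF that(2)] unfolding nice_def
      by (auto intro: continuous_on_compose2)
    ultimately have "continuous_on {0..1} (\<lambda>t. (\<gamma> x t, F (\<gamma> x t)))"
      by (intro continuous_intros)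
    moreover have "(\<lambda>t. (\<gamma> x t, F (\<gamma> x t))) ` {0..1} \<subseteq> S"
      using inZ \<gamma>_in[OF that(2)] that(1) Z unfolding nice_def by blast
    ultimately have "continuous_on {0..1} (\<lambda>t. f (\<gamma> x t, F (\<gamma> x t)))"
      using continuous_on_compose2[OF contf] by blast
    then show ?thesis by (intro continuous_intros)
  qed
  have T_range: "T F x \<in> cball y0 R" if "nice F" "x \<in> B" for F x
  proof -
    have "norm (integral {0..1} (\<lambda>t. f (\<gamma> x t, F (\<gamma> x t)) (x - x0))) \<le> R * (1 - 0)"
    proof (rule integral_bound)
      fix t :: real assume t: "t \<in> {0..1}"
      have "norm (f (\<gamma> x t, F (\<gamma> x t)) (x - x0)) \<le> norm (f (\<gamma> x t, F (\<gamma> x t))) * norm (x - x0)"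
        by (rule norm_blinfun)
      also have "\<dots> \<le> M * r"
        using that \<gamma>_in[OF that(2) t] B_dist M unfolding nice_def
        by (intro mult_mono M(2) inZ) auto
      finally show "norm (f (\<gamma> x t, F (\<gamma> x t)) (x - x0)) \<le> R" using r by linarith
    qed (use cont_path that in auto)
    then show ?thesis by (simp add: T_def dist_norm)
  qed
  have T_contract: "norm (T F x - T H x) \<le> d / 2"
    if "nice F" "nice H" "x \<in> B" and d: "\<And>x. x \<in> B \<Longrightarrow> norm (F x - H x) \<le> d" for F H x d
  proof -
    have "d \<ge> 0" using d[OF B(3)] norm_ge_zero order_trans by blast
    have "T F x - T H x = integral {0..1}
        (\<lambda>t. f (\<gamma> x t, F (\<gamma> x t)) (x - x0) - f (\<gamma> x t, H (\<gamma> x t)) (x - x0))"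
      using cont_path that by (subst integral_diff) (auto simp: T_def intro!: integrable_continuous_real)
    also have "norm \<dots> \<le> d / 2 * (1 - 0)"
    proof (rule integral_bound)
      fix t :: real assume t: "t \<in> {0..1}"
      let ?x = "\<gamma> x t"
      have "norm (f (?x, F ?x) (x - x0) - f (?x, H ?x) (x - x0))
          \<le> norm (f (?x, F ?x) - f (?x, H ?x)) * norm (x - x0)"
        by (metis blinfun.diff_left norm_blinfun)
      also have "\<dots> \<le> (K * norm (F ?x - H ?x)) * r"
        using that \<gamma>_in[OF that(3) t] B_dist K unfolding nice_def
        by (intro mult_mono lipschitz inZ) auto
      also have "\<dots> \<le> (K * d) * r"
        using d[OF \<gamma>_in[OF that(3) t]] K r by (intro mult_right_mono mult_left_mono) auto
      also have "\<dots> = (K * r) * d" by simp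
      also have "\<dots> \<le> 1 / 4 * d" using r \<open>d \<ge> 0\<close> by (intro mult_right_mono) auto
      finally show "norm (f (?x, F ?x) (x - x0) - f (?x, H ?x) (x - x0)) \<le> d / 2"
        using \<open>d \<ge> 0\<close> by linarith
    qed (use cont_path that in \<open>auto intro!: continuous_on_diff\<close>)
    finally show ?thesis by simp
  qed
  \<comment> \<open>The two inclusions into the product, used to write the derivative of \<open>x \<mapsto> f (x, F x)\<close>.\<close>
  define E1 :: "'a \<Rightarrow>\<^sub>L ('a \<times> 'b)" where "E1 = Blinfun (\<lambda>u. (u, 0))"
  define E2 :: "'b \<Rightarrow>\<^sub>L ('a \<times> 'b)" where "E2 = Blinfun (\<lambda>w. (0, w))"
  have E1: "E1 u = (u, 0)" for u
    unfolding E1_def by (subst bounded_linear_Blinfun_apply) (auto intro!: bounded_linear_intros)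
  have E2: "E2 w = (0, w)" for w
    unfolding E2_def by (subst bounded_linear_Blinfun_apply) (auto intro!: bounded_linear_intros)
  have T_derivative: "\<exists>G'. continuous_on B G' \<and> (\<forall>x\<in>B. (T F has_derivative blinfun_apply (G' x)) (at x)
        \<and> norm (G' x - f (x, F x)) \<le> \<epsilon> / 2)"
    if F: "nice F" "continuous_on B G" "\<And>x. x \<in> B \<Longrightarrow> (F has_derivative blinfun_apply (G x)) (at x)"
      and \<epsilon>: "\<And>x. x \<in> B \<Longrightarrow> norm (G x - f (x, F x)) \<le> \<epsilon>" for F G \<epsilon>
  proof -
    define \<alpha> where "\<alpha> x = f (x, F x)" for x
    define \<alpha>' where "\<alpha>' x = f' (x, F x) o\<^sub>L (E1 + (E2 o\<^sub>L G x))" for x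
    have \<alpha>': "\<alpha>' x u = f' (x, F x) (u, G x u)" for x u
      by (simp add: \<alpha>'_def blinfun.bilinear_simps E1 E2)
    have FZ: "(x, F x) \<in> Z" if "x \<in> B" for x
      using F(1) that inZ unfolding nice_def by auto
    then have FS: "(x, F x) \<in> S" if "x \<in> B" for x using that Z by blast
    have der_\<alpha>: "(\<alpha> has_derivative \<alpha>' x) (at x)" if "x \<in> B" for x
    proof -
      have "((\<lambda>x. (x, F x)) has_derivative (\<lambda>u. (u, G x u))) (at x)"
        by (intro has_derivative_Pair has_derivative_ident F(3) that)
      from has_derivative_compose[OF this der[OF FS[OF that]]]
      show ?thesis by (simp add: \<alpha>_def[abs_def] \<alpha>'[abs_def])
    qed
    have cont_\<alpha>': "continuous_on B \<alpha>'"
    proof -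
      have "continuous_on B (\<lambda>x. (x, F x))"
        using F(1) by (auto simp: nice_def intro!: continuous_intros)
      then have "continuous_on B (\<lambda>x. f' (x, F x))"
        using FS by (intro continuous_on_compose2[OF cont]) auto
      then show ?thesis unfolding \<alpha>'_def using F(2) by (intro continuous_intros)
    qed
    obtain G' :: "'a \<Rightarrow> 'a \<Rightarrow>\<^sub>L 'b" where G': "continuous_on B G'"
      "\<And>x. x \<in> B \<Longrightarrow> ((\<lambda>x. integral {0..1} (\<lambda>t. \<alpha> (x0 + t *\<^sub>R (x - x0)) (x - x0))) has_derivative blinfun_apply (G' x)) (at x)"
      "\<And>x v. x \<in> B \<Longrightarrow> blinfun_apply (G' x) v = \<alpha> x v - integral {0..1} (\<lambda>t. t *\<^sub>R
        (\<alpha>' (x0 + t *\<^sub>R (x - x0)) (x - x0) v - \<alpha>' (x0 + t *\<^sub>R (x - x0)) v (x - x0)))"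
      using radial_primitive_has_derivative[OF B der_\<alpha> cont_\<alpha>'] by meson
    have "\<epsilon> \<ge> 0" using \<epsilon>[OF B(3)] norm_ge_zero order_trans by blast
    \<comment> \<open>By the integrability condition only the defect of \<open>F\<close> contributes to \<open>d\<alpha>\<close>.\<close>
    have skew: "norm (\<alpha>' y w v - \<alpha>' y v w) \<le> \<epsilon> / 2 * norm v" if y: "y \<in> B" and w: "norm w \<le> r" for y v w
    proof -
      define E where "E = G y - f (y, F y)"
      have split: "(u, G y u) = (u, f (y, F y) u) + (0, E u)" for u
        by (simp add: E_def blinfun.diff_left)
      have "\<alpha>' y w v - \<alpha>' y v w = f' (y, F y) (0, E w) v - f' (y, F y) (0, E v) w"
        unfolding \<alpha>' split blinfun.add_right blinfun.add_left
        using integrable[OF FS[OF y], of w v] by simp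
      also have "norm \<dots> \<le> K * \<epsilon> * norm w * norm v + K * \<epsilon> * norm v * norm w"
      proof -
        have "norm (f' (y, F y) (0, E a) b) \<le> K * \<epsilon> * norm a * norm b" for a b
        proof -
          have "norm (f' (y, F y) (0, E a) b) \<le> norm (f' (y, F y) (0, E a)) * norm b"
            by (rule norm_blinfun)
          also have "\<dots> \<le> (norm (f' (y, F y)) * norm (0::'a, E a)) * norm b"
            by (intro mult_right_mono norm_blinfun) auto
          also have "\<dots> \<le> (K * (\<epsilon> * norm a)) * norm b"
          proof (intro mult_right_mono mult_mono K(2) FZ y)
            have "norm (E a) \<le> norm E * norm a" by (rule norm_blinfun)
            also have "\<dots> \<le> \<epsilon> * norm a" using \<epsilon>[OF y] by (intro mult_right_mono) (auto simp: E_def)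
            finally show "norm (0::'a, E a) \<le> \<epsilon> * norm a" by (simp add: norm_Pair)
          qed (use K in auto)
          finally show ?thesis by (simp add: mult.assoc)
        qed
        then show ?thesis by (intro norm_triangle_le_diff add_mono)
      qed
      also have "\<dots> = 2 * (K * norm w) * (\<epsilon> * norm v)" by simp
      also have "\<dots> \<le> 2 * (K * r) * (\<epsilon> * norm v)"
        using w K \<open>\<epsilon> \<ge> 0\<close> by (intro mult_right_mono mult_left_mono) auto
      also have "\<dots> \<le> 2 * (1 / 4) * (\<epsilon> * norm v)"
        using r \<open>\<epsilon> \<ge> 0\<close> by (intro mult_right_mono mult_left_mono) auto
      finally show ?thesis by simp
    qed
    have "norm (G' x - f (x, F x)) \<le> \<epsilon> / 2" if x: "x \<in> B" for x
    proof (rule norm_blinfun_bound)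
      fix v
      have "continuous_on {0..1} (\<gamma> x)" unfolding \<gamma>_def by (intro continuous_intros)
      then have c: "continuous_on {0..1} (\<lambda>t. \<alpha>' (\<gamma> x t))"
        using \<gamma>_in[OF x] by (intro continuous_on_compose2[OF cont_\<alpha>']) auto
      have "norm (integral {0..1} (\<lambda>t. t *\<^sub>R (\<alpha>' (\<gamma> x t) (x - x0) v - \<alpha>' (\<gamma> x t) v (x - x0))))
          \<le> \<epsilon> / 2 * norm v * (1 - 0)"
      proof (rule integral_bound)
        show "continuous_on {0..1} (\<lambda>t. t *\<^sub>R (\<alpha>' (\<gamma> x t) (x - x0) v - \<alpha>' (\<gamma> x t) v (x - x0)))"
          using c by (intro continuous_intros)
        fix t :: real assume t: "t \<in> {0..1}"
        have "norm (t *\<^sub>R (\<alpha>' (\<gamma> x t) (x - x0) v - \<alpha>' (\<gamma> x t) v (x - x0)))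
            \<le> 1 * (\<epsilon> / 2 * norm v)"
          unfolding norm_scaleR using t
          by (intro mult_mono skew \<gamma>_in x B_dist) auto
        then show "norm (t *\<^sub>R (\<alpha>' (\<gamma> x t) (x - x0) v - \<alpha>' (\<gamma> x t) v (x - x0))) \<le> \<epsilon> / 2 * norm v"
          by simp
      qed simp
      then show "norm ((G' x - f (x, F x)) v) \<le> \<epsilon> / 2 * norm v"
        using G'(3)[OF x, of v] by (simp add: blinfun.diff_left \<alpha>_def \<gamma>_def)
    qed (use \<open>\<epsilon> \<ge> 0\<close> in auto)
    moreover have "(T F has_derivative G' x) (at x)" if "x \<in> B" for x
      using has_derivative_add[OF has_derivative_const[of y0] G'(2)[OF that]]
      by (simp add: T_def[abs_def] \<alpha>_def \<gamma>_def)
    ultimately show ?thesis using G'(1) by blast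
  qed
  define Fn where "Fn k = (T ^^ k) (\<lambda>_. y0)" for k
  have Fn_Suc: "Fn (Suc k) = T (Fn k)" for k by (simp add: Fn_def)
  \<comment> \<open>The defect satisfies \<open>\<epsilon>\<^sub>k\<^sub>+\<^sub>1 \<le> \<epsilon>\<^sub>k / 2 + K R / 2\<^sup>k\<close>, so it is at most \<open>C (3/4)\<^sup>k\<close> as soon as
    \<open>C \<ge> 4 K R\<close>; the summand \<open>M\<close> covers the initial defect.\<close>
  define C where "C = M + 4 * K * R"
  have step: "nice (Fn k) \<and> (\<forall>x\<in>B. norm (Fn (Suc k) x - Fn k x) \<le> R / 2 ^ k) \<and>
     (\<exists>G. continuous_on B G \<and> (\<forall>x\<in>B. (Fn k has_derivative blinfun_apply (G x)) (at x)
        \<and> norm (G x - f (x, Fn k x)) \<le> C * (3 / 4) ^ k))" for k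
  proof (induction k)
    case 0
    have nice: "nice (Fn 0)" using R by (auto simp: nice_def Fn_def)
    have "norm (Fn (Suc 0) x - Fn 0 x) \<le> R" if "x \<in> B" for x
      using T_range[OF nice that] unfolding Fn_Suc by (simp add: Fn_def dist_norm norm_minus_commute)
    moreover have "(Fn 0 has_derivative blinfun_apply 0) (at x)" for x
      by (simp add: Fn_def zero_blinfun.rep_eq[abs_def])
    moreover have "norm (0 - f (x, Fn 0 x)) \<le> C" if "x \<in> B" for x
    proof -
      have "norm (f (x, Fn 0 x)) \<le> M" using R by (intro M inZ that) (simp add: Fn_def)
      moreover have "0 \<le> 4 * K * R" using K R by simp
      ultimately show ?thesis unfolding C_def by simp
    qed
    ultimately show ?case
      using nice by (auto intro!: exI[of _ "\<lambda>_. 0"])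
  next
    case (Suc k)
    then obtain G where G: "continuous_on B G"
      "\<And>x. x \<in> B \<Longrightarrow> (Fn k has_derivative blinfun_apply (G x)) (at x)"
      "\<And>x. x \<in> B \<Longrightarrow> norm (G x - f (x, Fn k x)) \<le> C * (3 / 4) ^ k" by blast
    have nk: "nice (Fn k)" and dk: "\<And>x. x \<in> B \<Longrightarrow> norm (Fn (Suc k) x - Fn k x) \<le> R / 2 ^ k"
      using Suc by auto
    obtain G' where G': "continuous_on B G'"
      "\<And>x. x \<in> B \<Longrightarrow> (Fn (Suc k) has_derivative blinfun_apply (G' x)) (at x)"
      "\<And>x. x \<in> B \<Longrightarrow> norm (G' x - f (x, Fn k x)) \<le> C * (3 / 4) ^ k / 2"
      using T_derivative[OF nk G] unfolding Fn_Suc by blast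
    have "continuous_on B (Fn (Suc k))"
      using G'(2) by (meson continuous_at_imp_continuous_on has_derivative_continuous)
    then have nice': "nice (Fn (Suc k))"
      using T_range[OF nk] unfolding nice_def Fn_Suc by auto
    have "norm (Fn (Suc (Suc k)) x - Fn (Suc k) x) \<le> R / 2 ^ Suc k" if "x \<in> B" for x
      using T_contract[OF nice' nk that dk] by (simp add: Fn_Suc)
    moreover have "norm (G' x - f (x, Fn (Suc k) x)) \<le> C * (3 / 4) ^ Suc k" if x: "x \<in> B" for x
    proof -
      have "norm (f (x, Fn k x) - f (x, Fn (Suc k) x)) \<le> K * norm (Fn k x - Fn (Suc k) x)"
        using nk nice' x unfolding nice_def by (intro lipschitz inZ) auto
      also have "\<dots> \<le> K * (R / 2 ^ k)"
        using dk[OF x] K by (intro mult_left_mono) (auto simp: norm_minus_commute)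
      also have "\<dots> = K * R * (1 / 2) ^ k" by (simp add: power_divide)
      also have "\<dots> \<le> K * R * (3 / 4) ^ k"
        using K R by (intro mult_left_mono power_mono) auto
      finally have "norm (G' x - f (x, Fn (Suc k) x)) \<le> C * (3 / 4) ^ k / 2 + K * R * (3 / 4) ^ k"
        using G'(3)[OF x] norm_triangle_ineq[of "G' x - f (x, Fn k x)" "f (x, Fn k x) - f (x, Fn (Suc k) x)"]
        by simp
      also have "\<dots> = (C / 2 + K * R) * (3 / 4) ^ k" by (simp add: field_simps)
      also have "\<dots> \<le> (C * (3 / 4)) * (3 / 4) ^ k"
        using M K R by (intro mult_right_mono) (auto simp: C_def)
      finally show ?thesis by simp
    qed
    ultimately show ?case using nice' G'(1,2) by blast
  qed
  then obtain G where G: "\<And>k x. x \<in> B \<Longrightarrow> (Fn k has_derivative blinfun_apply (G k x)) (at x)"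
    "\<And>k x. x \<in> B \<Longrightarrow> norm (G k x - f (x, Fn k x)) \<le> C * (3 / 4) ^ k"
    by metis
  have nice: "nice (Fn k)" and dk: "\<And>x. x \<in> B \<Longrightarrow> norm (Fn (Suc k) x - Fn k x) \<le> R / 2 ^ k" for k
    using step by blast+
  have dist_Fn: "norm (Fn (n + j) x - Fn n x) \<le> 2 * R / 2 ^ n - 2 * R / 2 ^ (n + j)" if "x \<in> B" for n j x
  proof (induction j)
    case (Suc j)
    have "norm (Fn (n + Suc j) x - Fn n x)
        \<le> norm (Fn (Suc (n + j)) x - Fn (n + j) x) + norm (Fn (n + j) x - Fn n x)"
      using norm_triangle_ineq[of "Fn (Suc (n + j)) x - Fn (n + j) x" "Fn (n + j) x - Fn n x"] by simp
    also have "\<dots> \<le> R / 2 ^ (n + j) + (2 * R / 2 ^ n - 2 * R / 2 ^ (n + j))"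
      by (intro add_mono dk that Suc.IH)
    also have "\<dots> = 2 * R / 2 ^ n - 2 * R / 2 ^ (n + Suc j)" by (simp add: field_simps)
    finally show ?case .
  qed simp
  have dist_Fn': "norm (Fn m x - Fn n x) \<le> 2 * R * (1 / 2) ^ n" if "x \<in> B" "m \<ge> n" for m n x
  proof -
    have "norm (Fn (n + (m - n)) x - Fn n x) \<le> 2 * R / 2 ^ n"
      using dist_Fn[OF that(1), of n "m - n"] R by (smt (verit) divide_nonneg_pos zero_less_power)
    then show ?thesis using that(2) by (simp add: power_divide)
  qed
  have null: "(\<lambda>n. c * q ^ n) \<longlonglongrightarrow> 0" if "0 \<le> q" "q < 1" for c q :: real
    using tendsto_mult_right_zero[OF LIMSEQ_realpow_zero[OF that]] by blast
  have "Cauchy (\<lambda>n. Fn n x)" if x: "x \<in> B" for x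
  proof (rule metric_CauchyI)
    fix \<epsilon> :: real assume \<epsilon>: "\<epsilon> > 0"
    have "\<forall>\<^sub>F n in sequentially. 2 * R * (1 / 2) ^ n < \<epsilon> / 2"
      using \<epsilon> by (intro order_tendstoD(2)[OF null]) auto
    then obtain N where N: "2 * R * (1 / 2) ^ N < \<epsilon> / 2" by (auto simp: eventually_sequentially)
    have "dist (Fn m x) (Fn n x) < \<epsilon>" if "m \<ge> N" "n \<ge> N" for m n
      using dist_Fn'[OF x that(1)] dist_Fn'[OF x that(2)] N
        dist_triangle2[of "Fn m x" "Fn n x" "Fn N x"] unfolding dist_norm by linarith
    then show "\<exists>N. \<forall>m\<ge>N. \<forall>n\<ge>N. dist (Fn m x) (Fn n x) < \<epsilon>" by blast
  qed
  then have "\<forall>x\<in>B. \<exists>l. (\<lambda>n. Fn n x) \<longlonglongrightarrow> l"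
    using Cauchy_convergent by (auto simp: convergent_def)
  then obtain F where F: "\<And>x. x \<in> B \<Longrightarrow> (\<lambda>n. Fn n x) \<longlonglongrightarrow> F x" by metis
  have F_range: "F x \<in> cball y0 R" if "x \<in> B" for x
  proof (rule Lim_in_closed_set[OF closed_cball _ _ F[OF that]])
    show "\<forall>\<^sub>F n in sequentially. Fn n x \<in> cball y0 R"
      using nice that unfolding nice_def by (intro always_eventually) blast
  qed simp
  have F_dist: "norm (F x - Fn n x) \<le> 2 * R * (1 / 2) ^ n" if x: "x \<in> B" for x n
  proof (rule Lim_norm_ubound)
    show "(\<lambda>m. Fn m x - Fn n x) \<longlonglongrightarrow> F x - Fn n x" by (intro tendsto_diff F x tendsto_const)
    show "\<forall>\<^sub>F m in sequentially. norm (Fn m x - Fn n x) \<le> 2 * R * (1 / 2) ^ n"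
      using dist_Fn'[OF x] by (auto simp: eventually_sequentially)
  qed simp
  have Fn_x0: "Fn n x0 = y0" for n
    by (cases n) (simp_all add: Fn_def T_def)
  have "\<exists>g. \<forall>x\<in>B. (\<lambda>n. Fn n x) \<longlonglongrightarrow> g x \<and> (g has_derivative blinfun_apply (f (x, F x))) (at x within B)"
  proof (rule has_derivative_sequence)
    show "convex B" "x0 \<in> B" "(\<lambda>n. Fn n x0) \<longlonglongrightarrow> F x0" using B F by auto
    show "(Fn n has_derivative blinfun_apply (G n x)) (at x within B)" if "x \<in> B" for n x
      using G(1) that by (blast intro: has_derivative_at_withinI)
    fix \<epsilon> :: real assume \<epsilon>: "\<epsilon> > 0"
    have "\<forall>\<^sub>F n in sequentially. (C + 2 * K * R) * (3 / 4) ^ n < \<epsilon>"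
      using \<epsilon> by (intro order_tendstoD(2)[OF null]) auto
    then show "\<forall>\<^sub>F n in sequentially. \<forall>x\<in>B. \<forall>h. norm (G n x h - f (x, F x) h) \<le> \<epsilon> * norm h"
    proof eventually_elim
      case (elim n)
      show ?case
      proof (intro ballI allI)
        fix x h :: 'a assume x: "x \<in> B"
        have "norm (f (x, F x) - f (x, Fn n x)) \<le> K * norm (F x - Fn n x)"
          using nice[of n] x F_range[OF x] unfolding nice_def by (intro lipschitz inZ) auto
        also have "\<dots> \<le> K * (2 * R * (1 / 2) ^ n)"
          using F_dist[OF x] K by (intro mult_left_mono) auto
        also have "\<dots> \<le> K * (2 * R * (3 / 4) ^ n)"
          using K R by (intro mult_left_mono power_mono) auto
        finally have "norm (G n x - f (x, F x)) \<le> (C + 2 * K * R) * (3 / 4) ^ n"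
          using G(2)[OF x, of n] norm_triangle_ineq4[of "G n x - f (x, Fn n x)" "f (x, F x) - f (x, Fn n x)"]
          by (simp add: algebra_simps)
        with elim have "norm (G n x - f (x, F x)) \<le> \<epsilon>" by simp
        then have "norm (G n x - f (x, F x)) * norm h \<le> \<epsilon> * norm h"
          by (rule mult_right_mono) simp
        with norm_blinfun[of "G n x - f (x, F x)" h]
        show "norm (G n x h - f (x, F x) h) \<le> \<epsilon> * norm h"
          by (simp add: blinfun.diff_left)
      qed
    qed
  qed
  then obtain g where g: "\<And>x. x \<in> B \<Longrightarrow> (\<lambda>n. Fn n x) \<longlonglongrightarrow> g x"
    "\<And>x. x \<in> B \<Longrightarrow> (g has_derivative blinfun_apply (f (x, F x))) (at x within B)" by metis
  have gF: "g x = F x" if "x \<in> B" for x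
    using LIMSEQ_unique[OF g(1) F] that by blast
  show thesis
  proof (rule that[of r g])
    show "g x0 = y0"
      using g(1)[OF B(3)] Fn_x0 by (simp add: LIMSEQ_const_iff)
    show "(x, g x) \<in> S" if "x \<in> ball x0 r" for x
      using that gF inZ F_range Z unfolding B_def by (metis subsetD)
    show "(g has_derivative f (x, g x)) (at x)" if "x \<in> ball x0 r" for x
      using g(2)[of x] that gF[of x] at_within_open[OF _ B(1)] by (simp add: B_def)
  qed (rule r)
qed


text \<open>A pointwise linear family that is smooth in each direction, as a differentiable map into the
  normed space of bounded linear maps.\<close>

lemma smooth_family_blinfun:
  fixes f :: "'c::euclidean_space \<Rightarrow> 'a::euclidean_space \<Rightarrow> 'b::euclidean_space"
  assumes S: "open S" and lin: "\<And>p. p \<in> S \<Longrightarrow> linear (f p)"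
    and smooth: "\<And>v. smooth_on S (\<lambda>p. f p v)"
  obtains \<Phi> :: "'c \<Rightarrow> 'a \<Rightarrow>\<^sub>L 'b" and \<Phi>' :: "'c \<Rightarrow> 'c \<Rightarrow>\<^sub>L ('a \<Rightarrow>\<^sub>L 'b)"
  where "\<And>p. p \<in> S \<Longrightarrow> blinfun_apply (\<Phi> p) = f p"
    "\<And>p. p \<in> S \<Longrightarrow> (\<Phi> has_derivative blinfun_apply (\<Phi>' p)) (at p)"
    "continuous_on S \<Phi>'"
    "\<And>p q v. p \<in> S \<Longrightarrow> blinfun_apply (blinfun_apply (\<Phi>' p) q) v = frechet_derivative (\<lambda>p. f p v) (at p) q"
proof -
  \<comment> \<open>The bounded linear map with prescribed values on the basis.\<close>
  define BL :: "('a \<Rightarrow> 'b) \<Rightarrow> 'a \<Rightarrow>\<^sub>L 'b"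
    where "BL \<psi> = (\<Sum>b\<in>Basis. blinfun_scaleR_left (\<psi> b) o\<^sub>L blinfun_inner_left b)" for \<psi>
  have BL_apply: "blinfun_apply (BL \<psi>) v = (\<Sum>b\<in>Basis. (v \<bullet> b) *\<^sub>R \<psi> b)" for \<psi> v
    by (simp add: BL_def blinfun.sum_left)
  have BL_linear: "blinfun_apply (BL \<psi>) = \<psi>" if "linear \<psi>" for \<psi>
  proof
    fix v
    have "\<psi> (\<Sum>b\<in>Basis. (v \<bullet> b) *\<^sub>R b) = (\<Sum>b\<in>Basis. (v \<bullet> b) *\<^sub>R \<psi> b)"
      by (simp add: linear_sum[OF that] linear_cmul[OF that])
    then show "blinfun_apply (BL \<psi>) v = \<psi> v" by (simp add: BL_apply euclidean_representation)
  qed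
  define D where "D p q b = frechet_derivative (\<lambda>p. f p b) (at p) q" for p q b
  have bl: "bounded_linear (\<lambda>y :: 'b. blinfun_scaleR_left y o\<^sub>L (c :: 'a \<Rightarrow>\<^sub>L real))" for c
    by (intro bounded_linear_intros)
  have der: "((\<lambda>p. BL (f p)) has_derivative (\<lambda>q. BL (D p q))) (at p)" if "p \<in> S" for p
    unfolding BL_def D_def using that
    by (intro has_derivative_sum bounded_linear.has_derivative[OF bl] smooth_on_has_derivative[OF smooth])
  define \<Phi>' where "\<Phi>' p = Blinfun (\<lambda>q. BL (D p q))" for p
  have \<Phi>': "blinfun_apply (\<Phi>' p) = (\<lambda>q. BL (D p q))" if "p \<in> S" for p
    unfolding \<Phi>'_def by (rule bounded_linear_Blinfun_apply[OF has_derivative_bounded_linear[OF der[OF that]]])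
  show thesis
  proof (rule that[of "\<lambda>p. BL (f p)" \<Phi>'])
    show "blinfun_apply (BL (f p)) = f p" if "p \<in> S" for p
      by (rule BL_linear[OF lin[OF that]])
    show "((\<lambda>p. BL (f p)) has_derivative blinfun_apply (\<Phi>' p)) (at p)" if "p \<in> S" for p
      unfolding \<Phi>'[OF that] by (rule der[OF that])
    show "continuous_on S \<Phi>'"
    proof (rule continuous_on_blinfun_componentwise)
      fix q :: 'c
      have "continuous_on S (\<lambda>p. BL (D p q))"
        unfolding BL_def D_def
        by (intro continuous_on_sum bounded_linear.continuous_on[OF bl] smooth_on_continuous
            smooth_on_deriv smooth)
      then show "continuous_on S (\<lambda>p. blinfun_apply (\<Phi>' p) q)"
        using \<Phi>' by (simp cong: continuous_on_cong)
    qed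
    fix p q v assume p: "p \<in> S"
    have "((\<lambda>p. blinfun_apply (BL (f p)) v) has_derivative (\<lambda>q. blinfun_apply (BL (D p q)) v)) (at p)"
      by (rule bounded_linear.has_derivative[OF blinfun.bounded_linear_left der[OF p]])
    then have "frechet_derivative (\<lambda>p. blinfun_apply (BL (f p)) v) (at p) = (\<lambda>q. blinfun_apply (BL (D p q)) v)"
      by (rule frechet_derivative_eqI)
    moreover have "frechet_derivative (\<lambda>p. blinfun_apply (BL (f p)) v) (at p) = frechet_derivative (\<lambda>p. f p v) (at p)"
      using S p by (rule frechet_derivative_cong_open) (simp add: BL_linear[OF lin])
    ultimately show "blinfun_apply (blinfun_apply (\<Phi>' p) q) v = frechet_derivative (\<lambda>p. f p v) (at p) q"
      by (simp add: \<Phi>'[OF p])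
  qed
qed

theorem total_system_exists:
  fixes f :: "'a::euclidean_space \<times> 'b::euclidean_space \<Rightarrow> 'a \<Rightarrow> 'b"
  assumes S: "open S" "(x0, y0) \<in> S" and lin: "\<And>p. p \<in> S \<Longrightarrow> linear (f p)"
    and smooth: "\<And>v. smooth_on S (\<lambda>p. f p v)"
    and integrable: "\<And>x y u v. (x, y) \<in> S \<Longrightarrow>
      frechet_derivative (\<lambda>p. f p v) (at (x, y)) (u, f (x, y) u)
        = frechet_derivative (\<lambda>p. f p u) (at (x, y)) (v, f (x, y) v)"
  obtains r F where "r > 0" "F x0 = y0"
    "\<And>x. x \<in> ball x0 r \<Longrightarrow> (x, F x) \<in> S"
    "\<And>x. x \<in> ball x0 r \<Longrightarrow> (F has_derivative f (x, F x)) (at x)"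
proof -
  obtain \<Phi> :: "'a \<times> 'b \<Rightarrow> 'a \<Rightarrow>\<^sub>L 'b" and \<Phi>' :: "'a \<times> 'b \<Rightarrow> ('a \<times> 'b) \<Rightarrow>\<^sub>L ('a \<Rightarrow>\<^sub>L 'b)"
    where \<Phi>: "\<And>p. p \<in> S \<Longrightarrow> blinfun_apply (\<Phi> p) = f p"
      "\<And>p. p \<in> S \<Longrightarrow> (\<Phi> has_derivative blinfun_apply (\<Phi>' p)) (at p)" "continuous_on S \<Phi>'"
      "\<And>p q v. p \<in> S \<Longrightarrow> blinfun_apply (blinfun_apply (\<Phi>' p) q) v = frechet_derivative (\<lambda>p. f p v) (at p) q"
    by (rule smooth_family_blinfun[OF S(1) lin smooth]) blast+
  obtain r F where F: "r > 0" "F x0 = y0"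
    "\<And>x. x \<in> ball x0 r \<Longrightarrow> (x, F x) \<in> S"
    "\<And>x. x \<in> ball x0 r \<Longrightarrow> (F has_derivative blinfun_apply (\<Phi> (x, F x))) (at x)"
  proof (rule frobenius_local[OF S \<Phi>(2,3)])
    show "blinfun_apply (blinfun_apply (\<Phi>' (x, y)) (u, blinfun_apply (\<Phi> (x, y)) u)) v
        = blinfun_apply (blinfun_apply (\<Phi>' (x, y)) (v, blinfun_apply (\<Phi> (x, y)) v)) u"
      if "(x, y) \<in> S" for x y u v
      using integrable[OF that] by (simp add: \<Phi>(1,4)[OF that])
  qed blast+
  show thesis by (rule that[OF F(1,2,3)]) (use F(3,4) \<Phi>(1) in force)+
qed

theorem total_system_unique:
  fixes f :: "'a::euclidean_space \<times> 'b::euclidean_space \<Rightarrow> 'a \<Rightarrow> 'b"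
  assumes S: "open S" "(x0, y0) \<in> S" and lin: "\<And>p. p \<in> S \<Longrightarrow> linear (f p)"
    and smooth: "\<And>v. smooth_on S (\<lambda>p. f p v)"
    and V: "open V" "x0 \<in> V"
    and F: "F x0 = y0" "\<And>x. x \<in> V \<Longrightarrow> (F has_derivative f (x, F x)) (at x)"
    and H: "H x0 = y0" "\<And>x. x \<in> V \<Longrightarrow> (H has_derivative f (x, H x)) (at x)"
  obtains r where "r > 0" "ball x0 r \<subseteq> V" "\<And>x. x \<in> ball x0 r \<Longrightarrow> F x = H x"
proof -
  obtain \<Phi> :: "'a \<times> 'b \<Rightarrow> 'a \<Rightarrow>\<^sub>L 'b" and \<Phi>' :: "'a \<times> 'b \<Rightarrow> ('a \<times> 'b) \<Rightarrow>\<^sub>L ('a \<Rightarrow>\<^sub>L 'b)"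
    where \<Phi>: "\<And>p. p \<in> S \<Longrightarrow> blinfun_apply (\<Phi> p) = f p"
      "\<And>p. p \<in> S \<Longrightarrow> (\<Phi> has_derivative blinfun_apply (\<Phi>' p)) (at p)" "continuous_on S \<Phi>'"
    by (rule smooth_family_blinfun[OF S(1) lin smooth]) blast+
  obtain R M K where R: "R > 0" "cball x0 R \<times> cball y0 R \<subseteq> S"
    and Lb: "\<And>x y y'. x \<in> cball x0 R \<Longrightarrow> y \<in> cball y0 R \<Longrightarrow> y' \<in> cball y0 R \<Longrightarrow>
      norm (\<Phi> (x, y) - \<Phi> (x, y')) \<le> K * norm (y - y')"
    by (rule C1_local_bounds[OF S \<Phi>(2,3)]) blast+
  have near: "\<forall>\<^sub>F x in nhds x0. G x \<in> cball y0 R" if "(G has_derivative G') (at x0)" "G x0 = y0" for G G'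
  proof -
    have "(G \<longlongrightarrow> y0) (nhds x0)"
      using has_derivative_continuous[OF that(1)] that(2) by (simp add: continuous_at tendsto_nhds_iff)
    then have "\<forall>\<^sub>F x in nhds x0. dist (G x) y0 < R" using R(1) by (rule tendstoD)
    then show ?thesis by eventually_elim (simp add: dist_commute)
  qed
  have "\<forall>\<^sub>F x in nhds x0. x \<in> V \<and> x \<in> ball x0 R \<and> F x \<in> cball y0 R \<and> H x \<in> cball y0 R"
    using R(1) near[OF F(2)[OF V(2)] F(1)] near[OF H(2)[OF V(2)] H(1)]
    by (intro eventually_conj eventually_nhds_in_open V open_ball) auto
  then obtain \<rho> where \<rho>: "\<rho> > 0"
    "\<And>x. dist x x0 < \<rho> \<Longrightarrow> x \<in> V \<and> x \<in> ball x0 R \<and> F x \<in> cball y0 R \<and> H x \<in> cball y0 R"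
    by (auto simp: eventually_nhds_metric)
  have in_ball: "x \<in> V" "x \<in> cball x0 R" "F x \<in> cball y0 R" "H x \<in> cball y0 R" if "x \<in> ball x0 \<rho>" for x
    using \<rho>(2)[of x] that by (auto simp: dist_commute)
  obtain r where r: "r > 0" "r \<le> \<rho>" "\<And>x. x \<in> ball x0 r \<Longrightarrow> F x - H x = 0"
  proof (rule eq_zero_of_derivative_bound[OF \<rho>(1), of "\<lambda>x. F x - H x" x0 "\<lambda>x v. f (x, F x) v - f (x, H x) v" K])
    show "F x0 - H x0 = 0" by (simp add: F H)
    fix x assume x: "x \<in> ball x0 \<rho>"
    note ib = in_ball[OF x]
    show "((\<lambda>x. F x - H x) has_derivative (\<lambda>v. f (x, F x) v - f (x, H x) v)) (at x)"
      by (intro has_derivative_diff F(2) H(2) ib)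
    have mem: "(x, F x) \<in> S" "(x, H x) \<in> S" using ib R(2) by auto
    fix v
    have "norm (f (x, F x) v - f (x, H x) v) = norm (blinfun_apply (\<Phi> (x, F x) - \<Phi> (x, H x)) v)"
      by (simp add: \<Phi>(1)[OF mem(1)] \<Phi>(1)[OF mem(2)] blinfun.diff_left)
    also have "\<dots> \<le> norm (\<Phi> (x, F x) - \<Phi> (x, H x)) * norm v" by (rule norm_blinfun)
    also have "\<dots> \<le> K * norm (F x - H x) * norm v"
      by (intro mult_right_mono Lb ib) auto
    finally show "norm (f (x, F x) v - f (x, H x) v) \<le> K * norm (F x - H x) * norm v" .
  qed blast+
  show thesis
  proof (rule that[OF r(1)])
    show "ball x0 r \<subseteq> V" using in_ball(1) r(2) by auto
    show "F x = H x" if "x \<in> ball x0 r" for x using r(3)[OF that] by simp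
  qed
qed

section \<open>Curvature of a Levi-Civita connection\<close>

text \<open>A tensor with the symmetries of a curvature tensor is determined by its sectional values.
  Vanishing of \<open>T u v v u\<close> and polarization make \<open>T\<close> skew under the exchange of the outer slots
  too, hence totally skew; the Bianchi identity then reads \<open>3 T = 0\<close>.\<close>

lemma curvature_like_eq_zero:
  fixes T :: "'a::ab_group_add \<Rightarrow> 'a \<Rightarrow> 'a \<Rightarrow> 'a \<Rightarrow> real"
  assumes add1: "\<And>u u' v w z. T (u + u') v w z = T u v w z + T u' v w z"
    and add2: "\<And>u v v' w z. T u (v + v') w z = T u v w z + T u v' w z"
    and add3: "\<And>u v w w' z. T u v (w + w') z = T u v w z + T u v w' z"
    and add4: "\<And>u v w z z'. T u v w (z + z') = T u v w z + T u v w z'"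
    and skew12: "\<And>u v w z. T v u w z = - T u v w z"
    and diag34: "\<And>u v w. T u v w w = 0"
    and bianchi: "\<And>u v w z. T u v w z + T v w u z + T w u v z = 0"
    and sect: "\<And>u v. T u v v u = 0"
  shows "T u v w z = 0"
proof -
  have skew34: "T u v z w = - T u v w z" for u v w z
    using diag34[of u v "w + z"] diag34[of u v w] diag34[of u v z] by (simp add: add3 add4)
  have pair: "T w u v z = T v z w u" for u v w z
    using bianchi[of u v w z] bianchi[of v w z u] bianchi[of w z u v] bianchi[of z u v w]
      skew34[of u v w z] skew34[of v w u z] skew34[of w z u v] skew34[of z u v w]
      skew12[of w u z v] skew34[of w u v z] skew12[of z v u w] skew34[of z v w u] skew12[of z v w u]
    by linarith
  have T_uvwu: "T u v w u = 0" for u v w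
    using sect[of u "v + w"] sect[of u v] sect[of u w] pair[of u w v u] skew12[of u v u w] skew34[of u v w u]
    by (simp add: add2 add3)
  have skew14: "T z v w u = - T u v w z" for u v w z
    using T_uvwu[of "u + z" v w] T_uvwu[of u v w] T_uvwu[of z v w] by (simp add: add1 add4)
  have skew24: "T u z w v = - T u v w z" for u v w z
    using skew14[of v z w u] skew12[of z v w u] skew14[of z v w u] by simp
  have skew23: "T u w v z = - T u v w z" for u v w z
    using skew34[of u w v z] skew24[of u w z v] skew34[of u v w z] by simp
  have "T v w u z = T u v w z" "T w u v z = T u v w z"
    using skew23[of v u w z] skew12[of u v w z] skew12[of w u v z] skew23[of u v w z] by simp_all
  with bianchi[of u v w z] show ?thesis by simp
qed

text \<open>A Riemannian metric on an open set together with its Levi-Civita connection.\<close>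

locale levi_civita_metric =
  fixes U :: "(real^'n) set" and g :: "'n metric"
    and nabla :: "'n vfield \<Rightarrow> 'n vfield \<Rightarrow> 'n vfield"
  assumes open_U: "open U"
    and metric: "riemannian_metric_on U g"
    and levi_civita: "levi_civita_on U g nabla"
begin

lemma bilinear_g: "x \<in> U \<Longrightarrow> bilinear (g x)"
  and g_commute: "x \<in> U \<Longrightarrow> g x u v = g x v u"
  and smooth_g_const: "smooth_on U (\<lambda>x. g x u v)"
  using metric unfolding riemannian_metric_on_def by blast+

lemma g_simps:
  assumes "x \<in> U"
  shows "g x (u + u') v = g x u v + g x u' v" "g x u (v + v') = g x u v + g x u v'"
    "g x (u - u') v = g x u v - g x u' v" "g x u (v - v') = g x u v - g x u v'"
    "g x (c *\<^sub>R u) v = c * g x u v" "g x u (c *\<^sub>R v) = c * g x u v"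
    "g x (- u) v = - g x u v" "g x u (- v) = - g x u v"
    "g x 0 v = 0" "g x u 0 = 0"
  using bilinear_g[OF assms]
  by (simp_all add: bilinear_ladd bilinear_radd bilinear_lsub bilinear_rsub bilinear_lmul bilinear_rmul
      bilinear_lneg bilinear_rneg bilinear_lzero bilinear_rzero)

lemma g_sum:
  assumes "x \<in> U"
  shows "g x (sum f I) v = (\<Sum>i\<in>I. g x (f i) v)" "g x v (sum f I) = (\<Sum>i\<in>I. g x v (f i))"
  using bilinear_g[OF assms] linear_sum[of "\<lambda>u. g x u v" f I] linear_sum[of "g x v" f I]
  by (auto simp: bilinear_def)

lemma smooth_g:
  assumes "smooth_on U Y" "smooth_on U Z"
  shows "smooth_on U (\<lambda>x. g x (Y x) (Z x))"
proof -
  have basis: "(\<Sum>i\<in>UNIV. (y $ i) *\<^sub>R axis i 1) = y" for y :: "real^'n"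
    by (simp add: vec_eq_iff axis_def if_distrib cong: if_cong)
  have sm: "smooth_on U (\<lambda>x. \<Sum>i\<in>UNIV. \<Sum>j\<in>UNIV. (Y x $ i * Z x $ j) * g x (axis i 1) (axis j 1))"
    by (intro smooth_on_sum open_U smooth_on_mult smooth_on_nth assms smooth_g_const)
  have eq: "(\<Sum>i\<in>UNIV. \<Sum>j\<in>UNIV. (Y x $ i * Z x $ j) * g x (axis i 1) (axis j 1)) = g x (Y x) (Z x)"
    if "x \<in> U" for x
  proof -
    have "g x (Y x) (Z x) = g x (\<Sum>i\<in>UNIV. (Y x $ i) *\<^sub>R axis i 1) (\<Sum>j\<in>UNIV. (Z x $ j) *\<^sub>R axis j 1)"
      by (simp only: basis)
    also have "\<dots> = (\<Sum>i\<in>UNIV. \<Sum>j\<in>UNIV. (Y x $ i * Z x $ j) * g x (axis i 1) (axis j 1))"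
      by (simp add: g_sum(1)[OF that] g_simps[OF that])
        (simp add: g_sum(2)[OF that] g_simps[OF that] sum_distrib_left mult_ac)
    finally show ?thesis by simp
  qed
  show ?thesis by (rule smooth_on_cong[THEN iffD1, OF open_U eq sm])
qed

lemmas levi_civita_conjuncts =
  levi_civita[unfolded levi_civita_on_def affine_connection_on_def, THEN conjunct1]
  levi_civita[unfolded levi_civita_on_def, THEN conjunct2]

lemma smooth_nabla:
  assumes "smooth_on U X" "smooth_on U Y"
  shows "smooth_on U (nabla X Y)"
  using assms levi_civita_conjuncts(1)[THEN conjunct1, rule_format] by simp

lemma nabla_add_left:
  assumes "smooth_on U X" "smooth_on U X'" "smooth_on U Y" "x \<in> U"
  shows "nabla (\<lambda>y. X y + X' y) Y x = nabla X Y x + nabla X' Y x"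
  by (rule levi_civita_conjuncts(1)[THEN conjunct2, THEN conjunct1, rule_format])
    (intro conjI assms)+

lemma nabla_scale_left:
  assumes "smooth_on U f" "smooth_on U X" "smooth_on U Y" "x \<in> U"
  shows "nabla (\<lambda>y. f y *\<^sub>R X y) Y x = f x *\<^sub>R nabla X Y x"
  by (rule levi_civita_conjuncts(1)[THEN conjunct2, THEN conjunct2, THEN conjunct1, rule_format])
    (intro conjI assms)+

lemma nabla_add_right:
  assumes "smooth_on U X" "smooth_on U Y" "smooth_on U Y'" "x \<in> U"
  shows "nabla X (\<lambda>y. Y y + Y' y) x = nabla X Y x + nabla X Y' x"
  by (rule levi_civita_conjuncts(1)[THEN conjunct2, THEN conjunct2, THEN conjunct2, THEN conjunct1,
        rule_format]) (intro conjI assms)+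

lemma nabla_scale_right:
  assumes "smooth_on U f" "smooth_on U X" "smooth_on U Y" "x \<in> U"
  shows "nabla X (\<lambda>y. f y *\<^sub>R Y y) x = frechet_derivative f (at x) (X x) *\<^sub>R Y x + f x *\<^sub>R nabla X Y x"
  by (rule levi_civita_conjuncts(1)[THEN conjunct2, THEN conjunct2, THEN conjunct2, THEN conjunct2,
        rule_format]) (intro conjI assms)+

lemma torsion_free:
  assumes "smooth_on U X" "smooth_on U Y" "x \<in> U"
  shows "nabla X Y x - nabla Y X x = lie_bracket X Y x"
  by (rule levi_civita_conjuncts(2)[THEN conjunct1, rule_format]) (intro conjI assms)+

lemma metric_compatible:
  assumes "smooth_on U X" "smooth_on U Y" "smooth_on U Z" "x \<in> U"
  shows "frechet_derivative (\<lambda>y. g y (Y y) (Z y)) (at x) (X x) =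
      g x (nabla X Y x) (Z x) + g x (Y x) (nabla X Z x)"
  by (rule levi_civita_conjuncts(2)[THEN conjunct2, rule_format]) (intro conjI assms)+

text \<open>A connection is applied to vector fields on the whole space, but its values on \<open>U\<close> depend only
  on the restrictions to \<open>U\<close>: the difference of two fields agreeing on \<open>U\<close> is its own multiple by the
  function \<open>f\<close> that is \<open>0\<close> on \<open>U\<close> and \<open>1\<close> elsewhere, and \<open>f\<close> is smooth on the open set \<open>U\<close>.\<close>

lemma nabla_cong_right:
  assumes "smooth_on U X" "smooth_on U Y" "\<And>y. y \<in> U \<Longrightarrow> Y y = Y' y" "x \<in> U"
  shows "nabla X Y x = nabla X Y' x"
proof -
  define f :: "real^'n \<Rightarrow> real" where "f y = (if y \<in> U then 0 else 1)" for y
  have Y': "smooth_on U Y'" by (rule smooth_on_cong[THEN iffD1, OF open_U assms(3,2)])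
  have f: "smooth_on U f"
    using smooth_on_cong[OF open_U, of f "\<lambda>_. 0"] smooth_on_const by (auto simp: f_def)
  have f': "frechet_derivative f (at x) = (\<lambda>_. 0)"
    using frechet_derivative_cong_open[OF open_U assms(4), of f "\<lambda>_. 0"] by (simp add: f_def)
  have d: "smooth_on U (\<lambda>y. Y' y - Y y)" by (intro smooth_on_diff open_U Y' assms)
  have "nabla X (\<lambda>y. f y *\<^sub>R (Y' y - Y y)) x = 0"
    using nabla_scale_right[OF f assms(1) d assms(4)] assms(3,4) by (simp add: f' f_def)
  moreover have "Y' = (\<lambda>y. Y y + f y *\<^sub>R (Y' y - Y y))"
    using assms(3) by (auto simp: f_def)
  ultimately show ?thesis
    using nabla_add_right[OF assms(1,2) smooth_on_scaleR[OF open_U f d] assms(4)] by simp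
qed

lemma smooth_const: "smooth_on U (\<lambda>_. c)"
  by (rule smooth_on_const)

lemma torsion_free_const: "x \<in> U \<Longrightarrow> nabla (\<lambda>_. u) (\<lambda>_. v) x = nabla (\<lambda>_. v) (\<lambda>_. u) x"
  using torsion_free[OF smooth_const smooth_const, of x u v] by (simp add: lie_bracket_def)

lemma nabla_const_add_left:
  "smooth_on U Y \<Longrightarrow> x \<in> U \<Longrightarrow> nabla (\<lambda>_. u + v) Y x = nabla (\<lambda>_. u) Y x + nabla (\<lambda>_. v) Y x"
  by (rule nabla_add_left[OF smooth_const smooth_const])

lemma nabla_const_scale_left:
  "smooth_on U Y \<Longrightarrow> x \<in> U \<Longrightarrow> nabla (\<lambda>_. c *\<^sub>R u) Y x = c *\<^sub>R nabla (\<lambda>_. u) Y x"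
  by (rule nabla_scale_left[OF smooth_const smooth_const])

lemma nabla_const_scale_right:
  "smooth_on U X \<Longrightarrow> smooth_on U Y \<Longrightarrow> x \<in> U \<Longrightarrow> nabla X (\<lambda>y. c *\<^sub>R Y y) x = c *\<^sub>R nabla X Y x"
  using nabla_scale_right[OF smooth_const] by simp

text \<open>The curvature operator in two constant directions, whose Lie bracket vanishes.\<close>

abbreviation curv :: "real^'n \<Rightarrow> real^'n \<Rightarrow> 'n vfield \<Rightarrow> 'n vfield" where
  "curv u v Z \<equiv> curvature nabla (\<lambda>_. u) (\<lambda>_. v) Z"

lemma curv_eq:
  assumes "smooth_on U Z" "x \<in> U"
  shows "curv u v Z x = nabla (\<lambda>_. u) (nabla (\<lambda>_. v) Z) x - nabla (\<lambda>_. v) (nabla (\<lambda>_. u) Z) x"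
proof -
  have "lie_bracket (\<lambda>_. u) (\<lambda>_. v) = (\<lambda>_. 0)" by (rule ext) (simp add: lie_bracket_def)
  moreover have "nabla (\<lambda>_. 0) Z x = 0"
    using nabla_const_scale_left[OF assms, of 0 0] by simp
  ultimately show ?thesis by (simp add: curvature_def)
qed

lemma curv_skew: "smooth_on U Z \<Longrightarrow> x \<in> U \<Longrightarrow> curv v u Z x = - curv u v Z x"
  by (simp add: curv_eq)

lemma curv_add_left:
  assumes "smooth_on U Z" "x \<in> U"
  shows "curv (u + u') v Z x = curv u v Z x + curv u' v Z x"
proof -
  have n: "smooth_on U (nabla (\<lambda>_. w) Z)" for w by (intro smooth_nabla smooth_const assms)
  have "nabla (\<lambda>_. v) (nabla (\<lambda>_. u + u') Z) x
      = nabla (\<lambda>_. v) (\<lambda>y. nabla (\<lambda>_. u) Z y + nabla (\<lambda>_. u') Z y) x"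
    by (intro nabla_cong_right n smooth_const nabla_const_add_left assms)
  also have "\<dots> = nabla (\<lambda>_. v) (nabla (\<lambda>_. u) Z) x + nabla (\<lambda>_. v) (nabla (\<lambda>_. u') Z) x"
    by (intro nabla_add_right n smooth_const assms)
  finally show ?thesis
    by (simp add: curv_eq[OF assms] nabla_const_add_left[OF n assms(2)])
qed

lemma curv_scale_left:
  assumes "smooth_on U Z" "x \<in> U"
  shows "curv (c *\<^sub>R u) v Z x = c *\<^sub>R curv u v Z x"
proof -
  have n: "smooth_on U (nabla (\<lambda>_. w) Z)" for w by (intro smooth_nabla smooth_const assms)
  have "nabla (\<lambda>_. v) (nabla (\<lambda>_. c *\<^sub>R u) Z) x = nabla (\<lambda>_. v) (\<lambda>y. c *\<^sub>R nabla (\<lambda>_. u) Z y) x"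
    by (intro nabla_cong_right n smooth_const nabla_const_scale_left assms)
  also have "\<dots> = c *\<^sub>R nabla (\<lambda>_. v) (nabla (\<lambda>_. u) Z) x"
    by (intro nabla_const_scale_right n smooth_const assms)
  finally show ?thesis
    by (simp add: curv_eq[OF assms] nabla_const_scale_left[OF n assms(2)] scaleR_diff_right)
qed

lemma curv_add_right:
  assumes Z: "smooth_on U Z" "smooth_on U Z'" and x: "x \<in> U"
  shows "curv u v (\<lambda>y. Z y + Z' y) x = curv u v Z x + curv u v Z' x"
proof -
  have n: "smooth_on U (nabla (\<lambda>_. w) Z)" "smooth_on U (nabla (\<lambda>_. w) Z')"
    "smooth_on U (nabla (\<lambda>_. w) (\<lambda>y. Z y + Z' y))" for w
    by (intro smooth_nabla smooth_const smooth_on_add open_U Z)+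
  have "nabla (\<lambda>_. u) (nabla (\<lambda>_. v) (\<lambda>y. Z y + Z' y)) x
      = nabla (\<lambda>_. u) (nabla (\<lambda>_. v) Z) x + nabla (\<lambda>_. u) (nabla (\<lambda>_. v) Z') x" for u v
  proof -
    have "nabla (\<lambda>_. u) (nabla (\<lambda>_. v) (\<lambda>y. Z y + Z' y)) x
        = nabla (\<lambda>_. u) (\<lambda>y. nabla (\<lambda>_. v) Z y + nabla (\<lambda>_. v) Z' y) x"
      by (intro nabla_cong_right n smooth_const nabla_add_right Z x)
    then show ?thesis using nabla_add_right[OF smooth_const n(1,2) x] by simp
  qed
  then show ?thesis using Z by (simp add: curv_eq smooth_on_add open_U x)
qed

text \<open>Tensoriality in the differentiated slot: the first derivatives of \<open>f\<close> cancel by skewness, the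
  second ones by symmetry.\<close>

lemma curv_scale_right:
  assumes f: "smooth_on U f" and Z: "smooth_on U Z" and x: "x \<in> U"
  shows "curv u v (\<lambda>y. f y *\<^sub>R Z y) x = f x *\<^sub>R curv u v Z x"
proof -
  define D where "D w y = frechet_derivative f (at y) w" for w y
  have D: "smooth_on U (D w)" for w unfolding D_def by (rule smooth_on_deriv[OF f])
  have n: "smooth_on U (nabla (\<lambda>_. w) Z)" "smooth_on U (nabla (\<lambda>_. w) (\<lambda>y. f y *\<^sub>R Z y))" for w
    by (intro smooth_nabla smooth_const smooth_on_scaleR open_U Z f)+
  have "nabla (\<lambda>_. u) (nabla (\<lambda>_. v) (\<lambda>y. f y *\<^sub>R Z y)) x
      = (frechet_derivative (D v) (at x) u *\<^sub>R Z x + D v x *\<^sub>R nabla (\<lambda>_. u) Z x)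
        + (D u x *\<^sub>R nabla (\<lambda>_. v) Z x + f x *\<^sub>R nabla (\<lambda>_. u) (nabla (\<lambda>_. v) Z) x)" for u v
  proof -
    have "nabla (\<lambda>_. u) (nabla (\<lambda>_. v) (\<lambda>y. f y *\<^sub>R Z y)) x
        = nabla (\<lambda>_. u) (\<lambda>y. D v y *\<^sub>R Z y + f y *\<^sub>R nabla (\<lambda>_. v) Z y) x"
      unfolding D_def by (intro nabla_cong_right n smooth_const nabla_scale_right Z f x)
    also have "\<dots> = nabla (\<lambda>_. u) (\<lambda>y. D v y *\<^sub>R Z y) x + nabla (\<lambda>_. u) (\<lambda>y. f y *\<^sub>R nabla (\<lambda>_. v) Z y) x"
      by (intro nabla_add_right smooth_const smooth_on_scaleR open_U D Z f n x)
    also have "nabla (\<lambda>_. u) (\<lambda>y. D v y *\<^sub>R Z y) x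
        = frechet_derivative (D v) (at x) u *\<^sub>R Z x + D v x *\<^sub>R nabla (\<lambda>_. u) Z x"
      by (rule nabla_scale_right[OF D smooth_const Z x])
    also have "nabla (\<lambda>_. u) (\<lambda>y. f y *\<^sub>R nabla (\<lambda>_. v) Z y) x
        = D u x *\<^sub>R nabla (\<lambda>_. v) Z x + f x *\<^sub>R nabla (\<lambda>_. u) (nabla (\<lambda>_. v) Z) x"
      using nabla_scale_right[OF f smooth_const n(1) x] by (simp add: D_def)
    finally show ?thesis .
  qed
  moreover have "frechet_derivative (D v) (at x) u = frechet_derivative (D u) (at x) v"
    unfolding D_def by (rule second_derivative_symmetric[OF open_U x f])
  ultimately show ?thesis
    using f Z x by (simp add: curv_eq smooth_on_scaleR open_U scaleR_diff_right)
qed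

lemma curv_tensorial:
  assumes Z: "smooth_on U Z" and x: "x \<in> U"
  shows "curv u v Z x = curv u v (\<lambda>_. Z x) x"
proof -
  have basis: "(\<Sum>i\<in>UNIV. (y $ i) *\<^sub>R axis i 1) = y" for y :: "real^'n"
    by (simp add: vec_eq_iff axis_def if_distrib cong: if_cong)
  have sum: "curv u v (\<lambda>y. \<Sum>i\<in>I. F i y) x = (\<Sum>i\<in>I. curv u v (F i) x)"
    if "\<And>i. smooth_on U (F i)" for F and I :: "'n set"
  proof (induction I rule: infinite_finite_induct)
    case (insert i I)
    then show ?case using curv_add_right[OF that[of i] smooth_on_sum[of U I F, OF open_U that] x] by simp
  qed (use curv_scale_right[OF smooth_const smooth_const x, of u v 0] in auto)
  have expand: "curv u v Y x = (\<Sum>i\<in>UNIV. (Y x $ i) *\<^sub>R curv u v (\<lambda>_. axis i 1) x)"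
    if Y: "smooth_on U Y" for Y
  proof -
    have "curv u v Y x = curv u v (\<lambda>y. \<Sum>i\<in>UNIV. (Y y $ i) *\<^sub>R axis i 1) x"
      by (simp only: basis)
    also have "\<dots> = (\<Sum>i\<in>UNIV. curv u v (\<lambda>y. (Y y $ i) *\<^sub>R axis i 1) x)"
      by (intro sum smooth_on_scaleR open_U smooth_on_nth Y smooth_const)
    also have "\<dots> = (\<Sum>i\<in>UNIV. (Y x $ i) *\<^sub>R curv u v (\<lambda>_. axis i 1) x)"
      by (intro sum.cong refl curv_scale_right smooth_on_nth open_U Y smooth_const x)
    finally show ?thesis .
  qed
  show ?thesis using expand[OF Z] expand[OF smooth_const, of "Z x"] by simp
qed

text \<open>Skewness of the curvature operator: twice the left-hand side is the commutator of the mixed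
  second derivatives of \<open>g(w, w)\<close>.\<close>

lemma g_curv_diagonal:
  assumes x: "x \<in> U"
  shows "g x (curv u v (\<lambda>_. w) x) w = 0"
proof -
  let ?w = "\<lambda>_. w :: real^'n"
  have n: "smooth_on U (nabla (\<lambda>_. v) ?w)" for v by (intro smooth_nabla smooth_const)
  have first: "frechet_derivative (\<lambda>y. g y w w) (at y) v = 2 * g y (nabla (\<lambda>_. v) ?w y) w"
    if "y \<in> U" for y v
    using metric_compatible[OF smooth_const smooth_const smooth_const that, of w w v] g_commute[OF that] by simp
  have second: "frechet_derivative (\<lambda>y. frechet_derivative (\<lambda>y. g y w w) (at y) v) (at x) u
      = 2 * (g x (nabla (\<lambda>_. u) (nabla (\<lambda>_. v) ?w) x) w
          + g x (nabla (\<lambda>_. v) ?w x) (nabla (\<lambda>_. u) ?w x))" for u v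
  proof -
    have "frechet_derivative (\<lambda>y. frechet_derivative (\<lambda>y. g y w w) (at y) v) (at x) u
        = frechet_derivative (\<lambda>y. g y (2 *\<^sub>R nabla (\<lambda>_. v) ?w y) w) (at x) u"
      using frechet_derivative_cong_open[OF open_U x,
          of "\<lambda>y. frechet_derivative (\<lambda>y. g y w w) (at y) v" "\<lambda>y. g y (2 *\<^sub>R nabla (\<lambda>_. v) ?w y) w"]
      by (simp add: first g_simps)
    also have "\<dots> = g x (nabla (\<lambda>_. u) (\<lambda>y. 2 *\<^sub>R nabla (\<lambda>_. v) ?w y) x) w
        + g x (2 *\<^sub>R nabla (\<lambda>_. v) ?w x) (nabla (\<lambda>_. u) ?w x)"
      by (rule metric_compatible[OF smooth_const smooth_on_scaleR[OF open_U smooth_const n] smooth_const x])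
    finally show ?thesis
      by (simp add: nabla_const_scale_right[OF smooth_const n x] g_simps[OF x])
  qed
  show ?thesis
    using second_derivative_symmetric[OF open_U x smooth_g_const, of w w v u]
    unfolding second by (simp add: curv_eq[OF smooth_const x] g_simps[OF x] g_commute[OF x])
qed

lemma curv_bianchi:
  assumes x: "x \<in> U"
  shows "curv u v (\<lambda>_. w) x + curv v w (\<lambda>_. u) x + curv w u (\<lambda>_. v) x = 0"
proof -
  have "nabla (\<lambda>_. p) (nabla (\<lambda>_. q) (\<lambda>_. s)) x = nabla (\<lambda>_. p) (nabla (\<lambda>_. s) (\<lambda>_. q)) x" for p q s
    by (intro nabla_cong_right smooth_const smooth_nabla x torsion_free_const)
  note this[of u v w] this[of v w u] this[of w u v]
  then show ?thesis by (simp add: curv_eq[OF smooth_const x])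
qed

lemma g_curv_constant_curvature:
  assumes K: "constant_curvature_on U g nabla (-1)" and Z: "smooth_on U Z" and x: "x \<in> U"
  shows "g x (curv u v Z x) z = g x u (Z x) * g x v z - g x v (Z x) * g x u z"
proof -
  \<comment> \<open>The difference between the curvature tensor and that of the model space of curvature \<open>-1\<close>.\<close>
  define T where "T u v w z = g x (curv u v (\<lambda>_. w) x) z + (g x v w * g x u z - g x u w * g x v z)" for u v w z
  note gs = g_simps[OF x]
  have sect: "T u v v u = 0" for u v
  proof (cases "u \<noteq> v \<and> independent {u, v}")
    case True
    then have "sectional_curvature g nabla x u v = -1"
      using K x unfolding constant_curvature_on_def by blast
    \<comment> \<open>The denominator cannot be \<open>0\<close>, since then the quotient would be \<open>0\<close> and not \<open>-1\<close>.\<close>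
    then show ?thesis
      unfolding sectional_curvature_def T_def
      by (cases "g x u u * g x v v - (g x u v)\<^sup>2 = 0")
        (auto simp: divide_eq_eq power2_eq_square g_commute[OF x] algebra_simps)
  next
    case False
    have "curv v v Y x = 0" if "smooth_on U Y" for v Y using that by (simp add: curv_eq x)
    moreover have "curv u 0 Y x = 0" if "smooth_on U Y" for u Y
      using curv_scale_left[OF that x, of 0 0 u] curv_skew[OF that x, of 0 u] by simp
    moreover have "v = 0 \<or> (\<exists>c. u = c *\<^sub>R v)"
      using False by (cases "u = v")
        (auto simp: independent_insert span_singleton dependent_single intro: exI[of _ 1])
    ultimately show ?thesis
      by (auto simp: T_def curv_scale_left smooth_const x gs g_commute[OF x])
  qed
  have "T u v (Z x) z = 0"
  proof (rule curvature_like_eq_zero[of T])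
    fix u u' v v' w w' z z'
    note s = smooth_const x
    show "T (u + u') v w z = T u v w z + T u' v w z"
      by (simp add: T_def curv_add_left[OF s] gs algebra_simps)
    have "curv u (v + v') (\<lambda>_. w) x = curv u v (\<lambda>_. w) x + curv u v' (\<lambda>_. w) x"
      using curv_add_left[OF s, of v v' u w] curv_skew[OF s, of u] by (metis add_uminus_conv_diff minus_add_distrib minus_minus)
    then show "T u (v + v') w z = T u v w z + T u v' w z"
      by (simp add: T_def gs algebra_simps)
    show "T u v (w + w') z = T u v w z + T u v w' z"
      by (simp add: T_def curv_add_right[OF smooth_const s] gs algebra_simps)
    show "T u v w (z + z') = T u v w z + T u v w z'"
      by (simp add: T_def gs algebra_simps)
    show "T v u w z = - T u v w z"
      by (simp add: T_def curv_skew[OF s, of v u] gs)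
    show "T u v w w = 0"
      by (simp add: T_def g_curv_diagonal[OF x])
    have "g x (curv u v (\<lambda>_. w) x + curv v w (\<lambda>_. u) x + curv w u (\<lambda>_. v) x) z = 0"
      by (simp add: curv_bianchi[OF x] gs)
    then show "T u v w z + T v w u z + T w u v z = 0"
      by (simp add: T_def gs g_commute[OF x])
    show "T u v v u = 0" by (rule sect)
  qed
  then show ?thesis by (simp add: T_def curv_tensorial[OF Z x, of u v])
qed

end

section \<open>Structure equations of an orthonormal frame\<close>

lemma vector_derivative_nth:
  fixes F :: "'a::real_normed_vector \<Rightarrow> ('b::euclidean_space)^'n"
  assumes "(F has_derivative F') (at x)"
  shows "frechet_derivative (\<lambda>y. F y $ i) (at x) u = F' u $ i"
  using frechet_derivative_eqI[OF bounded_linear.has_derivative[OF bounded_linear_vec_nth assms]] by simp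

lemma linear_vec_iff:
  fixes F :: "'a::real_vector \<Rightarrow> ('b::real_vector)^'n"
  shows "linear F \<longleftrightarrow> (\<forall>i. linear (\<lambda>v. F v $ i))"
  by (auto simp: linear_iff vec_eq_iff)

text \<open>The analytic data of a moving frame: the vector-valued 1-form \<open>om\<close> of dual forms and the
  skew matrix \<open>W\<close> of connection forms, subject to \<open>d\<omega> = W \<and> \<omega>\<close> and
  \<open>dW = W \<and> W + \<omega> \<and> \<omega>\<^sup>t\<close>.  The exterior derivatives are evaluated on constant fields \<open>u\<close> and \<open>v\<close>,
  and the second equation is applied to an arbitrary vector \<open>r\<close>.\<close>

locale structure_equations =
  fixes U :: "(real^'n) set" and om :: "real^'n \<Rightarrow> real^'n \<Rightarrow> real^'n"
    and W :: "real^'n \<Rightarrow> real^'n \<Rightarrow> real^'n^'n"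
  assumes open_U: "open U"
    and linear_om: "x \<in> U \<Longrightarrow> linear (om x)"
    and linear_W: "x \<in> U \<Longrightarrow> linear (W x)"
    and smooth_om: "smooth_on U (\<lambda>x. om x v)"
    and smooth_W: "smooth_on U (\<lambda>x. W x v)"
    and W_skew: "x \<in> U \<Longrightarrow> W x v $ i $ j = - W x v $ j $ i"
    and first_structure: "x \<in> U \<Longrightarrow>
      frechet_derivative (\<lambda>y. om y v) (at x) u - frechet_derivative (\<lambda>y. om y u) (at x) v
        = W x u *v om x v - W x v *v om x u"
    and second_structure: "x \<in> U \<Longrightarrow>
      frechet_derivative (\<lambda>y. W y v) (at x) u *v r - frechet_derivative (\<lambda>y. W y u) (at x) v *v r
        = W x u *v (W x v *v r) - W x v *v (W x u *v r) + (om x v \<bullet> r) *\<^sub>R om x u - (om x u \<bullet> r) *\<^sub>R om x v"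

text \<open>An orthonormal frame \<open>e\<close> of a metric with Levi-Civita connection, with dual forms \<open>\<omega>\<close>.\<close>

locale orthonormal_frame = levi_civita_metric U g nabla
  for U :: "(real^'n) set" and g :: "'n metric"
    and nabla :: "'n vfield \<Rightarrow> 'n vfield \<Rightarrow> 'n vfield" +
  fixes e :: "'n \<Rightarrow> 'n vfield" and \<omega> :: "'n \<Rightarrow> real^'n \<Rightarrow> real^'n \<Rightarrow> real"
  assumes frame: "orthonormal_frame_on U g e"
    and dual: "dual_forms_on U e \<omega>"
begin

text \<open>The matrix of connection forms of the frame.\<close>

abbreviation W where "W \<equiv> connection_matrix g nabla e"

lemma smooth_e: "smooth_on U (e i)"
  and g_e: "x \<in> U \<Longrightarrow> g x (e i x) (e j x) = (if i = j then 1 else 0)"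
  using frame unfolding orthonormal_frame_on_def by blast+

lemma linear_\<omega>: "x \<in> U \<Longrightarrow> linear (\<omega> i x)"
  and \<omega>_e: "x \<in> U \<Longrightarrow> \<omega> i x (e j x) = (if i = j then 1 else 0)"
  using dual unfolding dual_forms_on_def by blast+

lemma W_nth: "W x v $ i $ j = g x (nabla (\<lambda>_. v) (e i) x) (e j x)"
  by (simp add: connection_matrix_def)

lemma frame_coordinates:
  assumes x: "x \<in> U"
  obtains c where "v = (\<Sum>j\<in>UNIV. (c $ j) *\<^sub>R e j x)"
proof -
  define T :: "real^'n \<Rightarrow> real^'n" where "T c = (\<Sum>j\<in>UNIV. (c $ j) *\<^sub>R e j x)" for c
  have "linear T"
    by (rule linearI) (simp_all add: T_def scaleR_add_left sum.distrib scaleR_sum_right)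
  moreover have "c = 0" if "T c = 0" for c
  proof -
    have "g x (T c) (e i x) = c $ i" for i
      by (simp add: T_def g_sum[OF x] g_simps[OF x] g_e[OF x] if_distrib cong: if_cong)
    then show ?thesis using that by (simp add: vec_eq_iff g_simps[OF x])
  qed
  ultimately have "surj T"
    using linear_injective_imp_surjective[of T] by (simp add: linear_injective_0)
  then show thesis using that by (auto simp: T_def surj_def)
qed

text \<open>The dual forms, given on \<open>U\<close> only by duality, are the metric duals of the frame; in particular
  they are smooth.\<close>

lemma \<omega>_eq: "x \<in> U \<Longrightarrow> \<omega> i x v = g x v (e i x)"
  by (rule frame_coordinates[of x v])
    (auto simp: linear_sum[OF linear_\<omega>] linear_cmul[OF linear_\<omega>] \<omega>_e g_sum g_simps g_e if_distrib cong: if_cong)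

lemma frame_expand:
  assumes x: "x \<in> U"
  shows "(\<Sum>j\<in>UNIV. \<omega> j x v *\<^sub>R e j x) = v"
proof -
  obtain c where c: "v = (\<Sum>j\<in>UNIV. (c $ j) *\<^sub>R e j x)" by (rule frame_coordinates[OF x])
  have "\<omega> i x v = c $ i" for i
    unfolding c by (simp add: \<omega>_eq[OF x] g_sum[OF x] g_simps[OF x] g_e[OF x] if_distrib cong: if_cong)
  then show ?thesis using c by simp
qed

lemma g_expand:
  assumes x: "x \<in> U"
  shows "g x v w = (\<Sum>k\<in>UNIV. \<omega> k x v * \<omega> k x w)"
proof -
  have "g x v w = g x (\<Sum>k\<in>UNIV. \<omega> k x v *\<^sub>R e k x) w" by (simp add: frame_expand[OF x])
  then show ?thesis
    by (simp add: g_sum[OF x] g_simps[OF x] \<omega>_eq[OF x, of _ w] g_commute[OF x, of w])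
qed

lemma smooth_\<omega>: "smooth_on U (\<lambda>x. \<omega> i x v)"
  by (rule smooth_on_cong[THEN iffD1, OF open_U \<omega>_eq[symmetric] smooth_g[OF smooth_const smooth_e]])

lemma smooth_nabla_e: "smooth_on U (nabla (\<lambda>_. v) (e i))"
  by (intro smooth_nabla smooth_const smooth_e)

lemma smooth_W_nth: "smooth_on U (\<lambda>x. W x v $ i $ j)"
  unfolding W_nth by (intro smooth_g smooth_nabla_e smooth_e)

lemma linear_W_nth: "x \<in> U \<Longrightarrow> linear (\<lambda>v. W x v $ i $ j)"
  by (rule linearI)
    (simp_all add: W_nth nabla_const_add_left nabla_const_scale_left smooth_e g_simps)

lemma W_skew_nth:
  assumes x: "x \<in> U"
  shows "W x v $ i $ j = - W x v $ j $ i"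
proof -
  have "frechet_derivative (\<lambda>y. g y (e i y) (e j y)) (at x) v = 0"
    using frechet_derivative_cong_open[OF open_U x g_e] by simp
  then show ?thesis
    using metric_compatible[OF smooth_const[of v] smooth_e[of i] smooth_e[of j] x]
    by (simp add: W_nth g_commute[OF x, of "e i x"])
qed

lemma \<omega>_nabla: "x \<in> U \<Longrightarrow> \<omega> k x (nabla (\<lambda>_. v) (e i) x) = W x v $ i $ k"
  by (simp add: \<omega>_eq W_nth)

lemma first_structure_nth:
  assumes x: "x \<in> U"
  shows "frechet_derivative (\<lambda>y. \<omega> i y v) (at x) u - frechet_derivative (\<lambda>y. \<omega> i y u) (at x) v
    = (\<Sum>j\<in>UNIV. W x u $ i $ j * \<omega> j x v) - (\<Sum>j\<in>UNIV. W x v $ i $ j * \<omega> j x u)"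
proof -
  have "frechet_derivative (\<lambda>y. \<omega> i y v) (at x) u
      = g x (nabla (\<lambda>_. u) (\<lambda>_. v) x) (e i x) + g x v (nabla (\<lambda>_. u) (e i) x)" for u v
  proof -
    have "frechet_derivative (\<lambda>y. \<omega> i y v) (at x) = frechet_derivative (\<lambda>y. g y v (e i y)) (at x)"
      by (rule frechet_derivative_cong_open[OF open_U x \<omega>_eq])
    then show ?thesis
      using metric_compatible[OF smooth_const[of u] smooth_const[of v] smooth_e[of i] x] by simp
  qed
  moreover have "g x v (nabla (\<lambda>_. u) (e i) x) = (\<Sum>j\<in>UNIV. W x u $ i $ j * \<omega> j x v)" for u v
    by (subst g_commute[OF x]) (simp add: g_expand[OF x] \<omega>_nabla[OF x])
  ultimately show ?thesis using torsion_free_const[OF x, of u v] by simp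
qed

text \<open>Differentiating \<open>W\<^sub>i\<^sub>j(v) = g(\<nabla>\<^sub>v e\<^sub>i, e\<^sub>j)\<close> by metric compatibility produces the curvature operator
  and products of covariant derivatives; expanding the latter in the frame gives \<open>W \<and> W\<close>.\<close>

lemma second_structure_nth:
  assumes K: "constant_curvature_on U g nabla (-1)" and x: "x \<in> U"
  shows "frechet_derivative (\<lambda>y. W y v $ i $ j) (at x) u - frechet_derivative (\<lambda>y. W y u $ i $ j) (at x) v
    = (\<Sum>k\<in>UNIV. W x u $ i $ k * W x v $ k $ j) - (\<Sum>k\<in>UNIV. W x v $ i $ k * W x u $ k $ j)
      + \<omega> i x u * \<omega> j x v - \<omega> i x v * \<omega> j x u"
proof -
  have "frechet_derivative (\<lambda>y. W y v $ i $ j) (at x) u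
      = g x (nabla (\<lambda>_. u) (nabla (\<lambda>_. v) (e i)) x) (e j x)
        + g x (nabla (\<lambda>_. v) (e i) x) (nabla (\<lambda>_. u) (e j) x)" for u v
    unfolding W_nth by (rule metric_compatible[OF smooth_const smooth_nabla_e smooth_e x])
  moreover have "g x (nabla (\<lambda>_. v) (e i) x) (nabla (\<lambda>_. u) (e j) x)
      = - (\<Sum>k\<in>UNIV. W x v $ i $ k * W x u $ k $ j)" for u v
    by (simp add: g_expand[OF x] \<omega>_nabla[OF x] W_skew_nth[OF x, of u j] sum_negf)
  moreover have "g x (nabla (\<lambda>_. u) (nabla (\<lambda>_. v) (e i)) x) (e j x)
      - g x (nabla (\<lambda>_. v) (nabla (\<lambda>_. u) (e i)) x) (e j x) = \<omega> i x u * \<omega> j x v - \<omega> i x v * \<omega> j x u"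
    using g_curv_constant_curvature[OF K smooth_e x, of u v i "e j x"]
    by (simp add: curv_eq[OF smooth_e x] g_simps[OF x] \<omega>_eq[OF x])
  ultimately show ?thesis by simp
qed

text \<open>The dual forms assembled into one vector-valued form.\<close>

definition om :: "real^'n \<Rightarrow> real^'n \<Rightarrow> real^'n" where
  "om x v = (\<chi> k. \<omega> k x v)"

lemma om_nth: "om x v $ k = \<omega> k x v"
  by (simp add: om_def)

theorem structure_equations:
  assumes K: "constant_curvature_on U g nabla (-1)"
  shows "structure_equations U om W"
proof (rule structure_equations.intro)
  have som: "smooth_on U (\<lambda>x. om x v)" for v
    by (rule smooth_on_vec[OF open_U]) (simp add: om_nth smooth_\<omega>)
  have sW: "smooth_on U (\<lambda>x. W x v)" for v
    by (intro smooth_on_vec[OF open_U] smooth_W_nth)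
  show "open U" by (rule open_U)
  show "smooth_on U (\<lambda>x. om x v)" "smooth_on U (\<lambda>x. W x v)" for v
    by (rule som sW)+
  fix x assume x: "x \<in> U"
  show "linear (om x)" by (simp add: linear_vec_iff om_nth linear_\<omega>[OF x])
  show "linear (W x)" by (simp add: linear_vec_iff linear_W_nth[OF x])
  show "W x v $ i $ j = - W x v $ j $ i" for v i j by (rule W_skew_nth[OF x])
  have d\<omega>: "frechet_derivative (\<lambda>y. om y v) (at x) u $ i = frechet_derivative (\<lambda>y. \<omega> i y v) (at x) u" for u v i
    using vector_derivative_nth[OF smooth_on_has_derivative[OF som x], of v i u] by (simp add: om_nth)
  show "frechet_derivative (\<lambda>y. om y v) (at x) u - frechet_derivative (\<lambda>y. om y u) (at x) v
      = W x u *v om x v - W x v *v om x u" for u v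
    using first_structure_nth[OF x, of _ v u]
    by (simp add: vec_eq_iff d\<omega> matrix_vector_mult_def om_nth)
  have dW: "frechet_derivative (\<lambda>y. W y v) (at x) u $ i $ j = frechet_derivative (\<lambda>y. W y v $ i $ j) (at x) u"
    for u v i j
  proof -
    note d = smooth_on_has_derivative[OF sW x]
    show ?thesis
      using vector_derivative_nth[OF bounded_linear.has_derivative[OF bounded_linear_vec_nth d], of v i j u] by simp
  qed
  show "frechet_derivative (\<lambda>y. W y v) (at x) u *v r - frechet_derivative (\<lambda>y. W y u) (at x) v *v r
      = W x u *v (W x v *v r) - W x v *v (W x u *v r) + (om x v \<bullet> r) *\<^sub>R om x u - (om x u \<bullet> r) *\<^sub>R om x v"
    for u v r
  proof -
    have "frechet_derivative (\<lambda>y. W y v) (at x) u - frechet_derivative (\<lambda>y. W y u) (at x) v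
        = W x u ** W x v - W x v ** W x u + (\<chi> i j. om x u $ i * om x v $ j) - (\<chi> i j. om x v $ i * om x u $ j)"
      using second_structure_nth[OF K x, of v _ _ u]
      by (simp add: vec_eq_iff dW matrix_matrix_mult_def om_nth)
    from arg_cong[OF this, of "\<lambda>A. A *v r"]
    have "frechet_derivative (\<lambda>y. W y v) (at x) u *v r - frechet_derivative (\<lambda>y. W y u) (at x) v *v r
        = W x u *v (W x v *v r) - W x v *v (W x u *v r)
          + (\<chi> i j. om x u $ i * om x v $ j) *v r - (\<chi> i j. om x v $ i * om x u $ j) *v r"
      by (simp only: matrix_vector_mult_diff_rdistrib matrix_vector_mult_add_rdistrib matrix_vector_mul_assoc)
    moreover have "(\<chi> i j. p $ i * q $ j) *v r = (q \<bullet> r) *\<^sub>R p" for p q :: "real^'n"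
      by (simp add: vec_eq_iff matrix_vector_mult_def inner_vec_def sum_distrib_left sum_distrib_right mult_ac)
    ultimately show ?thesis by simp
  qed
qed

end

section \<open>The system as a total differential equation\<close>

lemma bounded_bilinear_matrix_vector: "bounded_bilinear (\<lambda>(A::real^'m^'n) x. A *v x)"
proof -
  have "bilinear (\<lambda>(A::real^'m^'n) x. A *v x)"
    unfolding bilinear_def
    by (auto intro!: linearI simp: algebra_simps scaleR_matrix_vector_assoc)
  then show ?thesis by (simp add: bilinear_conv_bounded_bilinear)
qed

lemma has_derivative_vec:
  fixes F :: "'a::real_normed_vector \<Rightarrow> ('b::euclidean_space)^'n"
  assumes "\<And>i. ((\<lambda>x. F x $ i) has_derivative (\<lambda>v. F' v $ i)) (at x)"
  shows "(F has_derivative F') (at x)"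
proof -
  have eq: "(\<Sum>i\<in>UNIV. axis i (f $ i)) = f" for f :: "'b^'n"
    by (auto simp: vec_eq_iff axis_def if_distrib if_distribR cong: if_cong)
  have "((\<lambda>x. \<Sum>i\<in>UNIV. axis i (F x $ i)) has_derivative (\<lambda>v. \<Sum>i\<in>UNIV. axis i (F' v $ i))) (at x)"
    by (intro has_derivative_sum bounded_linear.has_derivative[OF bounded_linear_axis] assms)
  then show ?thesis by (simp add: eq)
qed

lemma matrix_mult_transpose_nth:
  fixes A B :: "real^'n^'m"
  shows "(A ** transpose B) $ i $ j = A $ i \<bullet> B $ j"
  by (simp add: matrix_matrix_mult_def transpose_def inner_vec_def)

lemma conjugated_matrix_nth:
  fixes A B :: "real^'n^'n"
  shows "(A ** B ** transpose A) $ i $ j = A $ i \<bullet> (B *v A $ j)"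
proof -
  have "(A ** B ** transpose A) $ i $ j = (\<Sum>k\<in>UNIV. (\<Sum>l\<in>UNIV. A $ i $ l * B $ l $ k) * A $ j $ k)"
    by (simp add: matrix_matrix_mult_def transpose_def)
  also have "\<dots> = (\<Sum>k\<in>UNIV. \<Sum>l\<in>UNIV. A $ i $ l * B $ l $ k * A $ j $ k)"
    by (simp add: sum_distrib_right)
  also have "\<dots> = (\<Sum>l\<in>UNIV. \<Sum>k\<in>UNIV. A $ i $ l * B $ l $ k * A $ j $ k)"
    by (rule sum.swap)
  also have "\<dots> = A $ i \<bullet> (B *v A $ j)"
    by (simp add: inner_vec_def matrix_vector_mult_def sum_distrib_left mult.assoc)
  finally show ?thesis .
qed

lemma orthogonal_matrix_rows:
  fixes A :: "real^'n^'n"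
  shows "orthogonal_matrix A \<longleftrightarrow> (\<forall>i j. A $ i \<bullet> A $ j = (if i = j then 1 else 0))"
proof -
  have "orthogonal_matrix A \<longleftrightarrow> A ** transpose A = mat 1"
    by (metis orthogonal_matrix orthogonal_matrix_transpose transpose_transpose)
  then show ?thesis by (simp add: vec_eq_iff matrix_mult_transpose_nth mat_def)
qed

text \<open>Structure equations with a distinguished index \<open>a\<close>.\<close>

locale total_system = structure_equations U om W
  for U :: "(real^'n) set" and om :: "real^'n \<Rightarrow> real^'n \<Rightarrow> real^'n"
    and W :: "real^'n \<Rightarrow> real^'n \<Rightarrow> real^'n^'n" +
  fixes a :: 'n
begin

text \<open>The value of \<open>dL(v)\<close> prescribed by the system at the point \<open>x\<close> and the matrix \<open>A = L x\<close>, given by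
  its rows.  On orthogonal matrices it is forced; its extension to all matrices is chosen so that
  the compatibility condition persists.\<close>

definition rhs :: "real^'n \<Rightarrow> real^'n^'n \<Rightarrow> real^'n \<Rightarrow> real^'n^'n" where
  "rhs x A v = (\<chi> i. W x v *v A $ i + (A $ i \<bullet> om x v) *\<^sub>R A $ a - (if i = a then 1 else 0) *\<^sub>R om x v)"

text \<open>The derivatives of \<open>om\<close> and \<open>W\<close> in direction \<open>u\<close>, evaluated on the constant field \<open>v\<close>.\<close>

definition d_om :: "real^'n \<Rightarrow> real^'n \<Rightarrow> real^'n \<Rightarrow> real^'n" where
  "d_om x u v = frechet_derivative (\<lambda>y. om y v) (at x) u"

definition d_W :: "real^'n \<Rightarrow> real^'n \<Rightarrow> real^'n \<Rightarrow> real^'n^'n" where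
  "d_W x u v = frechet_derivative (\<lambda>y. W y v) (at x) u"

lemma rhs_nth: "rhs x A v $ i
    = W x v *v A $ i + (A $ i \<bullet> om x v) *\<^sub>R A $ a - (if i = a then 1 else 0) *\<^sub>R om x v"
  by (simp add: rhs_def)

lemma om_simps: "x \<in> U \<Longrightarrow> om x (u + v) = om x u + om x v" "x \<in> U \<Longrightarrow> om x (c *\<^sub>R v) = c *\<^sub>R om x v"
  and W_simps: "x \<in> U \<Longrightarrow> W x (u + v) = W x u + W x v" "x \<in> U \<Longrightarrow> W x (c *\<^sub>R v) = c *\<^sub>R W x v"
  using linear_om linear_W by (auto simp: linear_add linear_cmul)

lemma W_inner:
  assumes "x \<in> U"
  shows "(W x v *v p) \<bullet> q = - (p \<bullet> (W x v *v q))"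
proof -
  have "transpose (W x v) $ i $ j = (- W x v) $ i $ j" for i j
    using W_skew[OF assms, of v j i] by (simp add: transpose_def)
  then have "transpose (W x v) = - W x v" by (simp add: vec_eq_iff)
  then have "p \<bullet> (- W x v *v q) = (W x v *v p) \<bullet> q"
    using dot_lmul_matrix[of p "W x v" q] by (metis dot_lmul_matrix inner_commute transpose_matrix_vector)
  moreover have "- W x v *v q = - (W x v *v q)"
    by (simp add: vec_eq_iff matrix_vector_mult_def sum_negf)
  ultimately show ?thesis by simp
qed

lemma W_inner_self: "x \<in> U \<Longrightarrow> p \<bullet> (W x v *v p) = 0"
  using W_inner[of x v p p] by (simp add: inner_commute)

lemma linear_rhs: "x \<in> U \<Longrightarrow> linear (rhs x A)"
  by (rule linearI)
    (simp_all add: vec_eq_iff rhs_nth om_simps W_simps inner_add_right matrix_vector_mult_add_rdistrib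
      algebra_simps scaleR_matrix_vector_assoc[symmetric])

lemma d_om_derivative: "x \<in> U \<Longrightarrow> ((\<lambda>y. om y v) has_derivative (\<lambda>u. d_om x u v)) (at x)"
  unfolding d_om_def by (rule smooth_on_has_derivative[OF smooth_om])

lemma d_W_derivative: "x \<in> U \<Longrightarrow> ((\<lambda>y. W y v) has_derivative (\<lambda>u. d_W x u v)) (at x)"
  unfolding d_W_def by (rule smooth_on_has_derivative[OF smooth_W])

lemma d_om_commute: "x \<in> U \<Longrightarrow> d_om x u v = d_om x v u + W x u *v om x v - W x v *v om x u"
  using first_structure[of x v u] by (simp add: d_om_def algebra_simps)

lemma d_W_commute: "x \<in> U \<Longrightarrow> d_W x u v *v r = d_W x v u *v r + W x u *v (W x v *v r) - W x v *v (W x u *v r)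
    + (r \<bullet> om x v) *\<^sub>R om x u - (r \<bullet> om x u) *\<^sub>R om x v"
  using second_structure[of x v u r] by (simp add: d_W_def inner_commute algebra_simps)

lemma fst_derivative:
  assumes "(h has_derivative h') (at x)"
  shows "((\<lambda>p. h (fst p)) has_derivative (\<lambda>q. h' (fst q))) (at (x, A))"
  by (rule has_derivative_compose[OF has_derivative_fst[OF has_derivative_ident]]) (simp add: assms)

lemma snd_nth_derivative: "((\<lambda>p. snd p $ i) has_derivative (\<lambda>q. snd q $ i)) (at p)"
  by (intro bounded_linear.has_derivative[OF bounded_linear_vec_nth] has_derivative_snd has_derivative_ident)

text \<open>The derivative of \<open>(x, A) \<mapsto> rhs x A v\<close> in direction \<open>(u, M)\<close>.\<close>

definition d_rhs :: "real^'n \<Rightarrow> real^'n^'n \<Rightarrow> real^'n \<Rightarrow> real^'n^'n \<Rightarrow> real^'n \<Rightarrow> real^'n^'n" where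
  "d_rhs x A u M v = (\<chi> i. d_W x u v *v A $ i + W x v *v M $ i
     + (M $ i \<bullet> om x v + A $ i \<bullet> d_om x u v) *\<^sub>R A $ a + (A $ i \<bullet> om x v) *\<^sub>R M $ a
     - (if i = a then 1 else 0) *\<^sub>R d_om x u v)"

lemma rhs_derivative:
  assumes x: "x \<in> U"
  shows "((\<lambda>p. rhs (fst p) (snd p) v) has_derivative (\<lambda>q. d_rhs x A (fst q) (snd q) v)) (at (x, A))"
proof (rule has_derivative_vec)
  fix i
  note d = fst_derivative[OF d_om_derivative[OF x]] fst_derivative[OF d_W_derivative[OF x]] snd_nth_derivative
  note m = bounded_bilinear.FDERIV[OF bounded_bilinear_matrix_vector]
    has_derivative_inner has_derivative_scaleR
  have "((\<lambda>p. W (fst p) v *v snd p $ i + (snd p $ i \<bullet> om (fst p) v) *\<^sub>R snd p $ a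
        - (if i = a then 1 else 0) *\<^sub>R om (fst p) v) has_derivative
      (\<lambda>q. (W (fst (x, A)) v *v snd q $ i + d_W x (fst q) v *v snd (x, A) $ i)
        + ((snd (x, A) $ i \<bullet> om (fst (x, A)) v) *\<^sub>R snd q $ a
          + (snd (x, A) $ i \<bullet> d_om x (fst q) v + snd q $ i \<bullet> om (fst (x, A)) v) *\<^sub>R snd (x, A) $ a)
        - ((if i = a then 1 else 0) *\<^sub>R d_om x (fst q) v))) (at (x, A))"
    by (intro has_derivative_add has_derivative_diff m d has_derivative_scaleR_right)
  then show "((\<lambda>p. rhs (fst p) (snd p) v $ i) has_derivative (\<lambda>q. d_rhs x A (fst q) (snd q) v $ i)) (at (x, A))"
    unfolding rhs_nth by (simp add: d_rhs_def algebra_simps)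
qed

text \<open>The Frobenius compatibility condition, at every matrix \<open>A\<close>, orthogonal or not.\<close>

lemma rhs_integrable:
  assumes x: "x \<in> U"
  shows "d_rhs x A u (rhs x A u) v = d_rhs x A v (rhs x A v) u"
proof -
  have "d_rhs x A u (rhs x A u) v $ i = d_rhs x A v (rhs x A v) u $ i" for i
    unfolding d_rhs_def vec_lambda_beta rhs_nth
    by (simp add: d_W_commute[OF x, of u v] d_om_commute[OF x, of u v] W_inner[OF x]
        inner_add_left inner_add_right inner_diff_left inner_diff_right inner_commute[of "om x v" "om x u"]
        matrix_vector_right_distrib matrix_vector_mult_diff_distrib matrix_vector_mult_scaleR algebra_simps)
  then show ?thesis by (simp add: vec_eq_iff)
qed

lemma Ck_on_rhs:
  assumes "open T" "Ck_on k T (\<lambda>t. om (X t) v)" "Ck_on k T (\<lambda>t. W (X t) v)" "Ck_on k T A"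
  shows "Ck_on k T (\<lambda>t. rhs (X t) (A t) v)"
proof (rule Ck_on_vec[OF assms(1)])
  fix i
  have "Ck_on k T (\<lambda>t. A t $ i)" for i by (rule Ck_on_nth[OF assms(1,4)])
  then show "Ck_on k T (\<lambda>t. rhs (X t) (A t) v $ i)"
    unfolding rhs_nth
    by (intro Ck_on_add Ck_on_diff assms Ck_on_const
        bounded_bilinear.Ck_on_prod[OF bounded_bilinear_matrix_vector]
        bounded_bilinear.Ck_on_prod[OF bounded_bilinear_scaleR]
        bounded_bilinear.Ck_on_prod[OF bounded_bilinear_inner])
qed

lemma open_domain: "open (U \<times> (UNIV :: (real^'n^'n) set))"
  by (intro open_Times open_U open_UNIV)

lemma smooth_fst:
  assumes "smooth_on U h"
  shows "smooth_on (U \<times> (UNIV :: (real^'n^'n) set)) (\<lambda>p. h (fst p))"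
  by (rule smooth_on_compose_linear[OF bounded_linear_fst open_U open_domain _ assms]) auto

lemma smooth_snd: "smooth_on (U \<times> (UNIV :: (real^'n^'n) set)) snd"
  by (rule smooth_on_bounded_linear[OF bounded_linear_snd open_domain])

lemma smooth_rhs: "smooth_on (U \<times> UNIV) (\<lambda>p. rhs (fst p) (snd p) v)"
  using smooth_fst[OF smooth_om] smooth_fst[OF smooth_W] smooth_snd
  unfolding smooth_on_def by (auto intro!: Ck_on_rhs open_domain)

text \<open>Solutions of the total differential equation, without any orthogonality requirement.\<close>

definition solves :: "(real^'n) set \<Rightarrow> (real^'n \<Rightarrow> real^'n^'n) \<Rightarrow> bool" where
  "solves V L \<longleftrightarrow> (\<forall>x\<in>V. (L has_derivative rhs x (L x)) (at x))"

text \<open>Bootstrapping: if \<open>L\<close> is of class \<open>C\<^sup>k\<close>, then so is its derivative \<open>rhs x (L x)\<close>.\<close>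

lemma solves_smooth:
  assumes V: "open V" "V \<subseteq> U" and L: "solves V L"
  shows "smooth_on V L"
proof -
  have "Ck_on k V L" for k
  proof (induction k)
    case 0
    show ?case using L unfolding solves_def
      by (auto intro!: continuous_at_imp_continuous_on has_derivative_continuous)
  next
    case (Suc k)
    have "Ck_on k V (\<lambda>x. om x v)" "Ck_on k V (\<lambda>x. W x v)" for v
      using smooth_om smooth_W V(2) Ck_on_mono unfolding smooth_on_def by blast+
    then show ?case
      using L Suc unfolding solves_def by (intro Ck_on_SucI[OF V(1), of L "\<lambda>x. rhs x (L x)"] Ck_on_rhs V(1)) auto
  qed
  then show ?thesis by (simp add: smooth_on_def)
qed

lemma solves_exists:
  assumes x0: "x0 \<in> U"
  obtains r L where "r > 0" "ball x0 r \<subseteq> U" "L x0 = L0" "solves (ball x0 r) L"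
proof -
  obtain r L where L: "r > 0" "L x0 = L0" "\<And>x. x \<in> ball x0 r \<Longrightarrow> (x, L x) \<in> U \<times> UNIV"
    "\<And>x. x \<in> ball x0 r \<Longrightarrow> (L has_derivative rhs (fst (x, L x)) (snd (x, L x))) (at x)"
  proof (rule total_system_exists[of "U \<times> UNIV" x0 L0 "\<lambda>p. rhs (fst p) (snd p)"])
    fix x y u v assume "(x, y :: real^'n^'n) \<in> U \<times> UNIV"
    then show "frechet_derivative (\<lambda>p. rhs (fst p) (snd p) v) (at (x, y)) (u, rhs (fst (x, y)) (snd (x, y)) u)
        = frechet_derivative (\<lambda>p. rhs (fst p) (snd p) u) (at (x, y)) (v, rhs (fst (x, y)) (snd (x, y)) v)"
      using rhs_integrable[of x y u v] by (simp add: frechet_derivative_eqI[OF rhs_derivative])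
  next
    show "smooth_on (U \<times> UNIV) (\<lambda>p. rhs (fst p) (snd p) v)" for v by (rule smooth_rhs)
  qed (use x0 in \<open>auto intro: linear_rhs open_domain\<close>)
  show thesis by (rule that[of r L]) (use L in \<open>auto simp: solves_def\<close>)
qed

lemma solves_unique:
  assumes "open V" "x0 \<in> V" "V \<subseteq> U" "solves V L" "solves V L'" "L x0 = L' x0"
  obtains r where "r > 0" "ball x0 r \<subseteq> V" "\<And>x. x \<in> ball x0 r \<Longrightarrow> L x = L' x"
proof (rule total_system_unique[of "U \<times> UNIV" x0 "L x0" "\<lambda>p. rhs (fst p) (snd p)" V L L'])
  show "smooth_on (U \<times> UNIV) (\<lambda>p. rhs (fst p) (snd p) v)" for v by (rule smooth_rhs)
qed (use assms that in \<open>auto simp: solves_def intro: linear_rhs open_domain\<close>)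

text \<open>The contributions of \<open>W\<close> to the derivative of the Gram matrix \<open>P = L L\<^sup>t\<close> cancel by skewness, and
  the remainder depends linearly on \<open>P - 1\<close>.\<close>

lemma solves_gram_derivative:
  assumes x: "x \<in> U" and L: "(L has_derivative rhs x (L x)) (at x)"
  shows "((\<lambda>y. L y $ i \<bullet> L y $ j) has_derivative (\<lambda>v.
      (L x $ i \<bullet> om x v) * (L x $ a \<bullet> L x $ j - (if a = j then 1 else 0))
    + (L x $ j \<bullet> om x v) * (L x $ i \<bullet> L x $ a - (if i = a then 1 else 0)))) (at x)"
proof -
  have row: "((\<lambda>y. L y $ i) has_derivative (\<lambda>v. rhs x (L x) v $ i)) (at x)" for i
    by (rule bounded_linear.has_derivative[OF bounded_linear_vec_nth L])
  show ?thesis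
    by (rule has_derivative_eq_rhs[OF has_derivative_inner[OF row row]])
      (simp add: fun_eq_iff rhs_nth W_inner[OF x] inner_add_left inner_add_right inner_diff_left
        inner_diff_right inner_commute[of "om x _" "L x $ _"] eq_commute[of a j] algebra_simps)
qed

text \<open>Both \<open>Q = L L\<^sup>t - 1\<close> and \<open>0\<close> solve the total differential equation with right-hand side \<open>f\<close>, in
  which \<open>L\<close> is regarded as a known function.\<close>

lemma solves_orthogonal:
  assumes V: "open V" "x0 \<in> V" "V \<subseteq> U" and L: "solves V L" and orth: "orthogonal_matrix (L x0)"
  obtains r where "r > 0" "ball x0 r \<subseteq> V" "\<And>x. x \<in> ball x0 r \<Longrightarrow> orthogonal_matrix (L x)"
proof -
  define f :: "(real^'n) \<times> (real^'n^'n) \<Rightarrow> real^'n \<Rightarrow> real^'n^'n" where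
    "f p v = (\<chi> i j. (L (fst p) $ i \<bullet> om (fst p) v) * (snd p $ a $ j)
      + (L (fst p) $ j \<bullet> om (fst p) v) * (snd p $ i $ a))" for p v
  define Q where "Q x = (\<chi> i j. L x $ i \<bullet> L x $ j - (if i = j then 1 else 0))" for x
  have open_VM: "open (V \<times> (UNIV :: (real^'n^'n) set))" by (intro open_Times V open_UNIV)
  have "smooth_on V L" by (rule solves_smooth[OF V(1,3) L])
  have c: "smooth_on (V \<times> (UNIV :: (real^'n^'n) set)) (\<lambda>p. L (fst p) $ i \<bullet> om (fst p) v)" for i v
  proof -
    have "smooth_on V (\<lambda>x. L x $ i \<bullet> om x v)"
      by (intro smooth_on_inner V smooth_on_nth \<open>smooth_on V L\<close> smooth_on_mono[OF smooth_om V(3)])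
    then show ?thesis
      by (rule smooth_on_compose_linear[OF bounded_linear_fst V(1) open_VM, rotated]) auto
  qed
  have s: "smooth_on (V \<times> (UNIV :: (real^'n^'n) set)) (\<lambda>p. snd p $ i $ j)" for i j
    by (rule smooth_on_nth[OF open_VM smooth_on_nth[OF open_VM smooth_on_bounded_linear[OF bounded_linear_snd open_VM]]])
  obtain r where r: "r > 0" "ball x0 r \<subseteq> V" "\<And>x. x \<in> ball x0 r \<Longrightarrow> Q x = 0"
  proof (rule total_system_unique[of "V \<times> UNIV" x0 0 f V Q "\<lambda>_. 0"])
    show "open (V \<times> (UNIV :: (real^'n^'n) set))" by (rule open_VM)
    show "smooth_on (V \<times> UNIV) (\<lambda>p. f p v)" for v
      unfolding f_def by (intro smooth_on_vec open_VM) (simp, intro smooth_on_add smooth_on_mult open_VM c s)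
    show "linear (f p)" if "p \<in> V \<times> UNIV" for p
    proof -
      have "fst p \<in> U" using that V(3) by auto
      then show ?thesis
        by (intro linearI) (simp_all add: om_simps f_def vec_eq_iff inner_add_right algebra_simps)
    qed
    show "Q x0 = 0" using orth by (simp add: Q_def vec_eq_iff orthogonal_matrix_rows)
    show "(Q has_derivative f (x, Q x)) (at x)" if "x \<in> V" for x
    proof (intro has_derivative_vec)
      fix i j
      have "x \<in> U" "(L has_derivative rhs x (L x)) (at x)"
        using L that V(3) by (auto simp: solves_def)
      from has_derivative_diff[OF solves_gram_derivative[OF this, of i j]
          has_derivative_const[of "if i = j then 1 else 0"]]
      show "((\<lambda>x. Q x $ i $ j) has_derivative (\<lambda>v. f (x, Q x) v $ i $ j)) (at x)"
        unfolding Q_def f_def by simp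
    qed
    show "((\<lambda>_. 0) has_derivative f (x, 0)) (at x)" for x
    proof -
      have "f (x, 0) = (\<lambda>_. 0)" by (simp add: f_def fun_eq_iff vec_eq_iff)
      then show ?thesis by simp
    qed
  qed (use V in auto)
  show thesis
    by (rule that[OF r(1,2)])
      (use r(3) in \<open>simp add: Q_def vec_eq_iff orthogonal_matrix_rows\<close>)
qed

end

section \<open>The Pfaffian system\<close>

context total_system
begin

text \<open>Both families of forms of the system in terms of the rows of the matrix: \<open>c = 1\<close>, \<open>i = a\<close> gives
  the first one and \<open>c = 0\<close> the second one.\<close>

definition pfaff :: "real \<Rightarrow> 'n \<Rightarrow> 'n \<Rightarrow> (real^'n) \<times> (real^'n^'n) \<Rightarrow> (real^'n) \<times> (real^'n^'n) \<Rightarrow> real" where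
  "pfaff c i j p q = snd q $ i \<bullet> snd p $ j + snd p $ i \<bullet> (W (fst p) (fst q) *v snd p $ j)
     + c * (snd p $ j \<bullet> om (fst p) (fst q))"

abbreviation forms where "forms \<equiv> system_forms (\<lambda>k x v. om x v $ k) W a"

lemma forms_eq: "forms = {pfaff 1 a i | i. i \<noteq> a} \<union> {pfaff 0 i j | i j. i \<noteq> a \<and> j \<noteq> a \<and> i \<noteq> j}"
proof -
  have "system_form1 (\<lambda>k x v. om x v $ k) W a i = pfaff 1 a i" for i
    by (simp add: system_form1_def pfaff_def fun_eq_iff conjugated_matrix_nth inner_vec_def[of _ "om _ _"])
      (simp add: matrix_mult_transpose_nth)
  moreover have "system_form2 W i j = pfaff 0 i j" for i j
    by (simp add: system_form2_def pfaff_def fun_eq_iff conjugated_matrix_nth)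
      (simp add: matrix_mult_transpose_nth)
  ultimately show ?thesis by (simp add: system_forms_def)
qed

lemma forms_cases:
  assumes "\<theta> \<in> forms"
  obtains c i j where "\<theta> = pfaff c i j" "c = 1 \<and> i = a \<and> j \<noteq> a \<or> c = 0 \<and> i \<noteq> a \<and> j \<noteq> a \<and> i \<noteq> j"
  using assms unfolding forms_eq by blast

lemma orthogonal_tangent_iff:
  "(v, M) \<in> orthogonal_tangent (x, A) \<longleftrightarrow> (\<forall>i j. M $ i \<bullet> A $ j + A $ i \<bullet> M $ j = 0)"
  by (simp add: orthogonal_tangent_def vec_eq_iff matrix_mult_transpose_nth)

lemma rows_determine:
  fixes A :: "real^'n^'n"
  assumes "orthogonal_matrix A" "\<And>j. p \<bullet> A $ j = q \<bullet> A $ j"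
  shows "p = q"
proof -
  have "A *v (p - q) = 0"
    using assms(2) by (simp add: vec_eq_iff matrix_vector_mul_component inner_diff_right inner_commute)
  then have "transpose A *v (A *v (p - q)) = 0" by simp
  then show ?thesis using assms(1) by (simp add: matrix_vector_mul_assoc orthogonal_matrix)
qed

text \<open>On \<open>U \<times> O(n)\<close> the common kernel of the forms is the graph of \<open>v \<mapsto> rhs x A v\<close>: tangency to \<open>O(n)\<close>
  says that the matrix with entries \<open>M\<^sub>i \<bullet> A\<^sub>j\<close> is skew, and the forms prescribe its entries off the
  diagonal, those in column \<open>a\<close> by way of those in row \<open>a\<close>.\<close>

lemma kernel_iff:
  assumes x: "x \<in> U" and A: "orthogonal_matrix A"
  shows "(v, M) \<in> orthogonal_tangent (x, A) \<and> (\<forall>\<theta>\<in>forms. \<theta> (x, A) (v, M) = 0) \<longleftrightarrow> M = rhs x A v"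
proof -
  have on: "A $ i \<bullet> A $ j = (if i = j then 1 else 0)" for i j
    using A by (simp add: orthogonal_matrix_rows)
  have rhs_row: "rhs x A v $ i \<bullet> A $ j = - (A $ i \<bullet> (W x v *v A $ j))
      + (A $ i \<bullet> om x v) * (if a = j then 1 else 0) - (if i = a then 1 else 0) * (A $ j \<bullet> om x v)" for i j
    by (simp add: rhs_nth inner_add_left inner_diff_left W_inner[OF x] on inner_commute[of "om x v"])
  have W_swap: "A $ i \<bullet> (W x v *v A $ j) = - (A $ j \<bullet> (W x v *v A $ i))" for i j
    using W_inner[OF x, of v "A $ j" "A $ i"] by (simp add: inner_commute)
  show ?thesis
  proof
    assume *: "(v, M) \<in> orthogonal_tangent (x, A) \<and> (\<forall>\<theta>\<in>forms. \<theta> (x, A) (v, M) = 0)"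
    then have tangent: "M $ i \<bullet> A $ j + A $ i \<bullet> M $ j = 0" for i j
      unfolding orthogonal_tangent_iff by blast
    have skew: "M $ j \<bullet> A $ i = - (M $ i \<bullet> A $ j)" for i j
      using tangent[of i j] inner_commute[of "A $ i" "M $ j"] by linarith
    have f1: "M $ a \<bullet> A $ i + A $ a \<bullet> (W x v *v A $ i) + A $ i \<bullet> om x v = 0" if "i \<noteq> a" for i
    proof -
      have "pfaff 1 a i \<in> forms" using that unfolding forms_eq by blast
      then have "pfaff 1 a i (x, A) (v, M) = 0" using * by blast
      then show ?thesis by (simp add: pfaff_def)
    qed
    have f2: "M $ i \<bullet> A $ j + A $ i \<bullet> (W x v *v A $ j) = 0" if "i \<noteq> a" "j \<noteq> a" "i \<noteq> j" for i j
    proof -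
      have "pfaff 0 i j \<in> forms" using that unfolding forms_eq by blast
      then have "pfaff 0 i j (x, A) (v, M) = 0" using * by blast
      then show ?thesis by (simp add: pfaff_def)
    qed
    have "M $ i \<bullet> A $ j = rhs x A v $ i \<bullet> A $ j" for i j
    proof -
      consider "i = j" | "i = a" "j \<noteq> a" | "i \<noteq> a" "j = a" | "i \<noteq> a" "j \<noteq> a" "i \<noteq> j" by blast
      then show ?thesis
      proof cases
        case 1
        then show ?thesis using skew[of j j] W_inner_self[OF x, of "A $ j"] by (simp add: rhs_row)
      next
        case 2
        then show ?thesis using f1[of j] by (simp add: rhs_row)
      next
        case 3
        then show ?thesis using f1[of i] skew[of i a] W_swap[of i a] by (simp add: rhs_row)
      next
        case 4
        then show ?thesis using f2[of i j] by (simp add: rhs_row)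
      qed
    qed
    then have "M $ i = rhs x A v $ i" for i by (rule rows_determine[OF A])
    then show "M = rhs x A v" by (simp add: vec_eq_iff)
  next
    assume M: "M = rhs x A v"
    have "rhs x A v $ i \<bullet> A $ j + A $ i \<bullet> rhs x A v $ j = 0" for i j
      using W_swap[of i j] by (simp add: rhs_row inner_commute[of "A $ i" "rhs x A v $ j"])
    moreover have "\<theta> (x, A) (v, M) = 0" if "\<theta> \<in> forms" for \<theta>
      using that by (rule forms_cases) (auto simp: pfaff_def M rhs_row)
    ultimately show "(v, M) \<in> orthogonal_tangent (x, A) \<and> (\<forall>\<theta>\<in>forms. \<theta> (x, A) (v, M) = 0)"
      unfolding M orthogonal_tangent_iff by blast
  qed
qed

lemma pfaff_derivative:
  assumes x: "x \<in> U"
  shows "((\<lambda>p. pfaff c i j p (v, N)) has_derivative (\<lambda>q. N $ i \<bullet> snd q $ j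
      + (A $ i \<bullet> (W x v *v snd q $ j + d_W x (fst q) v *v A $ j) + snd q $ i \<bullet> (W x v *v A $ j))
      + c * (A $ j \<bullet> d_om x (fst q) v + snd q $ j \<bullet> om x v))) (at (x, A))"
proof -
  note d = fst_derivative[OF d_om_derivative[OF x]] fst_derivative[OF d_W_derivative[OF x]] snd_nth_derivative
  note m = bounded_bilinear.FDERIV[OF bounded_bilinear_matrix_vector]
  have "((\<lambda>p. N $ i \<bullet> snd p $ j + snd p $ i \<bullet> (W (fst p) v *v snd p $ j) + c * (snd p $ j \<bullet> om (fst p) v))
    has_derivative (\<lambda>q. N $ i \<bullet> snd q $ j
      + (snd (x, A) $ i \<bullet> (W (fst (x, A)) v *v snd q $ j + d_W x (fst q) v *v snd (x, A) $ j)
        + snd q $ i \<bullet> (W (fst (x, A)) v *v snd (x, A) $ j))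
      + c * (snd (x, A) $ j \<bullet> d_om x (fst q) v + snd q $ j \<bullet> om (fst (x, A)) v))) (at (x, A))"
    by (intro has_derivative_add m d has_derivative_inner has_derivative_inner_right has_derivative_mult_right)
  then show ?thesis by (simp add: pfaff_def)
qed

lemma pfaff_smooth: "smooth_1form_on (U \<times> UNIV) (pfaff c i j)"
  unfolding smooth_1form_on_def
proof (intro conjI ballI allI)
  show "linear (pfaff c i j p)" if "p \<in> U \<times> UNIV" for p
  proof -
    have "fst p \<in> U" using that by auto
    then show ?thesis
      by (intro linearI) (simp_all add: pfaff_def om_simps W_simps inner_add_left inner_add_right
          matrix_vector_mult_add_rdistrib scaleR_matrix_vector_assoc[symmetric] algebra_simps)
  qed
  fix q :: "(real^'n) \<times> (real^'n^'n)"
  have row: "smooth_on (U \<times> (UNIV :: (real^'n^'n) set)) (\<lambda>p. snd p $ i)" for i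
    by (rule smooth_on_nth[OF open_domain smooth_snd])
  have "smooth_on (U \<times> UNIV) (\<lambda>p. W (fst p) (fst q) *v snd p $ j)"
    using bounded_bilinear.Ck_on_prod[OF bounded_bilinear_matrix_vector open_domain]
      smooth_fst[OF smooth_W] row unfolding smooth_on_def by blast
  then show "smooth_on (U \<times> UNIV) (\<lambda>p. pfaff c i j p q)"
    unfolding pfaff_def
    by (intro smooth_on_add smooth_on_mult smooth_on_inner open_domain smooth_on_const row
        smooth_fst[OF smooth_om])
qed

text \<open>Exterior derivatives of the forms vanish on the common kernel.\<close>

lemma pfaff_ext_deriv:
  assumes x: "x \<in> U" and A: "orthogonal_matrix A"
    and ij: "c = 1 \<and> i = a \<and> j \<noteq> a \<or> c = 0 \<and> i \<noteq> a \<and> j \<noteq> a \<and> i \<noteq> j"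
  shows "ext_deriv (pfaff c i j) (x, A) (u, rhs x A u) (v, rhs x A v) = 0"
proof -
  have on: "A $ i \<bullet> A $ j = (if i = j then 1 else 0)" for i j
    using A by (simp add: orthogonal_matrix_rows)
  show ?thesis
    using ij
    by (auto simp: ext_deriv_def frechet_derivative_eqI[OF pfaff_derivative[OF x]] rhs_nth
        d_W_commute[OF x, of u v] d_om_commute[OF x, of u v] W_inner[OF x] on
        inner_add_left inner_add_right inner_diff_left inner_diff_right inner_commute[of "om x _" "A $ _"]
        inner_commute[of "om x v" "om x u"]
        matrix_vector_right_distrib matrix_vector_mult_diff_distrib matrix_vector_mult_scaleR algebra_simps)
qed

lemma system_integrable: "integrable_system_on U (\<lambda>k x v. om x v $ k) W a"
  unfolding integrable_system_on_def frobenius_integrable_def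
proof (intro conjI ballI allI impI)
  show "smooth_1form_on (U \<times> UNIV) \<theta>" if "\<theta> \<in> forms" for \<theta>
    using that by (rule forms_cases) (simp add: pfaff_smooth)
next
  fix p :: "(real^'n) \<times> (real^'n^'n)" assume "p \<in> U \<times> {A. orthogonal_matrix A}"
  then obtain x A where p: "p = (x, A)" and x: "x \<in> U" and A: "orthogonal_matrix A" by blast
  have kernel: "{\<xi> \<in> orthogonal_tangent p. \<forall>\<theta>\<in>forms. \<theta> p \<xi> = 0} = range (\<lambda>v. (v, rhs x A v))"
    using kernel_iff[OF x A] unfolding p by auto
  have "linear (\<lambda>v. (v, rhs x A v))"
    using linear_rhs[OF x, of A] by (auto simp: linear_iff)
  then have "dim (range (\<lambda>v. (v, rhs x A v))) = dim (UNIV :: (real^'n) set)"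
    by (rule dim_image_eq) (auto intro: inj_onI)
  then show "dim {\<xi> \<in> orthogonal_tangent p. \<forall>\<theta>\<in>forms. \<theta> p \<xi> = 0} = CARD('n)"
    unfolding kernel by simp
next
  fix p \<xi> \<eta> \<theta>
  assume "p \<in> U \<times> {A. orthogonal_matrix A}"
    and \<xi>\<eta>: "\<xi> \<in> orthogonal_tangent p" "\<eta> \<in> orthogonal_tangent p"
      "\<forall>\<theta>\<in>forms. \<theta> p \<xi> = 0 \<and> \<theta> p \<eta> = 0"
    and \<theta>: "\<theta> \<in> forms"
  then obtain x A where p: "p = (x, A)" and x: "x \<in> U" and A: "orthogonal_matrix A" by blast
  have "\<xi> = (fst \<xi>, rhs x A (fst \<xi>))" "\<eta> = (fst \<eta>, rhs x A (fst \<eta>))"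
    using kernel_iff[OF x A, of "fst \<xi>" "snd \<xi>"] kernel_iff[OF x A, of "fst \<eta>" "snd \<eta>"] \<xi>\<eta>
    unfolding p by (auto simp: prod_eq_iff)
  then show "ext_deriv \<theta> p \<xi> \<eta> = 0"
    using \<theta> pfaff_ext_deriv[OF x A] unfolding p by (metis forms_cases)
qed

lemma matrix_differential_eq:
  assumes "(L has_derivative L') (at x)"
  shows "matrix_differential L x v = L' v"
proof -
  have "frechet_derivative (\<lambda>y. L y $ i $ j) (at x) v = L' v $ i $ j" for i j
    using vector_derivative_nth[OF bounded_linear.has_derivative[OF bounded_linear_vec_nth assms], of i j v]
    by simp
  then show ?thesis by (simp add: matrix_differential_def vec_eq_iff)
qed

text \<open>For maps into \<open>O(n)\<close> the system is equivalent to the total differential equation; tangency to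
  \<open>O(n)\<close> comes from differentiating \<open>L L\<^sup>t = 1\<close>.\<close>

lemma solution_on_iff:
  assumes V: "open V" "V \<subseteq> U"
  shows "solution_on V (\<lambda>k x v. om x v $ k) W a L \<longleftrightarrow> solves V L \<and> (\<forall>x\<in>V. orthogonal_matrix (L x))"
proof
  assume L: "solution_on V (\<lambda>k x v. om x v $ k) W a L"
  then have smooth: "smooth_on V L" and orth: "\<And>x. x \<in> V \<Longrightarrow> orthogonal_matrix (L x)"
    and eq: "\<And>\<theta> x v. \<theta> \<in> forms \<Longrightarrow> x \<in> V \<Longrightarrow> \<theta> (x, L x) (v, matrix_differential L x v) = 0"
    unfolding solution_on_def by blast+
  have "(L has_derivative rhs x (L x)) (at x)" if x: "x \<in> V" for x
  proof -
    note d = smooth_on_has_derivative[OF smooth x]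
    define L' where "L' = frechet_derivative L (at x)"
    have L': "matrix_differential L x v = L' v" for v
      unfolding L'_def by (rule matrix_differential_eq[OF d])
    have "L' v $ i \<bullet> L x $ j + L x $ i \<bullet> L' v $ j = 0" for v i j
    proof -
      have row: "((\<lambda>y. L y $ i) has_derivative (\<lambda>v. L' v $ i)) (at x)" for i
        unfolding L'_def by (rule bounded_linear.has_derivative[OF bounded_linear_vec_nth d])
      have "frechet_derivative (\<lambda>y. L y $ i \<bullet> L y $ j) (at x)
          = frechet_derivative (\<lambda>_. if i = j then 1 else 0) (at x)"
        by (rule frechet_derivative_cong_open[OF V(1) x]) (use orth in \<open>simp add: orthogonal_matrix_rows\<close>)
      then have "frechet_derivative (\<lambda>y. L y $ i \<bullet> L y $ j) (at x) v = 0" by simp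
      then have "L x $ i \<bullet> L' v $ j + L' v $ i \<bullet> L x $ j = 0"
        by (simp only: frechet_derivative_eqI[OF has_derivative_inner[OF row row]])
      then show ?thesis by simp
    qed
    then have "(v, L' v) \<in> orthogonal_tangent (x, L x)" for v
      unfolding orthogonal_tangent_iff by blast
    then have "L' v = rhs x (L x) v" for v
    proof -
      have "x \<in> U" using V(2) x by blast
      then show ?thesis
        using \<open>(v, L' v) \<in> orthogonal_tangent (x, L x)\<close> eq[OF _ x, of _ v] unfolding L'
        by (intro kernel_iff[THEN iffD1] conjI ballI orth x)
    qed
    then have "L' = rhs x (L x)" by (rule ext)
    then show ?thesis using d by (simp add: L'_def)
  qed
  then show "solves V L \<and> (\<forall>x\<in>V. orthogonal_matrix (L x))"
    using orth by (auto simp: solves_def)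
next
  assume L: "solves V L \<and> (\<forall>x\<in>V. orthogonal_matrix (L x))"
  have "\<theta> (x, L x) (v, matrix_differential L x v) = 0" if "\<theta> \<in> forms" "x \<in> V" for \<theta> x v
  proof -
    have "matrix_differential L x v = rhs x (L x) v"
      using L that(2) by (intro matrix_differential_eq) (auto simp: solves_def)
    then show ?thesis
      using kernel_iff[of x "L x" v] L that V(2) by blast
  qed
  then show "solution_on V (\<lambda>k x v. om x v $ k) W a L"
    using L solves_smooth[OF V] by (auto simp: solution_on_def)
qed

lemma first_form_closed:
  assumes V: "open V" "V \<subseteq> U" and L: "solves V L"
  shows "closed_1form_on V (\<lambda>x v. \<Sum>k\<in>UNIV. L x $ a $ k * om x v $ k)"
proof -
  have eq: "(\<lambda>x v. \<Sum>k\<in>UNIV. L x $ a $ k * om x v $ k) = (\<lambda>x v. L x $ a \<bullet> om x v)"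
    by (simp add: inner_vec_def)
  have "linear (\<lambda>v. L x $ a \<bullet> om x v)" if "x \<in> V" for x
    using that V(2) by (intro linearI) (auto simp: om_simps inner_add_right)
  moreover have "smooth_on V (\<lambda>x. L x $ a \<bullet> om x v)" for v
    by (intro smooth_on_inner V smooth_on_nth solves_smooth[OF V L] smooth_on_mono[OF smooth_om V(2)])
  moreover have "ext_deriv (\<lambda>x v. L x $ a \<bullet> om x v) x u v = 0" if x: "x \<in> V" for x u v
  proof -
    have xU: "x \<in> U" using x V(2) by blast
    have row: "((\<lambda>y. L y $ a) has_derivative (\<lambda>v. rhs x (L x) v $ a)) (at x)"
      using L x by (intro bounded_linear.has_derivative[OF bounded_linear_vec_nth]) (simp add: solves_def)
    show ?thesis
      unfolding ext_deriv_def frechet_derivative_eqI[OF has_derivative_inner[OF row d_om_derivative[OF xU]]]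
      by (simp add: rhs_nth d_om_commute[OF xU, of u v] W_inner[OF xU] inner_add_left inner_add_right
          inner_diff_left inner_diff_right inner_commute[of "om x v" "om x u"] algebra_simps)
  qed
  ultimately show ?thesis by (simp add: eq closed_1form_on_def smooth_1form_on_def)
qed

lemma solution_exists:
  assumes x0: "x0 \<in> U" and L0: "orthogonal_matrix L0"
  obtains V L where "open V" "x0 \<in> V" "V \<subseteq> U" "solves V L" "\<And>x. x \<in> V \<Longrightarrow> orthogonal_matrix (L x)" "L x0 = L0"
proof -
  obtain r L where L: "r > 0" "ball x0 r \<subseteq> U" "L x0 = L0" "solves (ball x0 r) L"
    using solves_exists[OF x0] by blast
  obtain s where s: "s > 0" "ball x0 s \<subseteq> ball x0 r" "\<And>x. x \<in> ball x0 s \<Longrightarrow> orthogonal_matrix (L x)"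
    using solves_orthogonal[of "ball x0 r" x0 L] L L0 by auto
  show thesis
    by (rule that[of "ball x0 s" L]) (use L s in \<open>auto simp: solves_def\<close>)
qed

end

section \<open>Solutions as orthonormal frames\<close>

lemma (in orthonormal_frame) rotated_frame_orthonormal:
  assumes V: "open V" "V \<subseteq> U" and L: "smooth_on V L" "\<And>x. x \<in> V \<Longrightarrow> orthogonal_matrix (L x)"
  shows "orthonormal_frame_on V g (rotated_frame L e)"
  unfolding orthonormal_frame_on_def
proof (intro conjI allI ballI)
  show "smooth_on V (rotated_frame L e i)" for i
    unfolding rotated_frame_def[abs_def]
    by (intro smooth_on_sum smooth_on_scaleR V smooth_on_nth L smooth_on_mono[OF smooth_e V(2)])
  fix x i j assume x: "x \<in> V"
  then have xU: "x \<in> U" using V by blast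
  have "g x (rotated_frame L e i x) (rotated_frame L e j x) = L x $ i \<bullet> L x $ j"
    by (simp add: rotated_frame_def g_sum[OF xU] g_simps[OF xU] g_e[OF xU] inner_vec_def if_distrib
        mult.commute cong: if_cong)
  then show "g x (rotated_frame L e i x) (rotated_frame L e j x) = (if i = j then 1 else 0)"
    using L(2)[OF x] by (simp add: orthogonal_matrix_rows)
qed

theorem theorem4:
  fixes U :: "(real^'n) set" and g :: "'n metric"
    and nabla :: "'n vfield \<Rightarrow> 'n vfield \<Rightarrow> 'n vfield"
    and e :: "'n \<Rightarrow> 'n vfield" and \<omega> :: "'n \<Rightarrow> real^'n \<Rightarrow> real^'n \<Rightarrow> real"
    and W :: "real^'n \<Rightarrow> real^'n \<Rightarrow> real^'n^'n"
    and a :: 'n and x0 :: "real^'n" and L0 :: "real^'n^'n"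
  assumes "CARD('n) \<ge> 2"
    and "open U"
    and "riemannian_metric_on U g"
    and "levi_civita_on U g nabla"
    and "constant_curvature_on U g nabla (-1)"
    and "orthonormal_frame_on U g e"
    and "dual_forms_on U e \<omega>"
    and "W = connection_matrix g nabla e"
    and "x0 \<in> U"
    and "orthogonal_matrix L0"
  shows
    "integrable_system_on U \<omega> W a \<and>
     (\<exists>V L. open V \<and> x0 \<in> V \<and> V \<subseteq> U \<and> solution_on V \<omega> W a L \<and> L x0 = L0 \<and>
        orthonormal_frame_on V g (rotated_frame L e)) \<and>
     (\<forall>V L V' L'. open V \<and> x0 \<in> V \<and> V \<subseteq> U \<and> solution_on V \<omega> W a L \<and> L x0 = L0 \<and>
        open V' \<and> x0 \<in> V' \<and> V' \<subseteq> U \<and> solution_on V' \<omega> W a L' \<and> L' x0 = L0 \<longrightarrow>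
        (\<exists>N. open N \<and> x0 \<in> N \<and> N \<subseteq> V \<inter> V' \<and> (\<forall>x\<in>N. L x = L' x))) \<and>
     (\<forall>V L. open V \<and> V \<subseteq> U \<and> solution_on V \<omega> W a L \<longrightarrow>
        closed_1form_on V (\<lambda>x v. \<Sum>k\<in>UNIV. L x $ a $ k * \<omega> k x v))"
proof -
  interpret fr: orthonormal_frame U g nabla e \<omega>
    using assms(2-4,6,7) by unfold_locales
  interpret total_system U fr.om W a
    using fr.structure_equations[OF assms(5)] unfolding assms(8) by (rule total_system.intro)
  have \<omega>: "\<omega> = (\<lambda>k x v. fr.om x v $ k)"
    by (simp add: fun_eq_iff fr.om_nth)
  note sol = solution_on_iff[folded \<omega>]
  have "\<exists>V L. open V \<and> x0 \<in> V \<and> V \<subseteq> U \<and> solution_on V \<omega> W a L \<and> L x0 = L0 \<and>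
        orthonormal_frame_on V g (rotated_frame L e)"
  proof -
    obtain V L where V: "open V" "x0 \<in> V" "V \<subseteq> U" and L: "solves V L"
      "\<And>x. x \<in> V \<Longrightarrow> orthogonal_matrix (L x)" "L x0 = L0"
      using solution_exists[OF assms(9,10)] by blast
    have "orthonormal_frame_on V g (rotated_frame L e)"
      by (rule fr.rotated_frame_orthonormal[OF V(1,3) solves_smooth[OF V(1,3) L(1)] L(2)])
    moreover have "solution_on V \<omega> W a L"
      unfolding sol[OF V(1,3)] using L by simp
    ultimately show ?thesis using V L(3) by (intro exI[of _ V] exI[of _ L] conjI)
  qed
  moreover have "\<exists>N. open N \<and> x0 \<in> N \<and> N \<subseteq> V \<inter> V' \<and> (\<forall>x\<in>N. L x = L' x)"
    if V: "open V" "x0 \<in> V" "V \<subseteq> U" "open V'" "x0 \<in> V'" "V' \<subseteq> U"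
      and L: "solution_on V \<omega> W a L" "L x0 = L0" "solution_on V' \<omega> W a L'" "L' x0 = L0" for V L V' L'
  proof -
    have "solves V L" "solves V' L'"
      using sol[OF V(1,3)] sol[OF V(4,6)] L by blast+
    then have solves: "solves (V \<inter> V') L" "solves (V \<inter> V') L'"
      unfolding solves_def by blast+
    have "open (V \<inter> V')" "x0 \<in> V \<inter> V'" "V \<inter> V' \<subseteq> U" "L x0 = L' x0"
      using V L by auto
    from solves_unique[OF this(1-3) solves this(4)]
    obtain r where "r > 0" "ball x0 r \<subseteq> V \<inter> V'" "\<And>x. x \<in> ball x0 r \<Longrightarrow> L x = L' x"
      by metis
    then show ?thesis by (intro exI[of _ "ball x0 r"]) auto
  qed
  moreover have "closed_1form_on V (\<lambda>x v. \<Sum>k\<in>UNIV. L x $ a $ k * \<omega> k x v)"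
    if "open V" "V \<subseteq> U" "solution_on V \<omega> W a L" for V L
  proof -
    have "solves V L" using sol[OF that(1,2)] that(3) by blast
    from first_form_closed[OF that(1,2) this] show ?thesis by (simp only: fr.om_nth)
  qed
  ultimately show ?thesis using system_integrable[folded \<omega>] by blast
qed

end
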